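(* Let $n\ge1$ and let $\Bbbk$ be a field. Let $Q$ be the quiver of $\Bbbk\,\mathcal{PC}_n\simeq\Bbbk\,\mathcal{EC}_n$: its vertices are the subsets of $[n]$, and its arrows are the morphisms $d_i^A:A\to A_i$, one for each $A\subseteq[n]$ and each $i\in A$ with $i\ge2$. Then a quiver presentation of these algebras is given by $Q$ together with the relations $$d_i^{A_j}d_j^A=d_j^{A_i}d_i^A\qquad(j>i+1,\ i,j\in A),$$ $$d_i^{A_{i+1}}d_{i+1}^A=d_i^{(A_i)_{i+1}}d_{i+1}^{A_i}d_i^A\qquad(i,i+1\in A),$$ for every $A\subseteq[n]$ (and all indices $i,j$ for which the arrows involved are defined, i.e. $i\ge 2$).
   Context: $[n]=\{1,\dots,n\}$. $\mathcal{PC}_n$ is the monoid (under composition) of all partial functions $f$ on $[n]$ that are order-preserving ($x\le y\Rightarrow f(x)\le f(y)$ for $x,y$ in the domain) and order-decreasing ($f(x)\le x$ for $x$ in the domain); $\Bbbk\mathcal{PC}_n$ is its monoid algebra. $\mathcal{EC}_n$ is the category whose objects are all subsets of $[n]$ and whose morphisms $A\to B$ are the order-preserving and order-decreasing onto functions with domain $A$ and range $B$. It is known that $\Bbbk\mathcal{PC}_n\simeq\Bbbk\mathcal{EC}_n$ as algebras. For $A\subseteq[n]$ and $i\in A$, $i\ge2$, put $A_i=(A\cup\{i-1\})\setminus\{i\}$ and let $d_i^A:A\to A_i$ be the morphism of $\mathcal{EC}_n$ with $d_i^A(i)=i-1$ and $d_i^A(x)=x$ for $x\in A\setminus\{i\}$.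 These are exactly the irreducible morphisms of $\mathcal{EC}_n$ (non-isomorphisms $m$ such that $m=m'm''$ implies that $m'$ or $m''$ is an isomorphism). For a finite category $E$, the category algebra $\Bbbk E$ has basis the morphisms of $E$, with $m'\cdot m=m'm$ if the composition is defined and $0$ otherwise. Composition, also of paths, is from right to left. For a graph $Q$, $Q^*$ is the free category on $Q$ (morphisms are paths, including one empty path per vertex). $L_\Bbbk[E]$ is the $\Bbbk$-linear category with the same objects as $E$ whose hom-spaces have bases the hom-sets of $E$, with bilinearly extended composition. For a relation $R$ on morphisms of $L_\Bbbk[Q^*]$ (relating only morphisms with the same domain and range), $\rho_R$ is the smallest congruence containing $R$ that is both a category congruence and a vector space congruence on each hom-space. An algebra $A$ is split basic if $A/\mathrm{Rad}\,A\simeq\Bbbk^r$ for some $r$. For such $A$ with complete set of primitive orthogonal idempotents $\{e_1,\dots,e_r\}$, $\mathscr{L}(A)$ is the $\Bbbk$-linear category with objects $e_1,\dots,e_r$ and $\mathscr{L}(A)(e_i,e_j)=e_jAe_i$, composition being multiplication in $A$. The quiver of $A$ has vertices $e_1,\dots,e_r$ and, as arrows from $e_k$ to $e_l$, a basis of $e_l(\mathrm{Rad}A/\mathrm{Rad}^2A)e_k$. A quiver presentation of $A$ is a pair $(Q,R)$ where $Q$ is the quiver of $A$ and $L_\Bbbk[Q^*]/\rho_R\simeq\mathscr{L}(A)$. *)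

theory Defs
  imports
    "HOL-Algebra.Algebraic_Closure_Type"
    "HOL-Algebra.QuotRing"
    "HOL-Algebra.Ideal_Product"
    "HOL-Algebra.Module"
    "HOL-Library.Poly_Mapping"
    "Graph_Theory.Digraph"
    "Graph_Theory.Arc_Walk"
begin

section \<open>Associative unital algebras over a field\<close>

text \<open>
  The ground field is an arbitrary type of class \<open>field\<close>; \<open>ring_of_type_algebra\<close> turns it into
  a ring record, so that an algebra is a (not necessarily commutative) ring which is also a module
  over that record, with bilinear multiplication.
\<close>

locale k_algebra =
  module "ring_of_type_algebra :: 'k::field ring" A + A: ring A
  for A :: "('k::field, 'a) module" (structure) +
  assumes smult_mult_left:
    "\<lbrakk>x \<in> carrier A; y \<in> carrier A\<rbrakk> \<Longrightarrow> (c \<odot>\<^bsub>A\<^esub> x) \<otimes>\<^bsub>A\<^esub> y = c \<odot>\<^bsub>A\<^esub> (x \<otimes>\<^bsub>A\<^esub> y)"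
  and smult_mult_right:
    "\<lbrakk>x \<in> carrier A; y \<in> carrier A\<rbrakk> \<Longrightarrow> x \<otimes>\<^bsub>A\<^esub> (c \<odot>\<^bsub>A\<^esub> y) = c \<odot>\<^bsub>A\<^esub> (x \<otimes>\<^bsub>A\<^esub> y)"

definition algebras_isomorphic :: "('k, 'a) module \<Rightarrow> ('k, 'b) module \<Rightarrow> bool" where
  "algebras_isomorphic A B \<longleftrightarrow>
     (\<exists>h \<in> ring_iso A B. \<forall>c. \<forall>x \<in> carrier A. h (c \<odot>\<^bsub>A\<^esub> x) = c \<odot>\<^bsub>B\<^esub> h x)"

text \<open>The library's quotient ring \<open>A Quot I\<close>, equipped with the induced scalar multiplication.\<close>

definition quotient_algebra :: "('k, 'a) module \<Rightarrow> 'a set \<Rightarrow> ('k, 'a set) module" where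
  "quotient_algebra A I =
     \<lparr>carrier = carrier (A Quot I),
      monoid.mult = monoid.mult (A Quot I), one = \<one>\<^bsub>A Quot I\<^esub>,
      zero = \<zero>\<^bsub>A Quot I\<^esub>, add = add (A Quot I),
      module.smult = (\<lambda>c S. \<Union>x\<in>S. I +>\<^bsub>A\<^esub> (c \<odot>\<^bsub>A\<^esub> x))\<rparr>"

definition power_algebra :: "nat \<Rightarrow> ('k::field, nat \<Rightarrow> 'k) module" where
  "power_algebra r =
     \<lparr>carrier = {..<r} \<rightarrow>\<^sub>E UNIV,
      monoid.mult = (\<lambda>f g. \<lambda>i\<in>{..<r}. f i * g i), one = (\<lambda>i\<in>{..<r}. 1),
      zero = (\<lambda>i\<in>{..<r}. 0), add = (\<lambda>f g. \<lambda>i\<in>{..<r}. f i + g i),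
      module.smult = (\<lambda>c f. \<lambda>i\<in>{..<r}. c * f i)\<rparr>"

definition left_ideal :: "'a set \<Rightarrow> ('a, 'x) ring_scheme \<Rightarrow> bool" where
  "left_ideal I A \<longleftrightarrow> additive_subgroup I A \<and> (\<forall>a\<in>carrier A. \<forall>x\<in>I. a \<otimes>\<^bsub>A\<^esub> x \<in> I)"

definition maximal_left_ideal :: "'a set \<Rightarrow> ('a, 'x) ring_scheme \<Rightarrow> bool" where
  "maximal_left_ideal M A \<longleftrightarrow>
     left_ideal M A \<and> M \<noteq> carrier A \<and>
     (\<forall>J. left_ideal J A \<and> M \<subseteq> J \<longrightarrow> J = M \<or> J = carrier A)"

text \<open>The Jacobson radical.\<close>

definition Rad :: "('a, 'x) ring_scheme \<Rightarrow> 'a set" where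
  "Rad A = carrier A \<inter> \<Inter>{M. maximal_left_ideal M A}"

abbreviation Rad2 :: "('a, 'x) ring_scheme \<Rightarrow> 'a set" where
  "Rad2 A \<equiv> ideal_prod A (Rad A) (Rad A)"

definition split_basic :: "('k::field, 'a) module \<Rightarrow> bool" where
  "split_basic A \<longleftrightarrow>
     k_algebra A \<and>
     (\<exists>r. algebras_isomorphic (quotient_algebra A (Rad A)) (power_algebra r))"

definition idempotent :: "('a, 'x) ring_scheme \<Rightarrow> 'a \<Rightarrow> bool" where
  "idempotent A e \<longleftrightarrow> e \<in> carrier A \<and> e \<otimes>\<^bsub>A\<^esub> e = e"

definition orthogonal :: "('a, 'x) ring_scheme \<Rightarrow> 'a \<Rightarrow> 'a \<Rightarrow> bool" where
  "orthogonal A e f \<longleftrightarrow> e \<otimes>\<^bsub>A\<^esub> f = \<zero>\<^bsub>A\<^esub> \<and> f \<otimes>\<^bsub>A\<^esub> e = \<zero>\<^bsub>A\<^esub>"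

definition primitive_idempotent :: "('a, 'x) ring_scheme \<Rightarrow> 'a \<Rightarrow> bool" where
  "primitive_idempotent A e \<longleftrightarrow>
     idempotent A e \<and> e \<noteq> \<zero>\<^bsub>A\<^esub> \<and>
     (\<forall>f g. idempotent A f \<and> idempotent A g \<and> orthogonal A f g \<and> e = f \<oplus>\<^bsub>A\<^esub> g
        \<longrightarrow> f = \<zero>\<^bsub>A\<^esub> \<or> g = \<zero>\<^bsub>A\<^esub>)"

definition complete_primitive_orthogonal_idempotents ::
    "('a, 'x) ring_scheme \<Rightarrow> 'a set \<Rightarrow> bool" where
  "complete_primitive_orthogonal_idempotents A E \<longleftrightarrow>
     finite E \<and> (\<forall>e\<in>E. primitive_idempotent A e) \<and>
     (\<forall>e\<in>E. \<forall>f\<in>E. e \<noteq> f \<longrightarrow> orthogonal A e f) \<and>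
     (\<Oplus>\<^bsub>A\<^esub>e\<in>E. e) = \<one>\<^bsub>A\<^esub>"

text \<open>\<open>B\<close> is a (finite) basis of the subspace \<open>V\<close>: it lies in \<open>V\<close>, is linearly independent, and
  \<open>V\<close> is its linear span.\<close>

definition is_basis :: "('k::field, 'a) module \<Rightarrow> 'a set \<Rightarrow> 'a set \<Rightarrow> bool" where
  "is_basis M V B \<longleftrightarrow>
     finite B \<and> B \<subseteq> V \<and>
     (\<forall>c. (\<Oplus>\<^bsub>M\<^esub>b\<in>B. c b \<odot>\<^bsub>M\<^esub> b) = \<zero>\<^bsub>M\<^esub> \<longrightarrow> (\<forall>b\<in>B. c b = 0)) \<and>
     V = {\<Oplus>\<^bsub>M\<^esub>b\<in>B. c b \<odot>\<^bsub>M\<^esub> b |c. True}"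

section \<open>Categories and linear categories\<close>

record ('o, 'm) cat =
  Obj :: "'o set"
  Mor :: "'m set"
  Src :: "'m \<Rightarrow> 'o"
  Trg :: "'m \<Rightarrow> 'o"
  Ident :: "'o \<Rightarrow> 'm"
  Comp :: "'m \<Rightarrow> 'm \<Rightarrow> 'm"

text \<open>\<open>Comp C g f\<close> is ``\<open>g\<close> after \<open>f\<close>'', relevant only when \<open>Src C g = Trg C f\<close>.\<close>

definition cat_hom :: "('o, 'm) cat \<Rightarrow> 'o \<Rightarrow> 'o \<Rightarrow> 'm set" where
  "cat_hom C a b = {f \<in> Mor C. Src C f = a \<and> Trg C f = b}"

text \<open>In a linear category the hom-sets need not be disjoint, hence the operations are indexed by
  objects: \<open>LComp C a b c\<close> takes a morphism \<open>b \<rightarrow> c\<close> and a morphism \<open>a \<rightarrow> b\<close> to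
  their composite \<open>a \<rightarrow> c\<close>.\<close>

record ('o, 'm, 'k) lin_cat =
  LObj :: "'o set"
  LHom :: "'o \<Rightarrow> 'o \<Rightarrow> 'm set"
  LIdent :: "'o \<Rightarrow> 'm"
  LComp :: "'o \<Rightarrow> 'o \<Rightarrow> 'o \<Rightarrow> 'm \<Rightarrow> 'm \<Rightarrow> 'm"
  LAdd :: "'o \<Rightarrow> 'o \<Rightarrow> 'm \<Rightarrow> 'm \<Rightarrow> 'm"
  LScale :: "'o \<Rightarrow> 'o \<Rightarrow> 'k \<Rightarrow> 'm \<Rightarrow> 'm"

definition lin_cats_isomorphic :: "('o, 'm, 'k) lin_cat \<Rightarrow> ('p, 'l, 'k) lin_cat \<Rightarrow> bool" where
  "lin_cats_isomorphic C D \<longleftrightarrow>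
     (\<exists>F G.
        bij_betw F (LObj C) (LObj D) \<and>
        (\<forall>a\<in>LObj C. \<forall>b\<in>LObj C. bij_betw (G a b) (LHom C a b) (LHom D (F a) (F b))) \<and>
        (\<forall>a\<in>LObj C. G a a (LIdent C a) = LIdent D (F a)) \<and>
        (\<forall>a\<in>LObj C. \<forall>b\<in>LObj C. \<forall>c\<in>LObj C. \<forall>g\<in>LHom C b c. \<forall>f\<in>LHom C a b.
           G a c (LComp C a b c g f) = LComp D (F a) (F b) (F c) (G b c g) (G a b f)) \<and>
        (\<forall>a\<in>LObj C. \<forall>b\<in>LObj C. \<forall>f\<in>LHom C a b. \<forall>g\<in>LHom C a b.
           G a b (LAdd C a b f g) = LAdd D (F a) (F b) (G a b f) (G a b g)) \<and>
        (\<forall>a\<in>LObj C. \<forall>b\<in>LObj C. \<forall>t. \<forall>f\<in>LHom C a b.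
           G a b (LScale C a b t f) = LScale D (F a) (F b) t (G a b f)))"

text \<open>A relation family \<open>\<theta>\<close> (one relation on each hom-space) which is a congruence of categories
  and of vector spaces.\<close>

definition linear_congruence ::
    "('o, 'm, 'k) lin_cat \<Rightarrow> ('o \<Rightarrow> 'o \<Rightarrow> ('m \<times> 'm) set) \<Rightarrow> bool" where
  "linear_congruence C \<theta> \<longleftrightarrow>
     (\<forall>a\<in>LObj C. \<forall>b\<in>LObj C. equiv (LHom C a b) (\<theta> a b)) \<and>
     (\<forall>a\<in>LObj C. \<forall>b\<in>LObj C. \<forall>c\<in>LObj C. \<forall>(g, g')\<in>\<theta> b c. \<forall>(f, f')\<in>\<theta> a b.
        (LComp C a b c g f, LComp C a b c g' f') \<in> \<theta> a c) \<and>
     (\<forall>a\<in>LObj C. \<forall>b\<in>LObj C. \<forall>(f, f')\<in>\<theta> a b. \<forall>(g, g')\<in>\<theta> a b.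
        (LAdd C a b f g, LAdd C a b f' g') \<in> \<theta> a b) \<and>
     (\<forall>a\<in>LObj C. \<forall>b\<in>LObj C. \<forall>t. \<forall>(f, f')\<in>\<theta> a b.
        (LScale C a b t f, LScale C a b t f') \<in> \<theta> a b)"

definition relation_on_lin_cat :: "('o, 'm, 'k) lin_cat \<Rightarrow> ('m \<times> 'm) set \<Rightarrow> bool" where
  "relation_on_lin_cat C R \<longleftrightarrow>
     (\<forall>(x, y)\<in>R. \<exists>a\<in>LObj C. \<exists>b\<in>LObj C. x \<in> LHom C a b \<and> y \<in> LHom C a b)"

definition contains_relation ::
    "('o, 'm, 'k) lin_cat \<Rightarrow> ('m \<times> 'm) set \<Rightarrow> ('o \<Rightarrow> 'o \<Rightarrow> ('m \<times> 'm) set) \<Rightarrow> bool" where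
  "contains_relation C R \<theta> \<longleftrightarrow>
     (\<forall>a\<in>LObj C. \<forall>b\<in>LObj C. R \<inter> (LHom C a b \<times> LHom C a b) \<subseteq> \<theta> a b)"

definition generated_congruence ::
    "('o, 'm, 'k) lin_cat \<Rightarrow> ('m \<times> 'm) set \<Rightarrow> 'o \<Rightarrow> 'o \<Rightarrow> ('m \<times> 'm) set" where
  "generated_congruence C R a b = \<Inter>{\<theta> a b |\<theta>. linear_congruence C \<theta> \<and> contains_relation C R \<theta>}"

definition quotient_lin_cat ::
    "('o, 'm, 'k) lin_cat \<Rightarrow> ('o \<Rightarrow> 'o \<Rightarrow> ('m \<times> 'm) set) \<Rightarrow> ('o, 'm set, 'k) lin_cat" where
  "quotient_lin_cat C \<theta> =
     \<lparr>LObj = LObj C,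
      LHom = (\<lambda>a b. LHom C a b // \<theta> a b),
      LIdent = (\<lambda>a. \<theta> a a `` {LIdent C a}),
      LComp = (\<lambda>a b c S T. \<Union>g\<in>S. \<Union>f\<in>T. \<theta> a c `` {LComp C a b c g f}),
      LAdd = (\<lambda>a b S T. \<Union>f\<in>S. \<Union>g\<in>T. \<theta> a b `` {LAdd C a b f g}),
      LScale = (\<lambda>a b t S. \<Union>f\<in>S. \<theta> a b `` {LScale C a b t f})\<rparr>"

section \<open>Linearisations\<close>

text \<open>\<open>'m \<Rightarrow>\<^sub>0 'k\<close> is the vector space with basis \<open>'m\<close>; the basis vector of \<open>m\<close> is
  \<open>Poly_Mapping.single m 1\<close>, and the space with basis \<open>S\<close> consists of the \<open>p\<close> with
  \<open>keys p \<subseteq> S\<close>.\<close>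

definition scale_pm :: "'k::field \<Rightarrow> ('m \<Rightarrow>\<^sub>0 'k) \<Rightarrow> ('m \<Rightarrow>\<^sub>0 'k)" where
  "scale_pm t p = Poly_Mapping.map (\<lambda>x. t * x) p"

text \<open>Bilinear extension of a product of basis elements; \<open>def x y\<close> tells when the product is
  defined, undefined products being \<open>0\<close>.\<close>

definition bilin_ext ::
    "('m \<Rightarrow> 'm \<Rightarrow> bool) \<Rightarrow> ('m \<Rightarrow> 'm \<Rightarrow> 'm) \<Rightarrow> ('m \<Rightarrow>\<^sub>0 'k::field) \<Rightarrow> ('m \<Rightarrow>\<^sub>0 'k) \<Rightarrow> ('m \<Rightarrow>\<^sub>0 'k)" where
  "bilin_ext def op p q =
     (\<Sum>x\<in>Poly_Mapping.keys p. \<Sum>y\<in>Poly_Mapping.keys q.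
        if def x y
        then Poly_Mapping.single (op x y) (Poly_Mapping.lookup p x * Poly_Mapping.lookup q y)
        else 0)"

definition monoid_algebra :: "'m monoid \<Rightarrow> ('k::field, 'm \<Rightarrow>\<^sub>0 'k) module" where
  "monoid_algebra G =
     \<lparr>carrier = {p. Poly_Mapping.keys p \<subseteq> carrier G},
      monoid.mult = bilin_ext (\<lambda>x y. True) (monoid.mult G),
      one = Poly_Mapping.single \<one>\<^bsub>G\<^esub> 1,
      zero = 0, add = (+), module.smult = scale_pm\<rparr>"

definition category_algebra :: "('o, 'm) cat \<Rightarrow> ('k::field, 'm \<Rightarrow>\<^sub>0 'k) module" where
  "category_algebra C =
     \<lparr>carrier = {p. Poly_Mapping.keys p \<subseteq> Mor C},
      monoid.mult = bilin_ext (\<lambda>x y. Src C x = Trg C y) (Comp C),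
      one = (\<Sum>a\<in>Obj C. Poly_Mapping.single (Ident C a) 1),
      zero = 0, add = (+), module.smult = scale_pm\<rparr>"

definition linearization :: "('o, 'm) cat \<Rightarrow> ('o, 'm \<Rightarrow>\<^sub>0 'k::field, 'k) lin_cat" where
  "linearization C =
     \<lparr>LObj = Obj C,
      LHom = (\<lambda>a b. {p. Poly_Mapping.keys p \<subseteq> cat_hom C a b}),
      LIdent = (\<lambda>a. Poly_Mapping.single (Ident C a) 1),
      LComp = (\<lambda>a b c. bilin_ext (\<lambda>x y. True) (Comp C)),
      LAdd = (\<lambda>a b. (+)),
      LScale = (\<lambda>a b. scale_pm)\<rparr>"

section \<open>Quiver presentations\<close>

text \<open>A path is a triple of its source, its list of arrows \<^emph>\<open>in the order in which they are
  travelled\<close>, and its target. Since composition is from right to left, \<open>q\<close> after \<open>p\<close> has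
  arrow list \<open>p @ q\<close>.\<close>

type_synonym ('v, 'e) path = "'v \<times> 'e list \<times> 'v"

definition free_category :: "('v, 'e) pre_digraph \<Rightarrow> ('v, ('v, 'e) path) cat" where
  "free_category Q =
     \<lparr>Obj = verts Q,
      Mor = {(u, p, v). pre_digraph.awalk Q u p v},
      Src = (\<lambda>(u, p, v). u),
      Trg = (\<lambda>(u, p, v). v),
      Ident = (\<lambda>v. (v, [], v)),
      Comp = (\<lambda>(v', q, w) (u, p, v). (u, p @ q, w))\<rparr>"

definition arrow_path :: "('v, 'e) pre_digraph \<Rightarrow> 'e \<Rightarrow> ('v, 'e) path" where
  "arrow_path Q a = (tail Q a, [a], head Q a)"

text \<open>The linear category of \<open>A\<close> with respect to \<open>E\<close>: the hom-space from \<open>e\<close> to \<open>f\<close> is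
  \<open>f A e\<close>.\<close>

definition lin_cat_of_algebra :: "('k, 'a) module \<Rightarrow> 'a set \<Rightarrow> ('a, 'a, 'k) lin_cat" where
  "lin_cat_of_algebra A E =
     \<lparr>LObj = E,
      LHom = (\<lambda>e f. {f \<otimes>\<^bsub>A\<^esub> x \<otimes>\<^bsub>A\<^esub> e |x. x \<in> carrier A}),
      LIdent = (\<lambda>e. e),
      LComp = (\<lambda>e f g y x. y \<otimes>\<^bsub>A\<^esub> x),
      LAdd = (\<lambda>e f x y. x \<oplus>\<^bsub>A\<^esub> y),
      LScale = (\<lambda>e f t x. t \<odot>\<^bsub>A\<^esub> x)\<rparr>"

text \<open>\<open>f (Rad A / Rad\<^sup>2 A) e\<close>, as a subspace of \<open>A / Rad\<^sup>2 A\<close>.\<close>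

definition arrow_space :: "('k, 'a) module \<Rightarrow> 'a \<Rightarrow> 'a \<Rightarrow> 'a set set" where
  "arrow_space A f e = {Rad2 A +>\<^bsub>A\<^esub> (f \<otimes>\<^bsub>A\<^esub> x \<otimes>\<^bsub>A\<^esub> e) |x. x \<in> Rad A}"

text \<open>\<open>Q\<close> is the quiver of \<open>A\<close>, up to naming: \<open>\<phi>\<close> identifies its vertices with the chosen
  idempotents, and \<open>\<beta>\<close> identifies the arrows from \<open>u\<close> to \<open>v\<close> with a basis of
  \<open>\<phi> v (Rad A / Rad\<^sup>2 A) \<phi> u\<close>.\<close>

definition is_quiver_of ::
    "('k::field, 'a) module \<Rightarrow> 'a set \<Rightarrow> ('v, 'e) pre_digraph \<Rightarrow> bool" where
  "is_quiver_of A E Q \<longleftrightarrow>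
     wf_digraph Q \<and>
     (\<exists>\<phi> \<beta>. bij_betw \<phi> (verts Q) E \<and>
        (\<forall>u\<in>verts Q. \<forall>v\<in>verts Q.
           inj_on \<beta> {a \<in> arcs Q. tail Q a = u \<and> head Q a = v} \<and>
           is_basis (quotient_algebra A (Rad2 A)) (arrow_space A (\<phi> v) (\<phi> u))
             (\<beta> ` {a \<in> arcs Q. tail Q a = u \<and> head Q a = v})))"

text \<open>The quiver and the linear category of a split basic algebra do not depend, up to
  isomorphism, on the complete set of primitive orthogonal idempotents; \<open>E\<close> is one such set, used
  for both.\<close>

definition is_quiver_presentation ::
    "('k::field, 'a) module \<Rightarrow> ('v, 'e) pre_digraph \<Rightarrow>
     ((('v, 'e) path \<Rightarrow>\<^sub>0 'k) \<times> (('v, 'e) path \<Rightarrow>\<^sub>0 'k)) set \<Rightarrow> bool" where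
  "is_quiver_presentation A Q R \<longleftrightarrow>
     split_basic A \<and>
     relation_on_lin_cat (linearization (free_category Q)) R \<and>
     (\<exists>E. complete_primitive_orthogonal_idempotents A E \<and>
        is_quiver_of A E Q \<and>
        lin_cats_isomorphic
          (quotient_lin_cat (linearization (free_category Q))
             (generated_congruence (linearization (free_category Q)) R))
          (lin_cat_of_algebra A E))"

section \<open>The Catalan monoid of partial functions and its category\<close>

definition order_preserving :: "(nat \<rightharpoonup> nat) \<Rightarrow> bool" where
  "order_preserving f \<longleftrightarrow> (\<forall>x\<in>dom f. \<forall>y\<in>dom f. x \<le> y \<longrightarrow> the (f x) \<le> the (f y))"

definition order_decreasing :: "(nat \<rightharpoonup> nat) \<Rightarrow> bool" where
  "order_decreasing f \<longleftrightarrow> (\<forall>x\<in>dom f. the (f x) \<le> x)"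

definition PC :: "nat \<Rightarrow> (nat \<rightharpoonup> nat) monoid" where
  "PC n =
     \<lparr>carrier = {f. dom f \<subseteq> {1..n} \<and> ran f \<subseteq> {1..n} \<and> order_preserving f \<and> order_decreasing f},
      monoid.mult = (\<circ>\<^sub>m),
      one = Some |` {1..n}\<rparr>"

text \<open>An onto function with domain \<open>A\<close> and range \<open>B\<close> is a partial map \<open>f\<close> with \<open>dom f = A\<close>
  and \<open>ran f = B\<close>, so it determines its source and target.\<close>

definition EC :: "nat \<Rightarrow> (nat set, nat \<rightharpoonup> nat) cat" where
  "EC n =
     \<lparr>Obj = Pow {1..n},
      Mor = {f. dom f \<in> Pow {1..n} \<and> ran f \<in> Pow {1..n} \<and> order_preserving f \<and> order_decreasing f},
      Src = dom,
      Trg = ran,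
      Ident = (\<lambda>A. Some |` A),
      Comp = (\<circ>\<^sub>m)\<rparr>"

definition lower :: "nat set \<Rightarrow> nat \<Rightarrow> nat set" where
  "lower A i = (A \<union> {i - 1}) - {i}"

definition d_mor :: "nat set \<Rightarrow> nat \<Rightarrow> (nat \<rightharpoonup> nat)" where
  "d_mor A i = (Some |` A)(i \<mapsto> i - 1)"

text \<open>The arrows are the morphisms themselves, so tail and head (\<open>A\<close> and \<open>lower A i\<close> for
  \<open>d_mor A i\<close>) are domain and range.\<close>

definition EC_quiver :: "nat \<Rightarrow> (nat set, nat \<rightharpoonup> nat) pre_digraph" where
  "EC_quiver n =
     \<lparr>verts = Pow {1..n},
      arcs = {d_mor A i |A i. A \<subseteq> {1..n} \<and> i \<in> A \<and> 2 \<le> i},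
      tail = dom,
      head = ran\<rparr>"

definition EC_path_relations ::
    "nat \<Rightarrow> ((nat set, nat \<rightharpoonup> nat) path \<times> (nat set, nat \<rightharpoonup> nat) path) set" where
  "EC_path_relations n =
     (let cmp = Comp (free_category (EC_quiver n)); arr = arrow_path (EC_quiver n) in
       {(cmp (arr (d_mor (lower A j) i)) (arr (d_mor A j)),
         cmp (arr (d_mor (lower A i) j)) (arr (d_mor A i)))
        |A i j. A \<subseteq> {1..n} \<and> i \<in> A \<and> j \<in> A \<and> 2 \<le> i \<and> j > i + 1}
       \<union>
       {(cmp (arr (d_mor (lower A (i + 1)) i)) (arr (d_mor A (i + 1))),
         cmp (arr (d_mor (lower (lower A i) (i + 1)) i))
           (cmp (arr (d_mor (lower A i) (i + 1))) (arr (d_mor A i))))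
        |A i. A \<subseteq> {1..n} \<and> i \<in> A \<and> i + 1 \<in> A \<and> 2 \<le> i})"

definition EC_relations ::
    "nat \<Rightarrow> (((nat set, nat \<rightharpoonup> nat) path \<Rightarrow>\<^sub>0 'k::field) \<times>
             ((nat set, nat \<rightharpoonup> nat) path \<Rightarrow>\<^sub>0 'k)) set" where
  "EC_relations n =
     {(Poly_Mapping.single p 1, Poly_Mapping.single q 1) |p q. (p, q) \<in> EC_path_relations n}"

end

(*
  The total displacement f |-> sum of x - f x grades the category EC_n: it vanishes exactly on the
  identities, is superadditive under composition, and equals 1 exactly on the arrows d_i^A.

  Relations. A morphism f factors through d_i^A iff f moves i and, when i - 1 lies in A, f identifies
  i - 1 and i.  So if two walks with the same value start with different arrows d_i and d_j, i < j,
  both can be compared, by induction on the displacement, with walks starting with the two sides of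
  the defining relation for (i, j).  Hence the relations identify exactly the walks with equal value,
  and the congruence that they generate is the kernel of the evaluation functor.

  Radical. A non-identity morphism f satisfies f A f = 0 and therefore lies in every maximal left
  ideal, while the coefficient of an identity is a character of A.  So Rad A is spanned by the
  non-identities, its square by the morphisms of displacement at least 2, and Rad A / Rad^2 A by
  the arrows.

  The monoid algebra becomes the category algebra through f |-> sum of the restrictions of f.
*)
theory Submission
  imports Defs
begin

section \<open>Linear algebra of finitely supported functions\<close>

text \<open>The second family of relations equates a walk of two arrows with one of three, so the
  relations are not homogeneous in path length and a value does not determine the length of its
  walks. This is why walks are compared by displacement of the value and not by length. Onto maps
  are epimorphisms. Once two walks with equal value begin with the same arrow, their tails have
  equal value too, and the induction can continue there. To pass from walks to linear combinations,
  one walk is fixed for each morphism. Modulo any congruence that contains the relations, a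
  combination of paths equals a combination of chosen walks, and the latter depends only on the
  value. No canonical form of walks has to be found. The radical, the idempotents and the quiver are
  computed in an abstract algebra with coordinates, \<open>EC_algebra\<close>. The monoid algebra
  and the category algebra are two instances of it, so nothing has to be transported along their
  isomorphism.\<close>

lemma lookup_scale_pm [simp]:
  "Poly_Mapping.lookup (scale_pm t p) x = t * Poly_Mapping.lookup p x"
  by (simp add: scale_pm_def Poly_Mapping.map.rep_eq when_def)

lemma scale_pm_add: "scale_pm t (p + q) = scale_pm t p + scale_pm t q"
  by (rule poly_mapping_eqI) (simp add: lookup_add algebra_simps)

lemma scale_pm_add_left: "scale_pm (s + t) p = scale_pm s p + scale_pm t p"
  by (rule poly_mapping_eqI) (simp add: lookup_add algebra_simps)

lemma scale_pm_scale_pm [simp]: "scale_pm s (scale_pm t p) = scale_pm (s * t) p"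
  by (rule poly_mapping_eqI) simp

lemma scale_pm_one [simp]: "scale_pm 1 p = p"
  by (rule poly_mapping_eqI) simp

lemma scale_pm_0 [simp]: "scale_pm 0 p = 0"
  by (rule poly_mapping_eqI) simp

lemma scale_pm_zero [simp]: "scale_pm t 0 = 0"
  by (rule poly_mapping_eqI) simp

lemma scale_pm_single [simp]:
  "scale_pm t (Poly_Mapping.single x c) = Poly_Mapping.single x (t * c)"
  by (rule poly_mapping_eqI) (simp add: lookup_single when_def)

lemma scale_pm_sum: "scale_pm t (sum f I) = (\<Sum>i\<in>I. scale_pm t (f i))"
  by (rule poly_mapping_eqI) (simp add: lookup_sum sum_distrib_left)

lemma keys_scale_pm_subset: "Poly_Mapping.keys (scale_pm t p) \<subseteq> Poly_Mapping.keys p"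
  by (auto simp: in_keys_iff)

lemma keys_add_subset:
  "Poly_Mapping.keys p \<subseteq> S \<Longrightarrow> Poly_Mapping.keys q \<subseteq> S \<Longrightarrow> Poly_Mapping.keys (p + q) \<subseteq> S"
  using Poly_Mapping.keys_add[of p q] by blast

lemma keys_uminus_eq: "Poly_Mapping.keys (- p :: 'm \<Rightarrow>\<^sub>0 'k::field) = Poly_Mapping.keys p"
  by (auto simp: in_keys_iff)

lemma keys_minus_subset:
  "Poly_Mapping.keys p \<subseteq> S \<Longrightarrow> Poly_Mapping.keys q \<subseteq> S \<Longrightarrow>
   Poly_Mapping.keys (p - q :: 'm \<Rightarrow>\<^sub>0 'k::field) \<subseteq> S"
  using keys_add_subset[of p S "- q"] by (simp add: keys_uminus_eq)

lemma keys_sum_subset: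
  "(\<And>i. i \<in> I \<Longrightarrow> Poly_Mapping.keys (f i) \<subseteq> S) \<Longrightarrow> Poly_Mapping.keys (sum f I) \<subseteq> S"
  using Poly_Mapping.keys_sum[of f I] by blast

lemma keys_single_subset: "x \<in> S \<Longrightarrow> Poly_Mapping.keys (Poly_Mapping.single x c) \<subseteq> S"
  by (auto simp: in_keys_iff lookup_single when_def split: if_splits)

lemma sum_single_keys:
  "(\<Sum>x\<in>Poly_Mapping.keys p. Poly_Mapping.single x (Poly_Mapping.lookup p x)) = p"
proof (rule poly_mapping_eqI)
  fix y
  have "Poly_Mapping.lookup
      (\<Sum>x\<in>Poly_Mapping.keys p. Poly_Mapping.single x (Poly_Mapping.lookup p x)) y
    = (\<Sum>x\<in>Poly_Mapping.keys p. if x = y then Poly_Mapping.lookup p x else 0)"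
    unfolding lookup_sum by (rule sum.cong) (auto simp: lookup_single when_def)
  also have "\<dots> = Poly_Mapping.lookup p y"
    by (simp add: in_keys_iff)
  finally show "Poly_Mapping.lookup
      (\<Sum>x\<in>Poly_Mapping.keys p. Poly_Mapping.single x (Poly_Mapping.lookup p x)) y
    = Poly_Mapping.lookup p y" .
qed

lemma single_one_inject [simp]:
  "Poly_Mapping.single x (1 :: 'k::field) = Poly_Mapping.single y 1 \<longleftrightarrow> x = y"
  by (metis lookup_single_eq lookup_single_not_eq zero_neq_one)

lemma single_one_neq_zero [simp]: "Poly_Mapping.single x (1 :: 'k::field) \<noteq> 0"
  by (metis lookup_single_eq lookup_zero zero_neq_one)

text \<open>A vector is the sum of its monomials, and all partial sums stay supported in
  \<open>S\<close>. Keeping that support in the case \<open>add\<close> makes it available for side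
  conditions on keys.\<close>

lemma poly_mapping_span_induct [consumes 1, case_names zero add single]:
  fixes p :: "'m \<Rightarrow>\<^sub>0 'k::field"
  assumes "Poly_Mapping.keys p \<subseteq> S"
    and zero: "P 0"
    and add: "\<And>p q. Poly_Mapping.keys p \<subseteq> S \<Longrightarrow> Poly_Mapping.keys q \<subseteq> S \<Longrightarrow>
      P p \<Longrightarrow> P q \<Longrightarrow> P (p + q)"
    and single: "\<And>x c. x \<in> S \<Longrightarrow> P (Poly_Mapping.single x c)"
  shows "P p"
proof -
  have "P (\<Sum>x\<in>T. Poly_Mapping.single x (Poly_Mapping.lookup p x)) \<and>
      Poly_Mapping.keys (\<Sum>x\<in>T. Poly_Mapping.single x (Poly_Mapping.lookup p x)) \<subseteq> S"
    if "finite T" "T \<subseteq> S" for T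
    using that
  proof (induction T rule: finite_induct)
    case empty
    then show ?case by (simp add: zero)
  next
    case (insert x T)
    have k: "Poly_Mapping.keys (Poly_Mapping.single x (Poly_Mapping.lookup p x)) \<subseteq> S"
      by (rule keys_single_subset) (use insert in auto)
    show ?case
      using insert k keys_add_subset[OF k] by (simp add: add single del: keys_single)
  qed
  from this[of "Poly_Mapping.keys p"] assms(1) show ?thesis
    by (simp add: sum_single_keys)
qed

section \<open>Linear and bilinear extension from basis vectors\<close>

definition lin_ext :: "('m \<Rightarrow> 'l \<Rightarrow>\<^sub>0 'k::field) \<Rightarrow> ('m \<Rightarrow>\<^sub>0 'k) \<Rightarrow> ('l \<Rightarrow>\<^sub>0 'k)" where
  "lin_ext F p = (\<Sum>x\<in>Poly_Mapping.keys p. scale_pm (Poly_Mapping.lookup p x) (F x))"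

text \<open>Keys may cancel in a sum of vectors. Summing over a common finite superset makes the
  terms of different vectors comparable.\<close>

lemma lin_ext_superset:
  assumes "finite S" "Poly_Mapping.keys p \<subseteq> S"
  shows "lin_ext F p = (\<Sum>x\<in>S. scale_pm (Poly_Mapping.lookup p x) (F x))"
  unfolding lin_ext_def
  by (rule sum.mono_neutral_left) (use assms in \<open>auto simp: in_keys_iff\<close>)

lemma lin_ext_zero [simp]: "lin_ext F 0 = 0"
  by (simp add: lin_ext_def)

lemma lin_ext_single [simp]: "lin_ext F (Poly_Mapping.single x c) = scale_pm c (F x)"
  using lin_ext_superset[of "{x}" "Poly_Mapping.single x c" F] by (simp add: lookup_single)

lemma lin_ext_add: "lin_ext F (p + q) = lin_ext F p + lin_ext F q"
proof -
  let ?S = "Poly_Mapping.keys p \<union> Poly_Mapping.keys q"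
  have "lin_ext F (p + q) = (\<Sum>x\<in>?S. scale_pm (Poly_Mapping.lookup (p + q) x) (F x))"
    by (rule lin_ext_superset) (simp_all add: Poly_Mapping.keys_add)
  also have "\<dots> = lin_ext F p + lin_ext F q"
    by (simp add: lin_ext_superset[of ?S p] lin_ext_superset[of ?S q] lookup_add
        scale_pm_add_left sum.distrib)
  finally show ?thesis .
qed

lemma lin_ext_scale: "lin_ext F (scale_pm t p) = scale_pm t (lin_ext F p)"
  using lin_ext_superset[OF _ keys_scale_pm_subset, of p F t]
  by (simp add: lin_ext_def scale_pm_sum)

lemma lin_ext_sum: "lin_ext F (sum f I) = (\<Sum>i\<in>I. lin_ext F (f i))"
  by (induction I rule: infinite_finite_induct) (simp_all add: lin_ext_add)

lemma lin_ext_minus: "lin_ext F (p - q) = lin_ext F p - lin_ext F q"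
  using lin_ext_add[of F "p - q" q] by simp

lemma lin_ext_cong:
  "(\<And>x. x \<in> Poly_Mapping.keys p \<Longrightarrow> F x = G x) \<Longrightarrow> lin_ext F p = lin_ext G p"
  by (simp add: lin_ext_def)

lemma lin_ext_id: "lin_ext (\<lambda>x. Poly_Mapping.single x 1) p = p"
  by (simp add: lin_ext_def sum_single_keys)

lemma lin_ext_lin_ext: "lin_ext F (lin_ext G p) = lin_ext (\<lambda>x. lin_ext F (G x)) p"
proof -
  have "lin_ext F (lin_ext G p) =
      (\<Sum>x\<in>Poly_Mapping.keys p. lin_ext F (scale_pm (Poly_Mapping.lookup p x) (G x)))"
    by (simp only: lin_ext_def[of G] lin_ext_sum)
  then show ?thesis
    by (simp only: lin_ext_scale lin_ext_def[of "\<lambda>x. lin_ext F (G x)"])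
qed

lemma keys_lin_ext_subset:
  assumes "\<And>x. x \<in> Poly_Mapping.keys p \<Longrightarrow> Poly_Mapping.keys (F x) \<subseteq> S"
  shows "Poly_Mapping.keys (lin_ext F p) \<subseteq> S"
  unfolding lin_ext_def
  by (rule keys_sum_subset) (rule order_trans[OF keys_scale_pm_subset assms])

text \<open>Since undefined products count as 0, the product is linear in each argument, and
  bilinearity can be taken from linear extension.\<close>

lemma bilin_ext_eq_lin_ext:
  "bilin_ext def op p q =
     lin_ext (\<lambda>x. lin_ext (\<lambda>y. if def x y then Poly_Mapping.single (op x y) 1 else 0) q) p"
  unfolding bilin_ext_def lin_ext_def scale_pm_sum by (intro sum.cong) auto

lemma bilin_ext_add_left: "bilin_ext def op (p + p') q = bilin_ext def op p q + bilin_ext def op p' q"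
  by (simp add: bilin_ext_eq_lin_ext lin_ext_add)

lemma bilin_ext_zero_left [simp]: "bilin_ext def op 0 q = 0"
  by (simp add: bilin_ext_def)

lemma bilin_ext_zero_right [simp]: "bilin_ext def op p 0 = 0"
  by (simp add: bilin_ext_def)

lemma bilin_ext_add_right: "bilin_ext def op p (q + q') = bilin_ext def op p q + bilin_ext def op p q'"
  unfolding bilin_ext_eq_lin_ext lin_ext_add
  by (simp add: lin_ext_def scale_pm_add sum.distrib)

lemma bilin_ext_scale_left: "bilin_ext def op (scale_pm t p) q = scale_pm t (bilin_ext def op p q)"
  by (simp add: bilin_ext_eq_lin_ext lin_ext_scale)

lemma bilin_ext_scale_right: "bilin_ext def op p (scale_pm t q) = scale_pm t (bilin_ext def op p q)"
  unfolding bilin_ext_eq_lin_ext lin_ext_scale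
  by (simp add: lin_ext_def scale_pm_sum ac_simps)

lemma bilin_ext_single:
  "bilin_ext def op (Poly_Mapping.single x a) (Poly_Mapping.single y b) =
     (if def x y then Poly_Mapping.single (op x y) (a * b) else 0)"
  by (simp add: bilin_ext_eq_lin_ext)

lemma bilin_ext_sum_left: "bilin_ext def op (sum f I) q = (\<Sum>i\<in>I. bilin_ext def op (f i) q)"
  by (simp add: bilin_ext_eq_lin_ext lin_ext_sum)

lemma bilin_ext_sum_right: "bilin_ext def op p (sum f I) = (\<Sum>i\<in>I. bilin_ext def op p (f i))"
  by (induction I rule: infinite_finite_induct) (simp_all add: bilin_ext_add_right)

lemma keys_bilin_ext_subset:
  assumes "\<And>x y. x \<in> Poly_Mapping.keys p \<Longrightarrow> y \<in> Poly_Mapping.keys q \<Longrightarrow> def x y \<Longrightarrow> op x y \<in> S"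
  shows "Poly_Mapping.keys (bilin_ext def op p q) \<subseteq> S"
  unfolding bilin_ext_eq_lin_ext
  by (intro keys_lin_ext_subset) (use assms in auto)

text \<open>On basis vectors, \<open>iff\<close> makes the two bracketings defined or undefined
  together, and undefined ones are 0. Linearity in each argument does the rest.\<close>

lemma bilin_ext_assoc:
  assumes keys: "Poly_Mapping.keys p \<subseteq> S" "Poly_Mapping.keys q \<subseteq> S" "Poly_Mapping.keys r \<subseteq> S"
    and iff: "\<And>x y z. x \<in> S \<Longrightarrow> y \<in> S \<Longrightarrow> z \<in> S \<Longrightarrow>
      def x y \<and> def (op x y) z \<longleftrightarrow> def y z \<and> def x (op y z)"
    and assoc: "\<And>x y z. x \<in> S \<Longrightarrow> y \<in> S \<Longrightarrow> z \<in> S \<Longrightarrow> def x y \<Longrightarrow> def y z \<Longrightarrow>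
      op (op x y) z = op x (op y z)"
  shows "bilin_ext def op (bilin_ext def op p q) r = bilin_ext def op p (bilin_ext def op q r)"
  using keys(1)
proof (induction p rule: poly_mapping_span_induct)
  case (single x a)
  show ?case
    using keys(2)
  proof (induction q rule: poly_mapping_span_induct)
    case (single y b)
    show ?case
      using keys(3)
    proof (induction r rule: poly_mapping_span_induct)
      case (single z c)
      then show ?case
        using iff[OF \<open>x \<in> S\<close> \<open>y \<in> S\<close> \<open>z \<in> S\<close>] assoc[OF \<open>x \<in> S\<close> \<open>y \<in> S\<close> \<open>z \<in> S\<close>]
        by (auto simp: bilin_ext_single ac_simps)
    qed (simp_all add: bilin_ext_add_right)
  qed (simp_all add: bilin_ext_add_right bilin_ext_add_left)
qed (simp_all add: bilin_ext_add_left)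

text \<open>Common ground for the monoid algebra, where \<open>def\<close> always holds, and the
  category algebra, where it expresses composability. By linearity the unit laws are checked on
  monomials.\<close>

lemma k_algebra_bilin_ext:
  fixes u :: "'m \<Rightarrow>\<^sub>0 'k::field"
  assumes closed: "\<And>x y. x \<in> S \<Longrightarrow> y \<in> S \<Longrightarrow> def x y \<Longrightarrow> op x y \<in> S"
    and iff: "\<And>x y z. x \<in> S \<Longrightarrow> y \<in> S \<Longrightarrow> z \<in> S \<Longrightarrow>
      def x y \<and> def (op x y) z \<longleftrightarrow> def y z \<and> def x (op y z)"
    and assoc: "\<And>x y z. x \<in> S \<Longrightarrow> y \<in> S \<Longrightarrow> z \<in> S \<Longrightarrow> def x y \<Longrightarrow> def y z \<Longrightarrow>
      op (op x y) z = op x (op y z)"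
    and u: "Poly_Mapping.keys u \<subseteq> S"
    and u_left: "\<And>x c. x \<in> S \<Longrightarrow>
      bilin_ext def op u (Poly_Mapping.single x c) = Poly_Mapping.single x c"
    and u_right: "\<And>x c. x \<in> S \<Longrightarrow>
      bilin_ext def op (Poly_Mapping.single x c) u = Poly_Mapping.single x c"
  shows "k_algebra
     \<lparr>carrier = {p. Poly_Mapping.keys p \<subseteq> S}, monoid.mult = bilin_ext def op,
      one = u, zero = 0, add = (+), module.smult = scale_pm\<rparr>" (is "k_algebra ?A")
proof -
  have mult_closed: "Poly_Mapping.keys (bilin_ext def op p q) \<subseteq> S"
    if "Poly_Mapping.keys p \<subseteq> S" "Poly_Mapping.keys q \<subseteq> S" for p q :: "'m \<Rightarrow>\<^sub>0 'k"
    by (rule keys_bilin_ext_subset) (intro closed subsetD[OF that(1)] subsetD[OF that(2)])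
  have left: "bilin_ext def op u p = p" if "Poly_Mapping.keys p \<subseteq> S" for p
    using that by (induction p rule: poly_mapping_span_induct)
      (simp_all add: bilin_ext_add_right u_left)
  have right: "bilin_ext def op p u = p" if "Poly_Mapping.keys p \<subseteq> S" for p
    using that by (induction p rule: poly_mapping_span_induct)
      (simp_all add: bilin_ext_add_left u_right)
  have ab: "abelian_group ?A"
  proof (rule abelian_groupI)
    fix x assume "x \<in> carrier ?A"
    then show "\<exists>y\<in>carrier ?A. y \<oplus>\<^bsub>?A\<^esub> x = \<zero>\<^bsub>?A\<^esub>"
      by (intro bexI[of _ "- x"]) (simp_all add: keys_uminus_eq)
  qed (simp_all add: keys_add_subset ac_simps)
  have assoc': "bilin_ext def op (bilin_ext def op p q) r = bilin_ext def op p (bilin_ext def op q r)"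
    if "Poly_Mapping.keys p \<subseteq> S" "Poly_Mapping.keys q \<subseteq> S" "Poly_Mapping.keys r \<subseteq> S"
    for p q r :: "'m \<Rightarrow>\<^sub>0 'k"
    by (rule bilin_ext_assoc[OF that iff assoc])
  have mon: "Group.monoid ?A"
    by (rule monoidI) (simp_all add: mult_closed u left right assoc')
  have rng: "ring ?A"
    by (rule ringI) (simp_all add: ab mon bilin_ext_add_left bilin_ext_add_right)
  have md: "module (ring_of_type_algebra :: 'k ring) ?A"
  proof (rule moduleI)
    show "cring (ring_of_type_algebra :: 'k ring)" by (rule cring_from_type_algebra)
  qed (auto simp: ab ring_of_type_algebra_def scale_pm_add_left scale_pm_add
      intro: subsetD[OF keys_scale_pm_subset])
  show ?thesis
    by (intro k_algebra.intro k_algebra_axioms.intro md rng)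
      (simp_all add: bilin_ext_scale_left bilin_ext_scale_right)
qed

section \<open>Quotients of linear categories\<close>

lemma generated_congruence_eqI:
  assumes "linear_congruence C \<theta>" "contains_relation C R \<theta>"
    and "\<And>\<theta>' a b. linear_congruence C \<theta>' \<Longrightarrow> contains_relation C R \<theta>' \<Longrightarrow>
      a \<in> LObj C \<Longrightarrow> b \<in> LObj C \<Longrightarrow> \<theta> a b \<subseteq> \<theta>' a b"
    and "a \<in> LObj C" "b \<in> LObj C"
  shows "generated_congruence C R a b = \<theta> a b"
  using assms unfolding generated_congruence_def by blast

lemma linear_congruenceD:
  assumes "linear_congruence C \<theta>" "a \<in> LObj C" "b \<in> LObj C"
  shows "equiv (LHom C a b) (\<theta> a b)"
    and "c \<in> LObj C \<Longrightarrow> (g, g') \<in> \<theta> b c \<Longrightarrow> (f, f') \<in> \<theta> a b \<Longrightarrow>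
      (LComp C a b c g f, LComp C a b c g' f') \<in> \<theta> a c"
    and "(f, f') \<in> \<theta> a b \<Longrightarrow> (h, h') \<in> \<theta> a b \<Longrightarrow> (LAdd C a b f h, LAdd C a b f' h') \<in> \<theta> a b"
    and "(f, f') \<in> \<theta> a b \<Longrightarrow> (LScale C a b t f, LScale C a b t f') \<in> \<theta> a b"
  using assms
  by (simp_all only: linear_congruence_def Ball_def split_paired_All prod.case)

definition kernel_pair :: "('o, 'm, 'k) lin_cat \<Rightarrow> ('o \<Rightarrow> 'o \<Rightarrow> 'm \<Rightarrow> 'l) \<Rightarrow> 'o \<Rightarrow> 'o \<Rightarrow> ('m \<times> 'm) set" where
  "kernel_pair C \<Phi> a b = {(f, g). f \<in> LHom C a b \<and> g \<in> LHom C a b \<and> \<Phi> a b f = \<Phi> a b g}"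

text \<open>Bijective on objects and onto on hom-spaces: the setting of the first isomorphism
  theorem for linear categories. \<open>\<Phi>\<close> carries both objects because hom-spaces of a
  linear category may overlap.\<close>

locale full_linear_functor =
  fixes C :: "('o, 'm, 'k) lin_cat" and D :: "('p, 'l, 'k) lin_cat"
    and F :: "'o \<Rightarrow> 'p" and \<Phi> :: "'o \<Rightarrow> 'o \<Rightarrow> 'm \<Rightarrow> 'l"
  assumes F: "bij_betw F (LObj C) (LObj D)"
    and ident_closed: "a \<in> LObj C \<Longrightarrow> LIdent C a \<in> LHom C a a"
    and comp_closed: "a \<in> LObj C \<Longrightarrow> b \<in> LObj C \<Longrightarrow> c \<in> LObj C \<Longrightarrow>
      g \<in> LHom C b c \<Longrightarrow> f \<in> LHom C a b \<Longrightarrow> LComp C a b c g f \<in> LHom C a c"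
    and add_closed: "a \<in> LObj C \<Longrightarrow> b \<in> LObj C \<Longrightarrow>
      f \<in> LHom C a b \<Longrightarrow> g \<in> LHom C a b \<Longrightarrow> LAdd C a b f g \<in> LHom C a b"
    and scale_closed: "a \<in> LObj C \<Longrightarrow> b \<in> LObj C \<Longrightarrow> f \<in> LHom C a b \<Longrightarrow> LScale C a b t f \<in> LHom C a b"
    and full: "a \<in> LObj C \<Longrightarrow> b \<in> LObj C \<Longrightarrow> \<Phi> a b ` LHom C a b = LHom D (F a) (F b)"
    and ident: "a \<in> LObj C \<Longrightarrow> \<Phi> a a (LIdent C a) = LIdent D (F a)"
    and comp: "a \<in> LObj C \<Longrightarrow> b \<in> LObj C \<Longrightarrow> c \<in> LObj C \<Longrightarrow>
      g \<in> LHom C b c \<Longrightarrow> f \<in> LHom C a b \<Longrightarrow>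
      \<Phi> a c (LComp C a b c g f) = LComp D (F a) (F b) (F c) (\<Phi> b c g) (\<Phi> a b f)"
    and add: "a \<in> LObj C \<Longrightarrow> b \<in> LObj C \<Longrightarrow> f \<in> LHom C a b \<Longrightarrow> g \<in> LHom C a b \<Longrightarrow>
      \<Phi> a b (LAdd C a b f g) = LAdd D (F a) (F b) (\<Phi> a b f) (\<Phi> a b g)"
    and scale: "a \<in> LObj C \<Longrightarrow> b \<in> LObj C \<Longrightarrow> f \<in> LHom C a b \<Longrightarrow>
      \<Phi> a b (LScale C a b t f) = LScale D (F a) (F b) t (\<Phi> a b f)"
begin

lemma equiv_kernel_pair: "equiv (LHom C a b) (kernel_pair C \<Phi> a b)"
  by (auto simp: equiv_def refl_on_def sym_def trans_def kernel_pair_def)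

lemma linear_congruence_kernel_pair: "linear_congruence C (kernel_pair C \<Phi>)"
  unfolding linear_congruence_def
  by (intro conjI ballI allI equiv_kernel_pair)
    (auto simp: kernel_pair_def comp comp_closed add add_closed scale scale_closed)

text \<open>A class is a fibre of \<open>\<Phi>\<close>, so \<open>\<Phi>\<close> descends to a
  bijection. Equality with the kernel is asked for on objects, which is where a generated congruence
  gets identified.\<close>

lemma quotient_isomorphic:
  assumes \<theta>: "\<And>a b. a \<in> LObj C \<Longrightarrow> b \<in> LObj C \<Longrightarrow> \<theta> a b = kernel_pair C \<Phi> a b"
  shows "lin_cats_isomorphic (quotient_lin_cat C \<theta>) D"
proof -
  \<comment> \<open>\<open>\<Phi>\<close> is constant on a class, so its image is a singleton and
    \<open>the_elem\<close> reads off the value.\<close>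
  define G where "G a b S = the_elem (\<Phi> a b ` S)" for a b S
  have class_eq: "\<theta> a b `` {f} = {g \<in> LHom C a b. \<Phi> a b g = \<Phi> a b f}"
    if "a \<in> LObj C" "b \<in> LObj C" "f \<in> LHom C a b" for a b f
    using that by (auto simp: \<theta> kernel_pair_def)
  have G_class: "G a b (\<theta> a b `` {f}) = \<Phi> a b f"
    if "a \<in> LObj C" "b \<in> LObj C" "f \<in> LHom C a b" for a b f
  proof -
    have "\<Phi> a b ` (\<theta> a b `` {f}) = {\<Phi> a b f}"
      unfolding class_eq[OF that] using that(3) by auto
    then show ?thesis by (simp add: G_def)
  qed
  have bij: "bij_betw (G a b) (LHom C a b // \<theta> a b) (LHom D (F a) (F b))"
    if ab: "a \<in> LObj C" "b \<in> LObj C" for a b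
    unfolding bij_betw_def
  proof
    show "inj_on (G a b) (LHom C a b // \<theta> a b)"
    proof (rule inj_onI)
      fix S T assume "S \<in> LHom C a b // \<theta> a b" "T \<in> LHom C a b // \<theta> a b" and eq: "G a b S = G a b T"
      then obtain f g where f: "f \<in> LHom C a b" "S = \<theta> a b `` {f}"
        and g: "g \<in> LHom C a b" "T = \<theta> a b `` {g}" by (auto elim!: quotientE)
      have "\<Phi> a b f = \<Phi> a b g"
        using eq unfolding f(2) g(2) G_class[OF ab f(1)] G_class[OF ab g(1)] .
      then show "S = T"
        unfolding f(2) g(2) class_eq[OF ab f(1)] class_eq[OF ab g(1)] by simp
    qed
    have "G a b ` (LHom C a b // \<theta> a b) = \<Phi> a b ` LHom C a b"
      using G_class[OF ab] by (force simp: quotient_def image_iff)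
    then show "G a b ` (LHom C a b // \<theta> a b) = LHom D (F a) (F b)"
      by (simp add: full[OF ab])
  qed
  have rep: "\<exists>f\<in>LHom C a b. S = \<theta> a b `` {f}" if "S \<in> LHom (quotient_lin_cat C \<theta>) a b" for a b S
    using that by (auto simp: quotient_lin_cat_def elim!: quotientE)
  have self: "f \<in> \<theta> a b `` {f}" if "a \<in> LObj C" "b \<in> LObj C" "f \<in> LHom C a b" for a b f
    using class_eq[OF that] that(3) by simp
  \<comment> \<open>The quotient operations are unions over all representatives. Each choice yields
    the same class, and \<open>self\<close> rules out an empty union.\<close>
  have comp': "(\<Union>g\<in>\<theta> b c `` {g0}. \<Union>f\<in>\<theta> a b `` {f0}. \<theta> a c `` {LComp C a b c g f}) =
      \<theta> a c `` {LComp C a b c g0 f0}"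
    if abc: "a \<in> LObj C" "b \<in> LObj C" "c \<in> LObj C" and g0: "g0 \<in> LHom C b c" and f0: "f0 \<in> LHom C a b"
    for a b c g0 f0
  proof -
    have "\<theta> a c `` {LComp C a b c g f} = \<theta> a c `` {LComp C a b c g0 f0}"
      if "g \<in> \<theta> b c `` {g0}" "f \<in> \<theta> a b `` {f0}" for g f
      using that g0 f0 abc by (simp add: class_eq comp_closed comp)
    then show ?thesis using self abc g0 f0 by blast
  qed
  have add': "(\<Union>f\<in>\<theta> a b `` {f0}. \<Union>g\<in>\<theta> a b `` {g0}. \<theta> a b `` {LAdd C a b f g}) =
      \<theta> a b `` {LAdd C a b f0 g0}"
    if ab: "a \<in> LObj C" "b \<in> LObj C" and f0: "f0 \<in> LHom C a b" and g0: "g0 \<in> LHom C a b"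
    for a b f0 g0
  proof -
    have "\<theta> a b `` {LAdd C a b f g} = \<theta> a b `` {LAdd C a b f0 g0}"
      if "f \<in> \<theta> a b `` {f0}" "g \<in> \<theta> a b `` {g0}" for f g
      using that g0 f0 ab by (simp add: class_eq add_closed add)
    then show ?thesis using self ab g0 f0 by blast
  qed
  have scale': "(\<Union>f\<in>\<theta> a b `` {f0}. \<theta> a b `` {LScale C a b t f}) = \<theta> a b `` {LScale C a b t f0}"
    if ab: "a \<in> LObj C" "b \<in> LObj C" and f0: "f0 \<in> LHom C a b" for a b t f0
  proof -
    have "\<theta> a b `` {LScale C a b t f} = \<theta> a b `` {LScale C a b t f0}"
      if "f \<in> \<theta> a b `` {f0}" for f
      using that f0 ab by (simp add: class_eq scale_closed scale)
    then show ?thesis using self ab f0 by blast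
  qed
  show ?thesis
    unfolding lin_cats_isomorphic_def
  proof (intro exI[of _ F] exI[of _ G] conjI ballI allI)
    show "bij_betw F (LObj (quotient_lin_cat C \<theta>)) (LObj D)"
      using F by (simp add: quotient_lin_cat_def)
  next
    fix a b assume "a \<in> LObj (quotient_lin_cat C \<theta>)" "b \<in> LObj (quotient_lin_cat C \<theta>)"
    then show "bij_betw (G a b) (LHom (quotient_lin_cat C \<theta>) a b) (LHom D (F a) (F b))"
      using bij by (simp add: quotient_lin_cat_def)
  next
    fix a assume "a \<in> LObj (quotient_lin_cat C \<theta>)"
    then show "G a a (LIdent (quotient_lin_cat C \<theta>) a) = LIdent D (F a)"
      by (simp add: quotient_lin_cat_def G_class ident_closed ident)
  next
    fix a b c S T
    assume abc: "a \<in> LObj (quotient_lin_cat C \<theta>)" "b \<in> LObj (quotient_lin_cat C \<theta>)"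
        "c \<in> LObj (quotient_lin_cat C \<theta>)"
      and "S \<in> LHom (quotient_lin_cat C \<theta>) b c" "T \<in> LHom (quotient_lin_cat C \<theta>) a b"
    then obtain g f where g: "g \<in> LHom C b c" "S = \<theta> b c `` {g}"
      and f: "f \<in> LHom C a b" "T = \<theta> a b `` {f}"
      using rep by metis
    show "G a c (LComp (quotient_lin_cat C \<theta>) a b c S T) =
        LComp D (F a) (F b) (F c) (G b c S) (G a b T)"
      using abc g(1) f(1) unfolding g(2) f(2)
      by (simp add: quotient_lin_cat_def comp' G_class comp_closed comp)
  next
    fix a b S T
    assume ab: "a \<in> LObj (quotient_lin_cat C \<theta>)" "b \<in> LObj (quotient_lin_cat C \<theta>)"
      and "S \<in> LHom (quotient_lin_cat C \<theta>) a b" "T \<in> LHom (quotient_lin_cat C \<theta>) a b"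
    then obtain f g where f: "f \<in> LHom C a b" "S = \<theta> a b `` {f}"
      and g: "g \<in> LHom C a b" "T = \<theta> a b `` {g}"
      using rep by metis
    show "G a b (LAdd (quotient_lin_cat C \<theta>) a b S T) = LAdd D (F a) (F b) (G a b S) (G a b T)"
      using ab g(1) f(1) unfolding g(2) f(2)
      by (simp add: quotient_lin_cat_def add' G_class add_closed add)
  next
    fix a b t S
    assume ab: "a \<in> LObj (quotient_lin_cat C \<theta>)" "b \<in> LObj (quotient_lin_cat C \<theta>)"
      and "S \<in> LHom (quotient_lin_cat C \<theta>) a b"
    then obtain f where f: "f \<in> LHom C a b" "S = \<theta> a b `` {f}"
      using rep by metis
    show "G a b (LScale (quotient_lin_cat C \<theta>) a b t S) = LScale D (F a) (F b) t (G a b S)"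
      using ab f(1) unfolding f(2)
      by (simp add: quotient_lin_cat_def scale' G_class scale_closed scale)
  qed
qed

end

section \<open>Morphisms and paths\<close>

lemma order_preserving_iff:
  "order_preserving f \<longleftrightarrow>
     (\<forall>x y u v. f x = Some u \<longrightarrow> f y = Some v \<longrightarrow> x \<le> y \<longrightarrow> u \<le> v)"
  unfolding order_preserving_def dom_def by force

lemma order_decreasing_iff: "order_decreasing f \<longleftrightarrow> (\<forall>x u. f x = Some u \<longrightarrow> u \<le> x)"
  unfolding order_decreasing_def dom_def by force

lemma Mor_EC_iff:
  "f \<in> Mor (EC n) \<longleftrightarrow> dom f \<subseteq> {1..n} \<and> ran f \<subseteq> {1..n} \<and>
     (\<forall>x y u v. f x = Some u \<longrightarrow> f y = Some v \<longrightarrow> x \<le> y \<longrightarrow> u \<le> v) \<and>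
     (\<forall>x u. f x = Some u \<longrightarrow> u \<le> x)"
  by (simp add: EC_def order_preserving_iff order_decreasing_iff)

lemma carrier_PC: "carrier (PC n) = Mor (EC n)"
  by (simp add: PC_def EC_def)

lemma finite_dom_EC: "f \<in> Mor (EC n) \<Longrightarrow> finite (dom f)"
  by (auto simp: Mor_EC_iff intro: finite_subset)

lemma id_in_Mor_EC: "A \<subseteq> {1..n} \<Longrightarrow> Some |` A \<in> Mor (EC n)"
  by (auto simp: Mor_EC_iff restrict_map_def ran_def dom_def split: if_splits)

lemma dom_restrict_Some [simp]: "dom (Some |` A) = A"
  by simp

lemma ran_restrict_Some [simp]: "ran (Some |` A) = A"
  by (auto simp: ran_def restrict_map_def)

lemma restrict_Some_inject [simp]: "Some |` A = Some |` B \<longleftrightarrow> A = B"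
  using dom_restrict_Some by metis

lemma dom_map_comp_eq: "ran f \<subseteq> dom g \<Longrightarrow> dom (g \<circ>\<^sub>m f) = dom f"
  by (force simp: dom_def ran_def map_comp_def split: option.splits)

lemma ran_map_comp_eq: "ran f = dom g \<Longrightarrow> ran (g \<circ>\<^sub>m f) = ran g"
  by (force simp: set_eq_iff dom_def ran_def map_comp_def split: option.splits)

lemma map_comp_assoc: "(h \<circ>\<^sub>m g) \<circ>\<^sub>m f = h \<circ>\<^sub>m (g \<circ>\<^sub>m f)"
  by (rule ext) (simp add: map_comp_def split: option.splits)

lemma map_comp_id_right:
  assumes "dom f \<subseteq> A"
  shows "f \<circ>\<^sub>m (Some |` A) = f"
proof (rule ext)
  fix x show "(f \<circ>\<^sub>m (Some |` A)) x = f x"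
    using assms by (cases "f x") (auto simp: map_comp_def restrict_map_def)
qed

lemma map_comp_id_left: "ran f \<subseteq> A \<Longrightarrow> (Some |` A) \<circ>\<^sub>m f = f"
  by (rule ext) (auto simp: map_comp_def restrict_map_def ran_def split: option.splits)

text \<open>Onto maps are epimorphisms. This is what removes a common first arrow from two walks
  with equal value.\<close>

lemma map_comp_right_cancel:
  assumes "dom g \<subseteq> ran f" "dom h \<subseteq> ran f" "g \<circ>\<^sub>m f = h \<circ>\<^sub>m f"
  shows "g = h"
proof (rule ext)
  fix y
  show "g y = h y"
  proof (cases "y \<in> ran f")
    case True
    then obtain x where "f x = Some y" by (auto simp: ran_def)
    then show ?thesis using fun_cong[OF assms(3), of x] by (simp add: map_comp_def)
  next
    case False
    then show ?thesis using assms(1,2) by (metis domIff subsetD)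
  qed
qed

lemma map_restrict_dom: "f |` dom f = f"
  by (rule ext) (simp add: restrict_map_def domIff)

text \<open>Domain and range may fail to match, so the lemma serves the product of the monoid as
  well as composition in the category.\<close>

lemma map_comp_in_Mor_EC:
  assumes "f \<in> Mor (EC n)" "g \<in> Mor (EC n)"
  shows "g \<circ>\<^sub>m f \<in> Mor (EC n)"
proof -
  have "dom (g \<circ>\<^sub>m f) \<subseteq> dom f" "ran (g \<circ>\<^sub>m f) \<subseteq> ran g"
    by (auto simp: dom_def ran_def map_comp_def split: option.splits)
  moreover have "u \<le> v" if "(g \<circ>\<^sub>m f) x = Some u" "(g \<circ>\<^sub>m f) y = Some v" "x \<le> y" for x y u v
  proof -
    from that(1) obtain u' where "f x = Some u'" "g u' = Some u"
      by (auto simp: map_comp_def split: option.splits)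
    moreover from that(2) obtain v' where "f y = Some v'" "g v' = Some v"
      by (auto simp: map_comp_def split: option.splits)
    ultimately show ?thesis using assms that(3) unfolding Mor_EC_iff by meson
  qed
  moreover have "u \<le> x" if "(g \<circ>\<^sub>m f) x = Some u" for x u
  proof -
    from that obtain u' where "f x = Some u'" "g u' = Some u"
      by (auto simp: map_comp_def split: option.splits)
    then show ?thesis using assms unfolding Mor_EC_iff by (meson le_trans)
  qed
  moreover have "dom f \<subseteq> {1..n}" "ran g \<subseteq> {1..n}"
    using assms by (simp_all add: Mor_EC_iff)
  ultimately show ?thesis unfolding Mor_EC_iff[of "g \<circ>\<^sub>m f"] by blast
qed

section \<open>Total displacement\<close>

definition disp :: "(nat \<rightharpoonup> nat) \<Rightarrow> nat" where
  "disp f = (\<Sum>x\<in>dom f. x - the (f x))"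

lemma disp_id [simp]: "disp (Some |` A) = 0"
  by (simp add: disp_def)

lemma disp_eq_0:
  assumes "f \<in> Mor (EC n)" "disp f = 0"
  shows "f = Some |` dom f"
proof (rule ext)
  fix x
  show "f x = (Some |` dom f) x"
  proof (cases "f x")
    case (Some u)
    then have "x - u = 0"
      using assms finite_dom_EC[OF assms(1)] by (force simp: disp_def)
    moreover have "u \<le> x" using assms(1) Some by (auto simp: Mor_EC_iff)
    ultimately show ?thesis using Some by (simp add: restrict_map_def domIff)
  qed (simp add: restrict_map_def domIff)
qed

text \<open>If f merges points, a step of g at their common value is counted once in
  \<open>disp g\<close>, but once for each merged point in the composite. This is the source of the
  inequality.\<close>

lemma disp_comp:
  assumes "f \<in> Mor (EC n)" "g \<in> Mor (EC n)" "dom g = ran f"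
  shows "disp f + disp g \<le> disp (g \<circ>\<^sub>m f)"
proof -
  have ran: "ran f = (\<lambda>x. the (f x)) ` dom f"
    by (force simp: ran_def dom_def image_iff)
  have "disp g = (\<Sum>y\<in>(\<lambda>x. the (f x)) ` dom f. y - the (g y))"
    by (simp add: disp_def assms(3) ran)
  also have "\<dots> \<le> (\<Sum>x\<in>dom f. the (f x) - the (g (the (f x))))"
    using sum_image_le[of "dom f" "\<lambda>y. y - the (g y)" "\<lambda>x. the (f x)"] finite_dom_EC[OF assms(1)]
    by (simp add: comp_def)
  finally have "disp f + disp g
      \<le> (\<Sum>x\<in>dom f. (x - the (f x)) + (the (f x) - the (g (the (f x)))))"
    by (simp add: disp_def sum.distrib)
  also have "\<dots> = disp (g \<circ>\<^sub>m f)"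
  proof -
    have "(x - the (f x)) + (the (f x) - the (g (the (f x)))) = x - the ((g \<circ>\<^sub>m f) x)"
      if "x \<in> dom f" for x
    proof -
      from that obtain u where u: "f x = Some u" by auto
      then have "u \<in> dom g" using assms(3) by (auto simp: ran_def)
      then obtain v where v: "g u = Some v" by auto
      \<comment> \<open>Both maps lower points, so the truncated differences telescope.\<close>
      have "u \<le> x" "v \<le> u" using u v assms by (auto simp: Mor_EC_iff)
      then show ?thesis using u v by simp
    qed
    then show ?thesis
      unfolding disp_def using dom_map_comp_eq[of f g] assms(3) by (intro sum.cong) simp_all
  qed
  finally show ?thesis .
qed

text \<open>An onto self-map of a finite set is a permutation and preserves the sum of the elements,
  while the displacement is the amount by which f lowers that sum.\<close>

lemma endo_EC:
  assumes f: "f \<in> Mor (EC n)" and "dom f = ran f"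
  shows "f = Some |` dom f"
proof -
  let ?h = "\<lambda>x. the (f x)"
  have fin: "finite (dom f)" by (rule finite_dom_EC[OF f])
  have "?h ` dom f = ran f"
    by (force simp: ran_def dom_def image_iff)
  then have im: "?h ` dom f = dom f"
    using assms(2) by simp
  then have "inj_on ?h (dom f)" using fin by (simp add: eq_card_imp_inj_on)
  then have "(\<Sum>x\<in>dom f. ?h x) = (\<Sum>x\<in>dom f. x)"
    using sum.reindex[of ?h "dom f" "\<lambda>x. x"] im by (simp add: comp_def)
  moreover have "(\<Sum>x\<in>dom f. ?h x) + disp f = (\<Sum>x\<in>dom f. x)"
    unfolding disp_def sum.distrib[symmetric]
    by (rule sum.cong) (use f in \<open>auto simp: Mor_EC_iff\<close>)
  ultimately show ?thesis using disp_eq_0[OF f] by simp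
qed

text \<open>The composite is an onto endomorphism, hence an identity, and superadditivity leaves no
  displacement for f. So no non-identity lies on a cycle. Both the characters of the algebra and the
  vanishing of f A f rest on this.\<close>

lemma comp_eq_id_EC:
  assumes "f \<in> Mor (EC n)" "g \<in> Mor (EC n)" "dom g = ran f" "ran g = dom f"
  shows "disp f = 0"
proof -
  have "g \<circ>\<^sub>m f = Some |` dom (g \<circ>\<^sub>m f)"
    by (rule endo_EC[OF map_comp_in_Mor_EC[OF assms(1,2)]])
      (use assms(3,4) in \<open>simp add: dom_map_comp_eq ran_map_comp_eq\<close>)
  then have "disp (g \<circ>\<^sub>m f) = 0" by (metis disp_id)
  then show ?thesis using disp_comp[OF assms(1-3)] by simp
qed

section \<open>The arrows and factorisation through them\<close>

lemma d_mor_apply: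
  "d_mor A i x = (if x = i then Some (i - 1) else if x \<in> A then Some x else None)"
  by (simp add: d_mor_def restrict_map_def)

lemma dom_d_mor: "i \<in> A \<Longrightarrow> dom (d_mor A i) = A"
  by (auto simp: d_mor_apply dom_def)

lemma ran_d_mor: "i \<in> A \<Longrightarrow> 2 \<le> i \<Longrightarrow> ran (d_mor A i) = lower A i"
  by (auto simp: d_mor_apply ran_def lower_def)

lemma lower_subset: "A \<subseteq> {1..n} \<Longrightarrow> i \<in> A \<Longrightarrow> 2 \<le> i \<Longrightarrow> lower A i \<subseteq> {1..n}"
  unfolding lower_def by force

lemma d_mor_in_Mor_EC:
  assumes "A \<subseteq> {1..n}" "i \<in> A" "2 \<le> i"
  shows "d_mor A i \<in> Mor (EC n)"
  using assms lower_subset[OF assms] unfolding Mor_EC_iff dom_d_mor[OF assms(2)] ran_d_mor[OF assms(2,3)]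
  by (auto simp: d_mor_apply split: if_splits)

lemma disp_d_mor:
  assumes "A \<subseteq> {1..n}" "i \<in> A" "2 \<le> i"
  shows "disp (d_mor A i) = 1"
proof -
  have "disp (d_mor A i) = (\<Sum>x\<in>A. if x = i then 1 else 0)"
    unfolding disp_def dom_d_mor[OF assms(2)] using assms(3)
    by (intro sum.cong) (auto simp: d_mor_apply)
  then show ?thesis using assms finite_subset[of A "{1..n}"] by simp
qed

lemma arcs_EC_quiver_iff:
  "d \<in> arcs (EC_quiver n) \<longleftrightarrow> (\<exists>A i. d = d_mor A i \<and> A \<subseteq> {1..n} \<and> i \<in> A \<and> 2 \<le> i)"
  by (auto simp: EC_quiver_def)

lemma arc_in_Mor_EC: "d \<in> arcs (EC_quiver n) \<Longrightarrow> d \<in> Mor (EC n)"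
  by (auto simp: arcs_EC_quiver_iff d_mor_in_Mor_EC)

lemma disp_arc: "d \<in> arcs (EC_quiver n) \<Longrightarrow> disp d = 1"
  by (auto simp: arcs_EC_quiver_iff disp_d_mor)

text \<open>The second factor must send i - 1 to the value of f at i. If i - 1 is already in the
  domain, \<open>coll\<close> says that this is its value under f, so the override changes nothing
  there.\<close>

lemma factor_d_mor:
  assumes f: "f \<in> Mor (EC n)" and i: "f i = Some u" "u < i"
    and coll: "i - 1 \<in> dom f \<Longrightarrow> f (i - 1) = f i"
  obtains g where "g \<in> Mor (EC n)" "dom g = lower (dom f) i" "ran g = ran f"
    "g \<circ>\<^sub>m d_mor (dom f) i = f"
proof
  \<comment> \<open>Values are positive, so u < i forces i \<ge> 2, and i - 1 is a point different
    from i.\<close>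
  have u1: "1 \<le> u" using f i by (auto simp: Mor_EC_iff ran_def)
  have coll': "v = u" if "f (i - 1) = Some v" for v
  proof -
    from that have "i - 1 \<in> dom f" by blast
    from coll[OF this] show ?thesis using that i by simp
  qed
  define g where "g = (f |` (lower (dom f) i))(i - 1 \<mapsto> u)"
  have g: "g x = (if x = i - 1 then Some u else if x = i then None else f x)" for x
    using u1 i by (auto simp: g_def restrict_map_def lower_def)
  have idom: "i \<in> dom f" using i by auto
  show dom: "dom g = lower (dom f) i"
    using u1 i by (auto simp: g lower_def dom_def split: if_splits)
  show ran: "ran g = ran f"
  proof (rule Set.set_eqI)
    fix y
    show "y \<in> ran g \<longleftrightarrow> y \<in> ran f"
    proof
      assume "y \<in> ran g"
      then show "y \<in> ran f" using i by (auto simp: ran_def g split: if_splits)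
    next
      assume "y \<in> ran f"
      then obtain x where x: "f x = Some y" by (auto simp: ran_def)
      show "y \<in> ran g"
      proof (cases "x = i \<or> x = i - 1")
        case True
        then have "y = u" using x i coll' by auto
        moreover have "g (i - 1) = Some u" by (simp add: g)
        ultimately show ?thesis by (auto simp: ran_def)
      next
        case False
        then show ?thesis using x by (auto simp: ran_def g)
      qed
    qed
  qed
  show "g \<circ>\<^sub>m d_mor (dom f) i = f"
  proof (rule ext)
    fix x
    show "(g \<circ>\<^sub>m d_mor (dom f) i) x = f x"
      using i u1 coll' by (auto simp: map_comp_def d_mor_apply g domIff split: option.splits)
  qed
  have op: "v \<le> w" if "f x = Some v" "f y = Some w" "x \<le> y" for x y v w
    using f that by (auto simp: Mor_EC_iff)
  have od: "v \<le> x" if "f x = Some v" for x v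
    using f that by (auto simp: Mor_EC_iff)
  \<comment> \<open>A comparison at i - 1 becomes the comparison of f at i: as g is undefined at i,
    no point of its domain other than i - 1 changes sides.\<close>
  have "v \<le> w" if "g x = Some v" "g y = Some w" "x \<le> y" for x y v w
    using that op[of x v i u] op[of i u y w] op[of x v y w] i u1
    by (auto simp: g split: if_splits)
  moreover have "v \<le> x" if "g x = Some v" for x v
    using that od[of x v] i by (auto simp: g split: if_splits)
  moreover have "dom g \<subseteq> {1..n}"
    unfolding dom using lower_subset[of "dom f" n i] f idom i u1 by (auto simp: Mor_EC_iff)
  ultimately show "g \<in> Mor (EC n)"
    using f ran by (auto simp: Mor_EC_iff)
qed

text \<open>After d_i the point i sits at i - 1, together with i - 1 itself if that belongs to A,
  and g cannot raise them again. This is the converse of \<open>factor_d_mor\<close>.\<close>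

lemma d_mor_factor_imp:
  assumes "i \<in> A" "2 \<le> i" "g \<in> Mor (EC n)" "dom g = lower A i"
  shows "\<exists>u. (g \<circ>\<^sub>m d_mor A i) i = Some u \<and> u < i"
    and "i - 1 \<in> A \<Longrightarrow> (g \<circ>\<^sub>m d_mor A i) (i - 1) = (g \<circ>\<^sub>m d_mor A i) i"
proof -
  have "i - 1 \<in> dom g" using assms by (auto simp: lower_def)
  then obtain u where u: "g (i - 1) = Some u" by auto
  then have "u \<le> i - 1" using assms(3) by (auto simp: Mor_EC_iff)
  then show "\<exists>u. (g \<circ>\<^sub>m d_mor A i) i = Some u \<and> u < i"
    using u assms(2) by (auto simp: map_comp_def d_mor_apply)
  show "i - 1 \<in> A \<Longrightarrow> (g \<circ>\<^sub>m d_mor A i) (i - 1) = (g \<circ>\<^sub>m d_mor A i) i"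
    using u by (auto simp: map_comp_def d_mor_apply)
qed

text \<open>The least moved point can be lowered by one without colliding with a fixed one.\<close>

lemma factor_arc:
  assumes f: "f \<in> Mor (EC n)" and "disp f \<noteq> 0"
  obtains i g where "i \<in> dom f" "2 \<le> i" "g \<in> Mor (EC n)" "dom g = lower (dom f) i" "ran g = ran f"
    "g \<circ>\<^sub>m d_mor (dom f) i = f"
proof -
  let ?P = "\<lambda>i. \<exists>u. f i = Some u \<and> u < i"
  have "\<exists>i. ?P i"
  proof (rule ccontr)
    assume "\<not> ?thesis"
    then have "x - the (f x) = 0" if "x \<in> dom f" for x
      using that by (auto simp: not_less)
    then have "disp f = 0" unfolding disp_def by (intro sum.neutral) blast
    with assms(2) show False by simp
  qed
  define i where "i = (LEAST i. ?P i)"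
  obtain u where u: "f i = Some u" "u < i"
    using LeastI_ex[OF \<open>\<exists>i. ?P i\<close>] unfolding i_def by auto
  have u1: "1 \<le> u" using f u by (auto simp: Mor_EC_iff ran_def)
  have "f (i - 1) = f i" if "i - 1 \<in> dom f"
  proof -
    from that obtain v where v: "f (i - 1) = Some v" by auto
    have "\<not> ?P (i - 1)"
      using not_less_Least[of "i - 1" ?P] u unfolding i_def[symmetric] by simp
    then have "i - 1 \<le> v" using v by auto
    moreover have "v \<le> u" using f u(1) v unfolding Mor_EC_iff by (metis diff_le_self)
    ultimately show ?thesis using v u by simp
  qed
  from factor_d_mor[OF f u this] obtain g where "g \<in> Mor (EC n)" "dom g = lower (dom f) i"
    "ran g = ran f" "g \<circ>\<^sub>m d_mor (dom f) i = f" by blast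
  moreover have "i \<in> dom f" "2 \<le> i" using u u1 by auto
  ultimately show ?thesis using that by blast
qed

lemma EC_quiver_sel [simp]:
  "verts (EC_quiver n) = Pow {1..n}" "tail (EC_quiver n) = dom" "head (EC_quiver n) = ran"
  by (simp_all add: EC_quiver_def)

text \<open>Splitting an arrow off a morphism of displacement 1 leaves displacement 0, that is, an
  identity. This form singles out the arrows as the layer between the radical and its
  square.\<close>

lemma arcs_EC_quiver_eq: "arcs (EC_quiver n) = {f \<in> Mor (EC n). disp f = 1}"
proof (intro Set.set_eqI iffI)
  fix f assume "f \<in> arcs (EC_quiver n)"
  then show "f \<in> {f \<in> Mor (EC n). disp f = 1}" by (simp add: arc_in_Mor_EC disp_arc)
next
  fix f assume "f \<in> {f \<in> Mor (EC n). disp f = 1}"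
  then have f: "f \<in> Mor (EC n)" "disp f = 1" by simp_all
  then have "disp f \<noteq> 0" by simp
  from factor_arc[OF f(1) this] obtain i g where i: "i \<in> dom f" "2 \<le> i"
    and g: "g \<in> Mor (EC n)" "dom g = lower (dom f) i" "g \<circ>\<^sub>m d_mor (dom f) i = f"
    by metis
  have A: "dom f \<subseteq> {1..n}" using f by (simp add: Mor_EC_iff)
  note d = d_mor_in_Mor_EC[OF A i]
  have "disp g = 0"
    using disp_comp[OF d g(1)] g i f(2) disp_d_mor[OF A i] by (simp add: ran_d_mor)
  then have "g = Some |` dom g" by (rule disp_eq_0[OF g(1)])
  then have "f = d_mor (dom f) i"
    using g(2,3) map_comp_id_left[of "d_mor (dom f) i" "dom g"] i by (simp add: ran_d_mor)
  then show "f \<in> arcs (EC_quiver n)"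
    using A i unfolding arcs_EC_quiver_iff by blast
qed

text \<open>The only element of A missing from the range of d_i^A is i, so domain and range
  determine i. Every pair of vertices carries at most one arrow.\<close>

lemma arcs_EC_quiver_unique:
  assumes "d \<in> arcs (EC_quiver n)" "e \<in> arcs (EC_quiver n)" "dom d = dom e" "ran d = ran e"
  shows "d = e"
proof -
  obtain B i where d: "d = d_mor B i" "i \<in> B" "2 \<le> i"
    using assms(1) unfolding arcs_EC_quiver_iff by blast
  obtain C j where e: "e = d_mor C j" "j \<in> C" "2 \<le> j"
    using assms(2) unfolding arcs_EC_quiver_iff by blast
  have C: "C = B" using assms(3) d e by (simp add: dom_d_mor)
  then have "lower B i = lower B j" using assms(4) d e by (simp add: ran_d_mor)
  moreover have "i \<notin> lower B i" by (simp add: lower_def)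
  ultimately have "i = j" using d(2) by (auto simp: lower_def)
  then show ?thesis using d e C by simp
qed

text \<open>Were the remaining factor an identity, f would be an arrow and have displacement 1. The
  two factors will exhibit f as a product of radical elements.\<close>

lemma EC_factor_non_irreducible:
  assumes "f \<in> Mor (EC n)" "2 \<le> disp f"
  obtains d g where "d \<in> Mor (EC n)" "disp d = 1" "g \<in> Mor (EC n)" "disp g \<noteq> 0"
    "dom g = ran d" "g \<circ>\<^sub>m d = f"
proof -
  have "disp f \<noteq> 0" using assms(2) by simp
  from factor_arc[OF assms(1) this] obtain i g where i: "i \<in> dom f" "2 \<le> i"
    and g: "g \<in> Mor (EC n)" "dom g = lower (dom f) i" "g \<circ>\<^sub>m d_mor (dom f) i = f"
    by metis
  have A: "dom f \<subseteq> {1..n}" using assms by (simp add: Mor_EC_iff)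
  have "disp g \<noteq> 0"
  proof
    assume "disp g = 0"
    then have "g = Some |` dom g" by (rule disp_eq_0[OF g(1)])
    then have "f = d_mor (dom f) i"
      using g(2,3) map_comp_id_left[of "d_mor (dom f) i" "dom g"] i by (simp add: ran_d_mor)
    then show False using disp_d_mor[OF A i] assms(2) by simp
  qed
  then show ?thesis
    using that[of "d_mor (dom f) i" g] d_mor_in_Mor_EC[OF A i] disp_d_mor[OF A i] g i
    by (simp add: ran_d_mor)
qed

section \<open>Walks and their evaluation\<close>

abbreviation EC_walk :: "nat \<Rightarrow> nat set \<Rightarrow> (nat \<rightharpoonup> nat) list \<Rightarrow> nat set \<Rightarrow> bool" where
  "EC_walk n \<equiv> pre_digraph.awalk (EC_quiver n)"

text \<open>The vertex fixes the value of the empty walk; along a walk it becomes the range of the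
  arrow just travelled.\<close>

primrec eval_walk :: "nat set \<Rightarrow> (nat \<rightharpoonup> nat) list \<Rightarrow> (nat \<rightharpoonup> nat)" where
  "eval_walk A [] = Some |` A"
| "eval_walk A (d # p) = eval_walk (ran d) p \<circ>\<^sub>m d"

lemma EC_walk_Nil [simp]: "EC_walk n A [] B \<longleftrightarrow> A = B \<and> A \<subseteq> {1..n}"
  by (auto simp: pre_digraph.awalk_def pre_digraph.cas.simps EC_quiver_def)

lemma EC_walk_Cons [simp]:
  "EC_walk n A (d # p) B \<longleftrightarrow> d \<in> arcs (EC_quiver n) \<and> dom d = A \<and> EC_walk n (ran d) p B"
proof -
  have "dom d \<subseteq> {1..n} \<and> ran d \<subseteq> {1..n}" if "d \<in> arcs (EC_quiver n)"
    using arc_in_Mor_EC[OF that] by (simp add: Mor_EC_iff)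
  then show ?thesis
    by (auto simp: pre_digraph.awalk_def pre_digraph.cas.simps EC_quiver_def)
qed

lemma EC_walk_append:
  "EC_walk n A p B \<Longrightarrow> EC_walk n B q C \<Longrightarrow> EC_walk n A (p @ q) C"
  by (induction p arbitrary: A) auto

lemma eval_walk:
  assumes "EC_walk n A p B"
  shows "eval_walk A p \<in> Mor (EC n)" "dom (eval_walk A p) = A" "ran (eval_walk A p) = B"
  using assms
  by (induction p arbitrary: A)
    (simp_all add: id_in_Mor_EC map_comp_in_Mor_EC arc_in_Mor_EC dom_map_comp_eq ran_map_comp_eq)

lemma eval_walk_append:
  "EC_walk n A p B \<Longrightarrow> EC_walk n B q C \<Longrightarrow>
   eval_walk A (p @ q) = eval_walk B q \<circ>\<^sub>m eval_walk A p"
proof (induction p arbitrary: A)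
  case Nil
  then show ?case using eval_walk(2)[OF Nil(2)] by (simp add: map_comp_id_right)
next
  case (Cons d p)
  then show ?case by (simp add: map_comp_assoc)
qed

text \<open>Superadditivity charges at least 1 for the first arrow. The displacement of the value is
  thus a measure for induction on tails.\<close>

lemma disp_eval_walk_Cons:
  assumes "EC_walk n A (d # p) B"
  shows "disp (eval_walk (ran d) p) < disp (eval_walk A (d # p))"
  using disp_comp[of d n "eval_walk (ran d) p"] eval_walk[of n "ran d" p B] assms
  by (auto simp: arc_in_Mor_EC disp_arc)

text \<open>Arrows can be stripped from f, each time lowering the displacement, until an identity is
  left: the arrows generate the category.\<close>

lemma ex_EC_walk:
  "f \<in> Mor (EC n) \<Longrightarrow> \<exists>p. EC_walk n (dom f) p (ran f) \<and> eval_walk (dom f) p = f"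
proof (induction "disp f" arbitrary: f rule: less_induct)
  case less
  show ?case
  proof (cases "disp f = 0")
    case True
    then have f: "f = Some |` dom f" by (rule disp_eq_0[OF less.prems])
    have "dom f = ran f" using arg_cong[OF f, of ran] by simp
    then have "EC_walk n (dom f) [] (ran f)" using less.prems by (simp add: Mor_EC_iff)
    moreover have "eval_walk (dom f) [] = f" using f by simp
    ultimately show ?thesis by blast
  next
    case False
    from factor_arc[OF less.prems False] obtain i g where i: "i \<in> dom f" "2 \<le> i"
      and g: "g \<in> Mor (EC n)" "dom g = lower (dom f) i" "ran g = ran f"
        "g \<circ>\<^sub>m d_mor (dom f) i = f" by metis
    let ?d = "d_mor (dom f) i"
    have A: "dom f \<subseteq> {1..n}" using less.prems by (simp add: Mor_EC_iff)
    have d: "?d \<in> arcs (EC_quiver n)" using A i arcs_EC_quiver_iff by blast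
    have "disp ?d + disp g \<le> disp f"
      using disp_comp[OF arc_in_Mor_EC[OF d] g(1)] g i by (simp add: ran_d_mor)
    then have "disp g < disp f" using disp_arc[OF d] by simp
    from less.hyps[OF this g(1)] obtain p where
      "EC_walk n (dom g) p (ran g)" "eval_walk (dom g) p = g" by blast
    then have "EC_walk n (dom f) (?d # p) (ran f) \<and> eval_walk (dom f) (?d # p) = f"
      using d i g by (simp add: dom_d_mor ran_d_mor)
    then show ?thesis by blast
  qed
qed

section \<open>The defining relations and the comparison of walks\<close>

lemma lower_commute:
  "i \<noteq> j \<Longrightarrow> j + 1 \<noteq> i \<Longrightarrow> i + 1 \<noteq> j \<Longrightarrow> 2 \<le> i \<Longrightarrow> 2 \<le> j \<Longrightarrow>
   lower (lower A i) j = lower (lower A j) i"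
  by (auto simp: lower_def)

lemma lower_braid:
  "i \<in> A \<Longrightarrow> 2 \<le> i \<Longrightarrow> lower (lower (lower A i) (i + 1)) i = lower (lower A (i + 1)) i"
  by (auto simp: lower_def)

lemma d_mor_commute:
  assumes "i \<in> A" "j \<in> A" "2 \<le> i" "i + 1 < j"
  shows "d_mor (lower A j) i \<circ>\<^sub>m d_mor A j = d_mor (lower A i) j \<circ>\<^sub>m d_mor A i"
  using assms by (intro ext) (auto simp: map_comp_def d_mor_apply lower_def)

text \<open>Both sides send i and i + 1 to i - 1. The left one merges the two points at i and lowers
  them together; the right one lowers them one after the other. The displacement is 3, although the
  left side has only two arrows.\<close>

lemma d_mor_braid:
  assumes "i \<in> A" "i + 1 \<in> A" "2 \<le> i"
  shows "d_mor (lower A (i + 1)) i \<circ>\<^sub>m d_mor A (i + 1) =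
    d_mor (lower (lower A i) (i + 1)) i \<circ>\<^sub>m (d_mor (lower A i) (i + 1) \<circ>\<^sub>m d_mor A i)"
  using assms by (intro ext) (auto simp: map_comp_def d_mor_apply lower_def)

text \<open>Isolates the combinatorics from linear algebra: in the application, walks are related
  when their basis vectors are congruent. The defining relations carry an arbitrary tail r, so
  beyond them only prefixing an arrow is asked for.\<close>

locale walk_congruence =
  fixes n :: nat
    and R :: "nat set \<Rightarrow> nat set \<Rightarrow> (nat \<rightharpoonup> nat) list \<Rightarrow> (nat \<rightharpoonup> nat) list \<Rightarrow> bool"
  assumes refl: "EC_walk n A p B \<Longrightarrow> R A B p p"
    and sym: "R A B p q \<Longrightarrow> R A B q p"
    and trans: "R A B p q \<Longrightarrow> R A B q r \<Longrightarrow> R A B p r"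
    and cons: "d \<in> arcs (EC_quiver n) \<Longrightarrow> EC_walk n (ran d) p B \<Longrightarrow> EC_walk n (ran d) q B \<Longrightarrow>
      R (ran d) B p q \<Longrightarrow> R (dom d) B (d # p) (d # q)"
    and commute: "A \<subseteq> {1..n} \<Longrightarrow> i \<in> A \<Longrightarrow> j \<in> A \<Longrightarrow> 2 \<le> i \<Longrightarrow> i + 1 < j \<Longrightarrow>
      EC_walk n (lower (lower A j) i) r B \<Longrightarrow>
      R A B (d_mor A j # d_mor (lower A j) i # r) (d_mor A i # d_mor (lower A i) j # r)"
    and braid: "A \<subseteq> {1..n} \<Longrightarrow> i \<in> A \<Longrightarrow> i + 1 \<in> A \<Longrightarrow> 2 \<le> i \<Longrightarrow>
      EC_walk n (lower (lower A (i + 1)) i) r B \<Longrightarrow>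
      R A B (d_mor A (i + 1) # d_mor (lower A (i + 1)) i # r)
        (d_mor A i # d_mor (lower A i) (i + 1) # d_mor (lower (lower A i) (i + 1)) i # r)"
begin

text \<open>The order i < j matters: lowering j first changes neither i nor i - 1, so the factor h
  left after d_j still meets the criterion for d_i. A walk r for what then remains continues both
  sides of the relation. The induction hypothesis links q to the side through d_j and p to the side
  through d_i.\<close>

lemma related_if_lower_first:
  assumes IH: "\<And>A' p' q'. disp (eval_walk A' p') < disp f \<Longrightarrow>
      EC_walk n A' p' B \<Longrightarrow> EC_walk n A' q' B \<Longrightarrow> eval_walk A' p' = eval_walk A' q' \<Longrightarrow> R A' B p' q'"
    and A: "A \<subseteq> {1..n}" and ij: "i \<in> A" "j \<in> A" "2 \<le> i" "i < j"
    and p: "EC_walk n A (d_mor A i # p) B" "eval_walk A (d_mor A i # p) = f"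
    and q: "EC_walk n A (d_mor A j # q) B" "eval_walk A (d_mor A j # q) = f"
  shows "R A B (d_mor A i # p) (d_mor A j # q)"
proof -
  have j2: "2 \<le> j" using ij by simp
  note ri = ran_d_mor[OF ij(1,3)] and rj = ran_d_mor[OF ij(2) j2]
  note di = dom_d_mor[OF ij(1)] and dj = dom_d_mor[OF ij(2)]
  have wp: "EC_walk n (lower A i) p B" and wq: "EC_walk n (lower A j) q B"
    using p q by (simp_all add: ri rj)
  define g h where "g = eval_walk (lower A i) p" and "h = eval_walk (lower A j) q"
  note gw = eval_walk[OF wp, folded g_def] and hw = eval_walk[OF wq, folded h_def]
  have fg: "g \<circ>\<^sub>m d_mor A i = f" and fh: "h \<circ>\<^sub>m d_mor A j = f"
    using p q by (simp_all add: ri rj g_def h_def)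
  have lesp: "disp g < disp f" and lesq: "disp h < disp f"
    using disp_eval_walk_Cons[OF p(1)] disp_eval_walk_Cons[OF q(1)]
    by (simp_all only: p(2) q(2) ri rj g_def h_def)
  have h_eq: "h x = f x" if "x \<in> A" "x \<noteq> j" for x
    unfolding fh[symmetric] using that by (simp add: map_comp_def d_mor_apply)
  obtain u where u: "f i = Some u" "u < i"
    using d_mor_factor_imp(1)[OF ij(1,3) gw(1,2)] fg by auto
  have hi: "h i = Some u" using h_eq[of i] u ij by simp
  have coll: "h (i - 1) = h i" if "i - 1 \<in> dom h"
  proof -
    \<comment> \<open>Passing to A_j adds only j - 1 \<ge> i, so i - 1 comes from A.\<close>
    have "i - 1 \<in> A" "i - 1 \<noteq> j" using that ij unfolding hw(2) lower_def by auto
    then show ?thesis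
      using d_mor_factor_imp(2)[OF ij(1,3) gw(1,2)] fg h_eq[of "i - 1"] hi u by simp
  qed
  obtain k where k: "k \<in> Mor (EC n)" "dom k = lower (lower A j) i" "ran k = B"
    "k \<circ>\<^sub>m d_mor (lower A j) i = h"
    using factor_d_mor[OF hw(1) hi u(2) coll] unfolding hw(2,3) by blast
  from ex_EC_walk[OF k(1)] obtain r where
    r: "EC_walk n (lower (lower A j) i) r B" "eval_walk (lower (lower A j) i) r = k"
    unfolding k by blast
  have arcs: "d_mor A i \<in> arcs (EC_quiver n)" "d_mor A j \<in> arcs (EC_quiver n)"
    using p q by simp_all
  have Ai: "lower A i \<subseteq> {1..n}" and Aj: "lower A j \<subseteq> {1..n}"
    using lower_subset[OF A ij(1,3)] lower_subset[OF A ij(2) j2] by blast+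
  have iAj: "i \<in> lower A j" and jAi: "j \<in> lower A i" using ij by (auto simp: lower_def)
  have arcj: "d_mor (lower A j) i \<in> arcs (EC_quiver n)"
    and arci: "d_mor (lower A i) j \<in> arcs (EC_quiver n)"
    using Ai Aj iAj jAi ij j2 unfolding arcs_EC_quiver_iff by blast+
  have wr: "EC_walk n (lower A j) (d_mor (lower A j) i # r) B"
    using arcj r iAj ij by (simp add: dom_d_mor ran_d_mor)
  have "R (lower A j) B q (d_mor (lower A j) i # r)"
    by (rule IH) (use lesq wq wr k r iAj ij in \<open>simp_all add: ran_d_mor h_def[symmetric]\<close>)
  with cons[OF arcs(2), of q B "d_mor (lower A j) i # r"] wq wr
  have qr: "R A B (d_mor A j # q) (d_mor A j # d_mor (lower A j) i # r)"
    by (simp only: rj dj)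
  \<comment> \<open>The tail s is what follows d_i on the other side of the relation: two arrows
    before r if j = i + 1, one arrow otherwise.\<close>
  obtain s where s: "EC_walk n (lower A i) s B"
    "R A B (d_mor A j # d_mor (lower A j) i # r) (d_mor A i # s)"
    "eval_walk (lower A i) s \<circ>\<^sub>m d_mor A i = f"
  proof (cases "j = i + 1")
    case True
    let ?A' = "lower (lower A i) (i + 1)"
    have A': "?A' \<subseteq> {1..n}" "i \<in> ?A'"
      using lower_subset[OF Ai jAi j2] True by (simp_all add: lower_def)
    then have arc': "d_mor ?A' i \<in> arcs (EC_quiver n)"
      using ij unfolding arcs_EC_quiver_iff by blast
    let ?s = "d_mor (lower A i) j # d_mor ?A' i # r"
    have l: "lower ?A' i = lower (lower A j) i"
      using lower_braid[OF ij(1,3)] True by simp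
    have "EC_walk n (lower A i) ?s B"
      using arci arc' A' jAi j2 r ij l True by (simp add: dom_d_mor ran_d_mor)
    moreover have "R A B (d_mor A j # d_mor (lower A j) i # r) (d_mor A i # ?s)"
      using braid[of A i r B] A ij r True by simp
    moreover have "eval_walk (lower A i) ?s \<circ>\<^sub>m d_mor A i = f"
    proof -
      have "eval_walk (lower A i) ?s \<circ>\<^sub>m d_mor A i =
          k \<circ>\<^sub>m (d_mor ?A' i \<circ>\<^sub>m (d_mor (lower A i) (i + 1) \<circ>\<^sub>m d_mor A i))"
        using A' jAi j2 ij l r True by (simp add: ran_d_mor map_comp_assoc)
      also have "\<dots> = k \<circ>\<^sub>m (d_mor (lower A j) i \<circ>\<^sub>m d_mor A j)"
        using d_mor_braid[of i A] ij True by simp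
      also have "\<dots> = f" using k fh by (simp add: map_comp_assoc[symmetric])
      finally show ?thesis .
    qed
    ultimately show ?thesis using that by blast
  next
    case False
    let ?s = "d_mor (lower A i) j # r"
    have l: "lower (lower A i) j = lower (lower A j) i"
      using lower_commute[of i j A] ij False by simp
    have "EC_walk n (lower A i) ?s B"
      using arci jAi j2 r l by (simp add: dom_d_mor ran_d_mor)
    moreover have "R A B (d_mor A j # d_mor (lower A j) i # r) (d_mor A i # ?s)"
      using commute[of A i j r B] A ij r False by simp
    moreover have "eval_walk (lower A i) ?s \<circ>\<^sub>m d_mor A i = f"
    proof -
      have "eval_walk (lower A i) ?s \<circ>\<^sub>m d_mor A i = k \<circ>\<^sub>m (d_mor (lower A i) j \<circ>\<^sub>m d_mor A i)"
        using jAi j2 l r by (simp add: ran_d_mor map_comp_assoc)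
      also have "\<dots> = k \<circ>\<^sub>m (d_mor (lower A j) i \<circ>\<^sub>m d_mor A j)"
        using d_mor_commute[of i A j] ij False by simp
      also have "\<dots> = f" using k fh by (simp add: map_comp_assoc[symmetric])
      finally show ?thesis .
    qed
    ultimately show ?thesis using that by blast
  qed
  \<comment> \<open>Cancelling the epimorphism d_i shows that p and s have the same value, of
    smaller displacement than f.\<close>
  have "g = eval_walk (lower A i) s"
    by (rule map_comp_right_cancel[where f = "d_mor A i"])
      (use gw eval_walk[OF s(1)] ri fg s(3) in simp_all)
  then have "R (lower A i) B p s"
    by (intro IH) (use lesp wp s(1) in \<open>simp_all add: g_def[symmetric]\<close>)
  with cons[OF arcs(1), of p B s] wp s(1) have "R A B (d_mor A i # p) (d_mor A i # s)"
    by (simp only: ri di)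
  then show ?thesis using qr s(2) sym trans by blast
qed

text \<open>Only the first arrows need attention. Equal ones are cancelled, and different ones fall
  under \<open>related_if_lower_first\<close>, applied to the walk with the smaller index
  first.\<close>

theorem eval_walk_eq_imp_related:
  "EC_walk n A p B \<Longrightarrow> EC_walk n A q B \<Longrightarrow> eval_walk A p = eval_walk A q \<Longrightarrow> R A B p q"
proof (induction "disp (eval_walk A p)" arbitrary: A p q rule: less_induct)
  case less
  note p = less.prems(1) and q = less.prems(2) and pq = less.prems(3)
  have IH: "R A' B p' q'" if "disp (eval_walk A' p') < disp (eval_walk A p)"
      "EC_walk n A' p' B" "EC_walk n A' q' B" "eval_walk A' p' = eval_walk A' q'" for A' p' q'
    using less.hyps that by blast
  show ?case
  proof (cases "p = [] \<or> q = []")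
    case True
    \<comment> \<open>A nonempty walk has positive displacement, so an identity value leaves only
      the empty walk.\<close>
    have "p' = []" if "EC_walk n A p' B" "disp (eval_walk A p') = 0" for p'
      using disp_eval_walk_Cons[of n A _ _ B] that by (cases p') (fastforce simp del: eval_walk.simps)+
    moreover have "eval_walk A p = Some |` A" using True pq by auto
    then have "disp (eval_walk A p) = 0" by (metis disp_id)
    ultimately have "p = []" "q = []" using p q pq by auto
    then show ?thesis using refl p by blast
  next
    case False
    then obtain d p' e q' where pe: "p = d # p'" and qe: "q = e # q'" by (metis list.exhaust)
    have d: "d \<in> arcs (EC_quiver n)" "dom d = A" and e: "e \<in> arcs (EC_quiver n)" "dom e = A"
      using p q pe qe by simp_all
    obtain i where i: "d = d_mor A i" "i \<in> A" "2 \<le> i" and A: "A \<subseteq> {1..n}"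
      using d unfolding arcs_EC_quiver_iff by (auto simp: dom_d_mor)
    obtain j where j: "e = d_mor A j" "j \<in> A" "2 \<le> j"
      using e unfolding arcs_EC_quiver_iff by (auto simp: dom_d_mor)
    consider "i = j" | "i < j" | "j < i" by linarith
    then show ?thesis
    proof cases
      case 1
      then have ed: "e = d" using i j by simp
      have w: "EC_walk n (ran d) p' B" "EC_walk n (ran d) q' B"
        using p q pe qe ed by simp_all
      have "eval_walk (ran d) p' = eval_walk (ran d) q'"
        by (rule map_comp_right_cancel[where f = d])
          (use eval_walk[OF w(1)] eval_walk[OF w(2)] pq pe qe ed in simp_all)
      moreover have "disp (eval_walk (ran d) p') < disp (eval_walk A p)"
        using disp_eval_walk_Cons p pe by blast
      ultimately have "R (ran d) B p' q'" using IH w by blast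
      from cons[OF d(1) w this] show ?thesis using pe qe ed d by simp
    next
      case 2
      show ?thesis
        unfolding pe qe i(1) j(1)
        by (rule related_if_lower_first[OF IH A i(2) j(2) i(3) 2])
          (use p q pq pe qe i j in auto)
    next
      case 3
      have "R A B q p"
        unfolding pe qe i(1) j(1)
        by (rule related_if_lower_first[OF IH A j(2) i(2) j(3) 3])
          (use p q pq pe qe i j in auto)
      then show ?thesis by (rule sym)
    qed
  qed
qed

end

section \<open>Modules and quotient algebras\<close>

lemma ring_power_algebra: "ring (power_algebra r :: ('k::field, nat \<Rightarrow> 'k) module)" (is "ring ?P")
proof -
  have ext: "f = g" if "f \<in> carrier ?P" "g \<in> carrier ?P" "\<And>i. i < r \<Longrightarrow> f i = g i" for f g
    by (rule PiE_ext[of f "{..<r}" "\<lambda>_. UNIV" g]) (use that in \<open>simp_all add: power_algebra_def\<close>)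
  have closed: "f \<oplus>\<^bsub>?P\<^esub> g \<in> carrier ?P" "f \<otimes>\<^bsub>?P\<^esub> g \<in> carrier ?P"
    "\<zero>\<^bsub>?P\<^esub> \<in> carrier ?P" "\<one>\<^bsub>?P\<^esub> \<in> carrier ?P" for f g
    by (simp_all add: power_algebra_def)
  have at: "(f \<oplus>\<^bsub>?P\<^esub> g) i = f i + g i" "(f \<otimes>\<^bsub>?P\<^esub> g) i = f i * g i"
    "\<zero>\<^bsub>?P\<^esub> i = 0" "\<one>\<^bsub>?P\<^esub> i = 1" if "i < r" for f g i
    using that by (simp_all add: power_algebra_def)
  have ab: "abelian_group ?P"
  proof (rule abelian_groupI)
    fix x assume x: "x \<in> carrier ?P"
    have m: "(\<lambda>i\<in>{..<r}. - x i) \<in> carrier ?P" by (simp add: power_algebra_def)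
    moreover have "(\<lambda>i\<in>{..<r}. - x i) \<oplus>\<^bsub>?P\<^esub> x = \<zero>\<^bsub>?P\<^esub>"
      by (rule ext) (simp_all add: closed at)
    ultimately show "\<exists>y\<in>carrier ?P. y \<oplus>\<^bsub>?P\<^esub> x = \<zero>\<^bsub>?P\<^esub>" by blast
  qed (auto intro!: ext simp: closed at ac_simps)
  have mon: "Group.monoid ?P"
    by (rule monoidI) (auto intro!: ext simp: closed at ac_simps)
  show ?thesis
    by (rule ringI[OF ab mon]) (auto intro!: ext simp: closed at algebra_simps)
qed

context k_algebra
begin

text \<open>A scalar multiple of x is the product of c 1 with x, so ideals are subspaces.\<close>

lemma ideal_smult_closed:
  assumes "ideal I A" "x \<in> I"
  shows "c \<odot> x \<in> I"
proof -
  interpret I: ideal I A by (rule assms(1))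
  have "(c \<odot> \<one>) \<otimes> x \<in> I"
    using I.I_l_closed[OF assms(2)] smult_closed[of c \<one>] by (simp add: ring_of_type_algebra_def)
  then show ?thesis using smult_mult_left[of \<one> x c] I.a_Hcarr[OF assms(2)] by simp
qed

lemma coset_eq_iff:
  assumes "ideal I A" "x \<in> carrier A" "y \<in> carrier A"
  shows "I +> x = I +> y \<longleftrightarrow> x \<ominus> y \<in> I"
proof -
  interpret I: ideal I A by (rule assms(1))
  have "I +> x = I +> y \<longleftrightarrow> x \<in> I +> y"
    using I.a_rcos_self[OF assms(2)] I.a_repr_independence'[of x y] assms by auto
  also have "\<dots> \<longleftrightarrow> x \<ominus> y \<in> I"
    using I.a_rcos_module_minus[OF A.ring_axioms assms(3,2)] .
  finally show ?thesis .
qed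

lemma smult_quotient_algebra:
  assumes I: "ideal I A" and x: "x \<in> carrier A"
  shows "c \<odot>\<^bsub>quotient_algebra A I\<^esub> (I +> x) = I +> (c \<odot> x)"
proof -
  interpret I: ideal I A by (rule I)
  have cl: "c \<odot> z \<in> carrier A" if "z \<in> carrier A" for z
    using smult_closed[of c z] that by (simp add: ring_of_type_algebra_def)
  \<comment> \<open>Scaling a coset is defined as a union over its representatives. It is a single
    coset because the ideal absorbs c i.\<close>
  have "I +> (c \<odot> y) = I +> (c \<odot> x)" if y: "y \<in> I +> x" for y
  proof -
    obtain i where i: "i \<in> I" "y = i \<oplus> x"
      using y by (auto simp: a_r_coset_def')
    have ic: "i \<in> carrier A" using i by simp
    have "c \<odot> y = c \<odot> i \<oplus> c \<odot> x"
      using smult_r_distr[of c i x] ic x i by (simp add: ring_of_type_algebra_def)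
    then have "c \<odot> y \<ominus> c \<odot> x = c \<odot> i"
      using cl[OF ic] cl[OF x] by (simp add: M.minus_eq M.a_assoc M.r_neg)
    then show ?thesis
      using ideal_smult_closed[OF I i(1)] cl x ic i by (simp add: coset_eq_iff[OF I])
  qed
  then have "(\<Union>y\<in>I +> x. I +> (c \<odot> y)) = (\<Union>y\<in>I +> x. I +> (c \<odot> x))"
    by (rule SUP_cong[OF HOL.refl])
  also have "\<dots> = I +> (c \<odot> x)"
    using I.a_rcos_self[OF x] by (intro UN_constant_eq) simp_all
  finally show ?thesis by (simp only: quotient_algebra_def module.select_convs)
qed

end

text \<open>Finite sums depend on carrier, addition and zero, which the two records share. Sums in
  the quotient algebra can thus be computed in the quotient ring.\<close>

lemma finsum_quotient_algebra: "finsum (quotient_algebra A I) = finsum (A Quot I)"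
  by (intro ext) (simp add: finsum_def finprod_def quotient_algebra_def)

section \<open>Algebras isomorphic to the category algebra\<close>

abbreviation cmul ::
    "((nat \<rightharpoonup> nat) \<Rightarrow>\<^sub>0 'k::field) \<Rightarrow> ((nat \<rightharpoonup> nat) \<Rightarrow>\<^sub>0 'k) \<Rightarrow> ((nat \<rightharpoonup> nat) \<Rightarrow>\<^sub>0 'k)" where
  "cmul \<equiv> bilin_ext (\<lambda>g f. dom g = ran f) (\<circ>\<^sub>m)"

abbreviation EC_hom :: "nat \<Rightarrow> nat set \<Rightarrow> nat set \<Rightarrow> (nat \<rightharpoonup> nat) set" where
  "EC_hom n \<equiv> cat_hom (EC n)"

lemma EC_hom_iff: "f \<in> EC_hom n B C \<longleftrightarrow> f \<in> Mor (EC n) \<and> dom f = B \<and> ran f = C"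
  by (simp add: cat_hom_def EC_def)

text \<open>Trivial endomorphisms make the corner at a vertex one-dimensional, whence the vertex is
  primitive.\<close>

lemma EC_hom_self: "B \<subseteq> {1..n} \<Longrightarrow> EC_hom n B B = {Some |` B}"
  by (auto simp: EC_hom_iff id_in_Mor_EC) (metis endo_EC)

lemma keys_cmul_subset:
  assumes "Poly_Mapping.keys p \<subseteq> S" "Poly_Mapping.keys q \<subseteq> T"
    and "\<And>g f. g \<in> S \<Longrightarrow> f \<in> T \<Longrightarrow> dom g = ran f \<Longrightarrow> g \<circ>\<^sub>m f \<in> U"
  shows "Poly_Mapping.keys (cmul p q) \<subseteq> U"
  by (rule keys_bilin_ext_subset) (use assms in blast)

text \<open>In the category an identity factors only as itself times itself, so a single product
  contributes to this coefficient.\<close>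

lemma lookup_cmul_id:
  assumes "Poly_Mapping.keys p \<subseteq> Mor (EC n)" "Poly_Mapping.keys q \<subseteq> Mor (EC n)"
  shows "Poly_Mapping.lookup (cmul p q) (Some |` B) =
    Poly_Mapping.lookup p (Some |` B) * Poly_Mapping.lookup q (Some |` B)"
  using assms(1)
proof (induction p rule: poly_mapping_span_induct)
  case (single g a)
  show ?case
    using assms(2)
  proof (induction q rule: poly_mapping_span_induct)
    case (single f b)
    have "f = Some |` B \<and> g = Some |` B" if "dom g = ran f" "g \<circ>\<^sub>m f = Some |` B"
    proof -
      have df: "dom f = B" using dom_map_comp_eq[of f g] that by (simp add: equalityD1)
      have "ran g = B" using ran_map_comp_eq[of f g] that by simp
      then have "disp f = 0"
        using comp_eq_id_EC[OF single \<open>g \<in> Mor (EC n)\<close> that(1)] df by simp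
      then have f: "f = Some |` B" using disp_eq_0[OF single] df by simp
      then have "g = Some |` B" using map_comp_id_right[of g B] that by simp
      then show ?thesis using f by simp
    qed
    moreover have "(Some |` B) \<circ>\<^sub>m (Some |` B) = Some |` B" by (rule map_comp_id_right) simp
    ultimately show ?case
      by (auto simp: bilin_ext_single lookup_single when_def)
  qed (simp_all add: bilin_ext_add_right lookup_add algebra_simps)
qed (simp_all add: bilin_ext_add_left lookup_add algebra_simps)

lemma lookup_cmul_corner:
  assumes "Poly_Mapping.keys p \<subseteq> Mor (EC n)"
  shows "Poly_Mapping.lookup
      (cmul (cmul (Poly_Mapping.single (Some |` C) 1) p) (Poly_Mapping.single (Some |` B) 1)) f =
    (if f \<in> EC_hom n B C then Poly_Mapping.lookup p f else 0)"
  using assms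
proof (induction p rule: poly_mapping_span_induct)
  case (single g a)
  show ?case
  proof (cases "dom g = B \<and> ran g = C")
    case True
    then have "(Some |` C) \<circ>\<^sub>m g = g" "g \<circ>\<^sub>m (Some |` B) = g"
      by (simp_all add: map_comp_id_left map_comp_id_right)
    then show ?thesis using True single
      by (auto simp: bilin_ext_single lookup_single when_def EC_hom_iff)
  next
    case False
    have "cmul (cmul (Poly_Mapping.single (Some |` C) 1) (Poly_Mapping.single g a))
        (Poly_Mapping.single (Some |` B) 1) = 0"
    proof (cases "ran g = C")
      case True
      then have "(Some |` C) \<circ>\<^sub>m g = g" by (simp add: map_comp_id_left)
      then show ?thesis using True False by (simp add: bilin_ext_single)
    qed (simp add: bilin_ext_single)
    then show ?thesis using False by (auto simp: lookup_single when_def EC_hom_iff)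
  qed
qed (simp_all add: bilin_ext_add_left bilin_ext_add_right lookup_add)

text \<open>In a composable f g f the map g would lead from the range of f back to its domain, which
  forces f to be an identity.\<close>

lemma cmul_sandwich_eq_0:
  assumes "Poly_Mapping.keys p \<subseteq> Mor (EC n)" "f \<in> Mor (EC n)" "disp f \<noteq> 0"
  shows "cmul (cmul (Poly_Mapping.single f 1) p) (Poly_Mapping.single f 1) = 0"
  using assms(1)
proof (induction p rule: poly_mapping_span_induct)
  case (single g a)
  have "\<not> (dom f = ran g \<and> dom (f \<circ>\<^sub>m g) = ran f)"
    using comp_eq_id_EC[OF assms(2) single] assms(3) dom_map_comp_eq[of g f] by auto
  then show ?case by (auto simp: bilin_ext_single)
qed (simp_all add: bilin_ext_add_left bilin_ext_add_right)

text \<open>\<open>co\<close> is an algebra isomorphism onto the category algebra: the coordinates in a basis that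
  multiplies like the morphisms.\<close>

locale EC_algebra = k_algebra A for A :: "('k::field, 'a) module" (structure) +
  fixes n :: nat and co :: "'a \<Rightarrow> ((nat \<rightharpoonup> nat) \<Rightarrow>\<^sub>0 'k)"
  assumes co_bij: "bij_betw co (carrier A) {p. Poly_Mapping.keys p \<subseteq> Mor (EC n)}"
    and co_add: "x \<in> carrier A \<Longrightarrow> y \<in> carrier A \<Longrightarrow> co (x \<oplus> y) = co x + co y"
    and co_mult: "x \<in> carrier A \<Longrightarrow> y \<in> carrier A \<Longrightarrow> co (x \<otimes> y) = cmul (co x) (co y)"
    and co_smult: "x \<in> carrier A \<Longrightarrow> co (c \<odot> x) = scale_pm c (co x)"
    and co_one: "co \<one> = (\<Sum>B\<in>Pow {1..n}. Poly_Mapping.single (Some |` B) 1)"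
begin

lemma keys_co: "x \<in> carrier A \<Longrightarrow> Poly_Mapping.keys (co x) \<subseteq> Mor (EC n)"
  using bij_betwE[OF co_bij] by blast

lemma co_inject: "x \<in> carrier A \<Longrightarrow> y \<in> carrier A \<Longrightarrow> co x = co y \<longleftrightarrow> x = y"
  using bij_betw_imp_inj_on[OF co_bij] by (auto dest: inj_onD)

definition elt :: "((nat \<rightharpoonup> nat) \<Rightarrow>\<^sub>0 'k) \<Rightarrow> 'a" where
  "elt = inv_into (carrier A) co"

lemma elt_closed [simp]: "Poly_Mapping.keys p \<subseteq> Mor (EC n) \<Longrightarrow> elt p \<in> carrier A"
  using bij_betwE[OF bij_betw_inv_into[OF co_bij]] by (simp add: elt_def)

lemma co_elt [simp]: "Poly_Mapping.keys p \<subseteq> Mor (EC n) \<Longrightarrow> co (elt p) = p"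
  using bij_betw_inv_into_right[OF co_bij] by (simp add: elt_def)

lemma elt_co [simp]: "x \<in> carrier A \<Longrightarrow> elt (co x) = x"
  using bij_betw_inv_into_left[OF co_bij] by (simp add: elt_def)

lemma smult_in_carrier [simp]: "x \<in> carrier A \<Longrightarrow> c \<odot> x \<in> carrier A"
  using smult_closed[of c x] by (simp add: ring_of_type_algebra_def)

lemma co_zero [simp]: "co \<zero> = 0"
  using co_add[of \<zero> \<zero>] by simp

lemma co_uminus: "x \<in> carrier A \<Longrightarrow> co (\<ominus> x) = - co x"
  using co_add[of "\<ominus> x" x] by (simp add: M.l_neg eq_neg_iff_add_eq_0)

lemma co_minus: "x \<in> carrier A \<Longrightarrow> y \<in> carrier A \<Longrightarrow> co (x \<ominus> y) = co x - co y"
  by (simp add: M.minus_eq co_add co_uminus)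

lemma co_finsum:
  "finite I \<Longrightarrow> f \<in> I \<rightarrow> carrier A \<Longrightarrow> co (finsum A f I) = (\<Sum>i\<in>I. co (f i))"
  by (induction I rule: finite_induct) (simp_all add: co_add)

lemma elt_add:
  assumes "Poly_Mapping.keys p \<subseteq> Mor (EC n)" "Poly_Mapping.keys q \<subseteq> Mor (EC n)"
  shows "elt (p + q) = elt p \<oplus> elt q"
  using assms keys_add_subset[OF assms] co_inject[of "elt (p + q)" "elt p \<oplus> elt q"]
  by (simp add: co_add)

lemma elt_zero [simp]: "elt 0 = \<zero>"
  using elt_co[of \<zero>] by simp

definition basis :: "(nat \<rightharpoonup> nat) \<Rightarrow> 'a" where
  "basis f = elt (Poly_Mapping.single f 1)"

lemma basis_closed [simp]: "f \<in> Mor (EC n) \<Longrightarrow> basis f \<in> carrier A"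
  by (simp add: basis_def)

lemma co_basis [simp]: "f \<in> Mor (EC n) \<Longrightarrow> co (basis f) = Poly_Mapping.single f 1"
  by (simp add: basis_def)

definition span :: "(nat \<rightharpoonup> nat) set \<Rightarrow> 'a set" where
  "span S = {x \<in> carrier A. Poly_Mapping.keys (co x) \<subseteq> S}"

text \<open>Minimality of the span, to be applied with \<open>T\<close> a maximal left ideal and
  with \<open>T\<close> the square of the radical.\<close>

lemma span_subset:
  assumes S: "S \<subseteq> Mor (EC n)" and T: "\<zero> \<in> T" "\<And>x y. x \<in> T \<Longrightarrow> y \<in> T \<Longrightarrow> x \<oplus> y \<in> T"
    and smult: "\<And>c x. x \<in> T \<Longrightarrow> c \<odot> x \<in> T" and basis: "\<And>f. f \<in> S \<Longrightarrow> basis f \<in> T"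
  shows "span S \<subseteq> T"
proof
  fix x assume "x \<in> span S"
  then have x: "x \<in> carrier A" "Poly_Mapping.keys (co x) \<subseteq> S" by (simp_all add: span_def)
  have "elt p \<in> T" if "Poly_Mapping.keys p \<subseteq> S" for p
    using that
  proof (induction p rule: poly_mapping_span_induct)
    case (add p q)
    then show ?case using S T(2) by (simp add: elt_add order_trans)
  next
    case (single f c)
    have f: "f \<in> Mor (EC n)" using single S by blast
    have "co (elt (Poly_Mapping.single f c)) = co (c \<odot> basis f)"
      using f keys_single_subset[OF f] by (simp add: co_smult)
    then have "elt (Poly_Mapping.single f c) = c \<odot> basis f"
      using f keys_single_subset[OF f, of c] by (simp add: co_inject)
    then show ?case using smult basis single by simp
  qed (use T in simp)
  from this[OF x(2)] show "x \<in> T" using x by simp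
qed

lemma ideal_span:
  assumes "S \<subseteq> Mor (EC n)"
    and "\<And>g f. g \<in> Mor (EC n) \<Longrightarrow> f \<in> S \<Longrightarrow> dom g = ran f \<Longrightarrow> g \<circ>\<^sub>m f \<in> S"
    and "\<And>g f. g \<in> S \<Longrightarrow> f \<in> Mor (EC n) \<Longrightarrow> dom g = ran f \<Longrightarrow> g \<circ>\<^sub>m f \<in> S"
  shows "ideal (span S) A"
proof (rule idealI)
  show "ring A" by (rule A.ring_axioms)
  show "subgroup (span S) (add_monoid A)"
  proof
    show "inv\<^bsub>add_monoid A\<^esub> x \<in> span S" if "x \<in> span S" for x
      using that unfolding a_inv_def[symmetric] by (simp add: span_def co_uminus keys_uminus_eq)
  qed (auto simp: span_def co_add intro: subsetD[OF keys_add_subset])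
next
  fix a x assume a: "a \<in> span S" and x: "x \<in> carrier A"
  show "x \<otimes> a \<in> span S"
    using a x keys_cmul_subset[OF keys_co[OF x], of "co a" S S] assms(2)
    by (simp add: span_def co_mult)
  show "a \<otimes> x \<in> span S"
    using a x keys_cmul_subset[OF _ keys_co[OF x], of "co a" S S] assms(3)
    by (simp add: span_def co_mult)
qed

abbreviation vertex :: "nat set \<Rightarrow> 'a" where
  "vertex B \<equiv> basis (Some |` B)"

text \<open>Multiplying by the two vertices deletes coefficients without changing the others. With
  all morphisms for \<open>S\<close> this gives the hom-spaces, with the non-identities the arrow
  spaces.\<close>

lemma corner_span:
  assumes "B \<subseteq> {1..n}" "C \<subseteq> {1..n}" "S \<subseteq> Mor (EC n)"
  shows "{vertex C \<otimes> x \<otimes> vertex B |x. x \<in> span S} = span (S \<inter> EC_hom n B C)"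
proof -
  note B = id_in_Mor_EC[OF assms(1)] and C = id_in_Mor_EC[OF assms(2)]
  have lk: "Poly_Mapping.lookup (co (vertex C \<otimes> x \<otimes> vertex B)) f =
      (if f \<in> EC_hom n B C then Poly_Mapping.lookup (co x) f else 0)" if "x \<in> carrier A" for x f
    using that B C keys_co[OF that] by (simp add: co_mult lookup_cmul_corner)
  show ?thesis
  proof (intro Set.set_eqI iffI)
    fix y assume "y \<in> {vertex C \<otimes> x \<otimes> vertex B |x. x \<in> span S}"
    then obtain x where x: "x \<in> carrier A" "Poly_Mapping.keys (co x) \<subseteq> S"
      and y: "y = vertex C \<otimes> x \<otimes> vertex B" by (auto simp: span_def)
    have "Poly_Mapping.keys (co y) \<subseteq> S \<inter> EC_hom n B C"
      using x(2) unfolding y by (auto simp: in_keys_iff lk[OF x(1)] split: if_splits)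
    then show "y \<in> span (S \<inter> EC_hom n B C)"
      using x B C by (simp add: span_def y)
  next
    fix y assume "y \<in> span (S \<inter> EC_hom n B C)"
    then have y: "y \<in> carrier A" "Poly_Mapping.keys (co y) \<subseteq> S" "Poly_Mapping.keys (co y) \<subseteq> EC_hom n B C"
      by (auto simp: span_def)
    have "co (vertex C \<otimes> y \<otimes> vertex B) = co y"
      by (rule poly_mapping_eqI) (use y in \<open>auto simp: lk in_keys_iff\<close>)
    then have "vertex C \<otimes> y \<otimes> vertex B = y" using y B C by (simp add: co_inject)
    then show "y \<in> {vertex C \<otimes> x \<otimes> vertex B |x. x \<in> span S}"
      using y by (force simp: span_def)
  qed
qed

lemma carrier_eq_span: "carrier A = span (Mor (EC n))"
  using keys_co by (auto simp: span_def)

subsection \<open>The radical\<close>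

definition non_ids :: "(nat \<rightharpoonup> nat) set" where
  "non_ids = {f \<in> Mor (EC n). disp f \<noteq> 0}"

definition reducibles :: "(nat \<rightharpoonup> nat) set" where
  "reducibles = {f \<in> Mor (EC n). 2 \<le> disp f}"

text \<open>The one-dimensional representation attached to the object B; multiplicativity is
  \<open>lookup_cmul_id\<close>.\<close>

definition char_at :: "nat set \<Rightarrow> 'a \<Rightarrow> 'k" where
  "char_at B x = Poly_Mapping.lookup (co x) (Some |` B)"

lemma char_at_simps:
  assumes "x \<in> carrier A" "y \<in> carrier A"
  shows "char_at B (x \<oplus> y) = char_at B x + char_at B y"
    "char_at B (x \<ominus> y) = char_at B x - char_at B y"
    "char_at B (x \<otimes> y) = char_at B x * char_at B y"
    "char_at B (c \<odot> x) = c * char_at B x"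
  using assms keys_co[of x] keys_co[of y]
  by (simp_all add: char_at_def co_add co_minus co_mult co_smult lookup_add lookup_minus lookup_cmul_id)

lemma char_at_zero [simp]: "char_at B \<zero> = 0"
  by (simp add: char_at_def)

lemma char_at_one: "B \<subseteq> {1..n} \<Longrightarrow> char_at B \<one> = 1"
  by (simp add: char_at_def co_one lookup_sum lookup_single when_def)

lemma char_at_uminus: "x \<in> carrier A \<Longrightarrow> char_at B (\<ominus> x) = - char_at B x"
  by (simp add: char_at_def co_uminus)

lemma left_ideal_char_kernel: "left_ideal {x \<in> carrier A. char_at B x = 0} A"
  unfolding left_ideal_def
proof (intro conjI ballI additive_subgroup.intro)
  show "subgroup {x \<in> carrier A. char_at B x = 0} (add_monoid A)"
  proof
    show "inv\<^bsub>add_monoid A\<^esub> x \<in> {x \<in> carrier A. char_at B x = 0}"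
      if "x \<in> {x \<in> carrier A. char_at B x = 0}" for x
      using that unfolding a_inv_def[symmetric] by (simp add: char_at_uminus)
  qed (auto simp: char_at_simps)
qed (simp add: char_at_simps)

text \<open>A left ideal is an additive subgroup by definition; scalars act on it through left
  multiplication by c 1.\<close>

lemma left_ideal_carrierI:
  assumes "left_ideal J A"
  shows "J \<subseteq> carrier A" "x \<in> J \<Longrightarrow> y \<in> J \<Longrightarrow> x \<oplus> y \<in> J" "a \<in> carrier A \<Longrightarrow> x \<in> J \<Longrightarrow> a \<otimes> x \<in> J"
    "x \<in> J \<Longrightarrow> c \<odot> x \<in> J" "\<zero> \<in> J"
proof -
  interpret additive_subgroup J A using assms by (simp add: left_ideal_def)
  show sub: "J \<subseteq> carrier A" by (rule a_subset)
  show "x \<in> J \<Longrightarrow> y \<in> J \<Longrightarrow> x \<oplus> y \<in> J" by simp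
  show mult: "x \<in> J \<Longrightarrow> a \<otimes> x \<in> J" if "a \<in> carrier A" for a x
    using assms that by (simp add: left_ideal_def)
  show "\<zero> \<in> J" by simp
  show "c \<odot> x \<in> J" if "x \<in> J"
    using mult[of "c \<odot> \<one>" x] sub that smult_mult_left[of \<one> x c] by auto
qed

text \<open>The kernel has codimension one, so together with any element outside it spans the whole
  algebra.\<close>

lemma maximal_left_ideal_char_kernel:
  assumes B: "B \<subseteq> {1..n}"
  shows "maximal_left_ideal {x \<in> carrier A. char_at B x = 0} A"
  unfolding maximal_left_ideal_def
proof (intro conjI allI impI left_ideal_char_kernel)
  show "{x \<in> carrier A. char_at B x = 0} \<noteq> carrier A"
  proof
    assume "{x \<in> carrier A. char_at B x = 0} = carrier A"
    then have "\<one> \<in> {x \<in> carrier A. char_at B x = 0}" by simp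
    then show False using char_at_one[OF B] by simp
  qed
next
  fix J assume J: "left_ideal J A \<and> {x \<in> carrier A. char_at B x = 0} \<subseteq> J"
  note Jc = left_ideal_carrierI[OF J[THEN conjunct1]]
  show "J = {x \<in> carrier A. char_at B x = 0} \<or> J = carrier A"
  proof (rule disjCI)
    assume "J \<noteq> carrier A"
    have "char_at B y = 0" if y: "y \<in> J" for y
    proof (rule ccontr)
      assume nz: "char_at B y \<noteq> 0"
      have yc: "y \<in> carrier A" using y Jc by blast
      have "x \<in> J" if x: "x \<in> carrier A" for x
      proof -
        \<comment> \<open>The scalar makes the character of x minus this multiple of y
          vanish.\<close>
        let ?z = "(char_at B x / char_at B y) \<odot> y"
        have "x \<ominus> ?z \<in> J" using J x yc nz by (auto simp: char_at_simps)
        moreover have "?z \<in> J" using Jc(4) y by blast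
        ultimately have "(x \<ominus> ?z) \<oplus> ?z \<in> J" by (rule Jc(2))
        moreover have "(x \<ominus> ?z) \<oplus> ?z = x"
          using x yc by (simp add: M.minus_eq M.a_assoc M.l_neg)
        ultimately show ?thesis by simp
      qed
      then show False using \<open>J \<noteq> carrier A\<close> Jc(1) by blast
    qed
    then show "J = {x \<in> carrier A. char_at B x = 0}" using J Jc(1) by blast
  qed
qed

text \<open>A non-identity \<open>f\<close> satisfies \<open>f A f = 0\<close>, which forces \<open>f\<close> into every maximal left ideal
  \<open>L\<close>: otherwise \<open>1 = m + a f\<close> with \<open>m \<in> L\<close>, whence \<open>f = f m \<in> L\<close>.\<close>

lemma basis_in_maximal_left_ideal:
  assumes L: "maximal_left_ideal L A" and f: "f \<in> non_ids"
  shows "basis f \<in> L"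
proof (rule ccontr)
  assume nL: "basis f \<notin> L"
  have fM: "f \<in> Mor (EC n)" "disp f \<noteq> 0" using f by (simp_all add: non_ids_def)
  note b = basis_closed[OF fM(1)]
  have lL: "left_ideal L A" using L by (simp add: maximal_left_ideal_def)
  note Lc = left_ideal_carrierI[OF lL]
  define K where "K = {m \<oplus> a \<otimes> basis f |m a. m \<in> L \<and> a \<in> carrier A}"
  have K_I: "m \<oplus> a \<otimes> basis f \<in> K" if "m \<in> L" "a \<in> carrier A" for m a
    using that by (auto simp: K_def)
  have Lcar: "m \<in> carrier A" if "m \<in> L" for m
    using that Lc(1) by blast
  have "left_ideal K A"
    unfolding left_ideal_def
  proof (intro conjI ballI additive_subgroup.intro)
    show "subgroup K (add_monoid A)"
    proof
      show "K \<subseteq> carrier (add_monoid A)" using Lc(1) b by (auto simp: K_def)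
      show "x \<otimes>\<^bsub>add_monoid A\<^esub> y \<in> K" if "x \<in> K" "y \<in> K" for x y
      proof -
        from that obtain m a m' a' where *: "m \<in> L" "a \<in> carrier A" "x = m \<oplus> a \<otimes> basis f"
          "m' \<in> L" "a' \<in> carrier A" "y = m' \<oplus> a' \<otimes> basis f" by (auto simp: K_def)
        then have "x \<oplus> y = (m \<oplus> m') \<oplus> (a \<oplus> a') \<otimes> basis f"
          using Lcar[OF *(1)] Lcar[OF *(4)] b by (simp add: A.l_distr M.a_ac)
        moreover have "(m \<oplus> m') \<oplus> (a \<oplus> a') \<otimes> basis f \<in> K"
          by (rule K_I) (use * Lc(2) in simp_all)
        ultimately show ?thesis by simp
      qed
      have "\<zero> \<oplus> \<zero> \<otimes> basis f \<in> K" using Lc(5) by (intro K_I) simp_all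
      then show "\<one>\<^bsub>add_monoid A\<^esub> \<in> K" using b by simp
      show "inv\<^bsub>add_monoid A\<^esub> x \<in> K" if "x \<in> K" for x
      proof -
        from that obtain m a where m: "m \<in> L" "a \<in> carrier A" "x = m \<oplus> a \<otimes> basis f"
          by (auto simp: K_def)
        have "(\<ominus> \<one>) \<otimes> m \<in> L" using Lc(3) m by simp
        then have "\<ominus> m \<in> L" using Lcar[OF m(1)] by (simp add: A.l_minus)
        then have "\<ominus> m \<oplus> (\<ominus> a) \<otimes> basis f \<in> K" using m by (intro K_I) simp_all
        moreover have "\<ominus> x = \<ominus> m \<oplus> (\<ominus> a) \<otimes> basis f"
          using m Lcar[OF m(1)] b by (simp add: A.l_minus M.minus_add)
        ultimately show ?thesis unfolding a_inv_def[symmetric] by simp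
      qed
    qed
  next
    fix c x assume c: "c \<in> carrier A" and "x \<in> K"
    then obtain m a where m: "m \<in> L" "a \<in> carrier A" "x = m \<oplus> a \<otimes> basis f"
      by (auto simp: K_def)
    have "c \<otimes> x = c \<otimes> m \<oplus> (c \<otimes> a) \<otimes> basis f"
      using m c Lcar[OF m(1)] b by (simp add: A.r_distr A.m_assoc)
    moreover have "c \<otimes> m \<oplus> (c \<otimes> a) \<otimes> basis f \<in> K"
      by (rule K_I) (use m c Lc(3) in simp_all)
    ultimately show "c \<otimes> x \<in> K" by simp
  qed
  moreover have "L \<subseteq> K"
  proof
    fix x assume x: "x \<in> L"
    then have "x = x \<oplus> \<zero> \<otimes> basis f" using Lcar b by simp
    then show "x \<in> K" using K_I[OF x, of \<zero>] by simp
  qed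
  ultimately have "K = L \<or> K = carrier A" using L by (simp add: maximal_left_ideal_def)
  moreover have "basis f = \<zero> \<oplus> \<one> \<otimes> basis f" using b by simp
  then have "basis f \<in> K" using K_I[OF Lc(5), of \<one>] by simp
  ultimately have "\<one> \<in> K" using nL by auto
  then obtain m a where m: "m \<in> L" "a \<in> carrier A" "\<one> = m \<oplus> a \<otimes> basis f"
    by (auto simp: K_def)
  have mc: "m \<in> carrier A" using m Lc(1) by blast
  have "basis f = basis f \<otimes> (m \<oplus> a \<otimes> basis f)" using b m by (simp flip: m(3))
  also have "\<dots> = basis f \<otimes> m \<oplus> basis f \<otimes> a \<otimes> basis f"
    using b m mc by (simp add: A.r_distr A.m_assoc)
  also have "basis f \<otimes> a \<otimes> basis f = \<zero>"
  proof -
    have "co (basis f \<otimes> a \<otimes> basis f) = co \<zero>"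
      using b m fM cmul_sandwich_eq_0[OF keys_co[OF m(2)] fM] by (simp add: co_mult)
    then show ?thesis using b m by (subst (asm) co_inject) simp_all
  qed
  also have "basis f \<otimes> m \<oplus> \<zero> = basis f \<otimes> m" using b mc by simp
  finally have "basis f = basis f \<otimes> m" .
  then show False using Lc(3)[OF b m(1)] nL by simp
qed

lemma Rad_eq: "Rad A = span non_ids"
proof
  show "span non_ids \<subseteq> Rad A"
    unfolding Rad_def
  proof (intro Int_greatest Inter_greatest)
    fix L assume "L \<in> {M. maximal_left_ideal M A}"
    then have L: "maximal_left_ideal L A" by simp
    then have "left_ideal L A" by (simp add: maximal_left_ideal_def)
    from left_ideal_carrierI[OF this] show "span non_ids \<subseteq> L"
      by (intro span_subset basis_in_maximal_left_ideal[OF L]) (auto simp: non_ids_def)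
  qed (auto simp: span_def)
  show "Rad A \<subseteq> span non_ids"
  proof
    fix x assume x: "x \<in> Rad A"
    then have xc: "x \<in> carrier A" by (simp add: Rad_def)
    have "disp f \<noteq> 0" if f: "f \<in> Poly_Mapping.keys (co x)" for f
    proof
      assume "disp f = 0"
      have fM: "f \<in> Mor (EC n)" using f keys_co[OF xc] by blast
      then have fd: "f = Some |` dom f" and "dom f \<subseteq> {1..n}"
        using disp_eq_0[OF fM \<open>disp f = 0\<close>] by (simp_all add: Mor_EC_iff)
      then have "char_at (dom f) x = 0"
        using x maximal_left_ideal_char_kernel[of "dom f"] unfolding Rad_def by blast
      then show False using f fd by (simp add: char_at_def in_keys_iff)
    qed
    then show "x \<in> span non_ids"
      using xc keys_co[OF xc] by (auto simp: span_def non_ids_def)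
  qed
qed

lemma ideal_Rad: "ideal (Rad A) A"
proof -
  \<comment> \<open>Requiring only a nonzero sum of displacements covers a non-identity on either
    side.\<close>
  have "g \<circ>\<^sub>m f \<in> non_ids"
    if "g \<in> Mor (EC n)" "f \<in> Mor (EC n)" "dom g = ran f" "disp f + disp g \<noteq> 0" for g f
  proof -
    have "disp (g \<circ>\<^sub>m f) \<noteq> 0"
      using disp_comp[OF that(2,1,3)] that(4) by linarith
    then show ?thesis
      using map_comp_in_Mor_EC[OF that(2,1)] unfolding non_ids_def by simp
  qed
  then show ?thesis
    unfolding Rad_eq by (intro ideal_span) (simp_all add: non_ids_def Collect_restrict)
qed

text \<open>With the radical as common kernel of the characters, the quotient by it becomes a power
  of the field.\<close>

lemma mem_Rad_iff: "x \<in> Rad A \<longleftrightarrow> x \<in> carrier A \<and> (\<forall>B\<in>Pow {1..n}. char_at B x = 0)"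
proof
  assume "x \<in> Rad A"
  then have x: "x \<in> carrier A" "Poly_Mapping.keys (co x) \<subseteq> non_ids"
    by (simp_all add: Rad_eq span_def)
  have "Some |` B \<notin> Poly_Mapping.keys (co x)" for B
    using x(2) by (auto simp: non_ids_def)
  then show "x \<in> carrier A \<and> (\<forall>B\<in>Pow {1..n}. char_at B x = 0)"
    using x(1) by (simp add: char_at_def in_keys_iff)
next
  assume x: "x \<in> carrier A \<and> (\<forall>B\<in>Pow {1..n}. char_at B x = 0)"
  have "disp f \<noteq> 0" if f: "f \<in> Poly_Mapping.keys (co x)" "f \<in> Mor (EC n)" for f
  proof
    assume "disp f = 0"
    then have "f = Some |` dom f" "dom f \<in> Pow {1..n}"
      using f disp_eq_0[of f n] by (simp_all add: Mor_EC_iff)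
    then show False using x f(1) unfolding char_at_def in_keys_iff by metis
  qed
  then show "x \<in> Rad A"
    using x keys_co[of x] by (auto simp: Rad_eq span_def non_ids_def)
qed

text \<open>The 2^n characters, one for each object, jointly map A onto a power of the field with
  the radical as kernel.\<close>

lemma split_basic: "split_basic A"
proof -
  define r where "r = card (Pow {1..n})"
  obtain e where e: "bij_betw e {..<r} (Pow {1..n})"
    using ex_bij_betw_nat_finite[of "Pow {1..n}"] by (auto simp: r_def atLeast0LessThan)
  let ?P = "power_algebra r :: ('k, nat \<Rightarrow> 'k) module"
  define h where "h x = (\<lambda>i\<in>{..<r}. char_at (e i) x)" for x
  have eB: "e i \<subseteq> {1..n}" if "i < r" for i
    using bij_betwE[OF e] that by auto
  interpret h: ring_hom_ring A ?P h
    by (rule ring_hom_ringI[OF A.ring_axioms ring_power_algebra])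
      (auto simp: h_def power_algebra_def char_at_simps char_at_one eB fun_eq_iff simp del: One_nat_def)
  have ker: "a_kernel A ?P h = Rad A"
  proof -
    have "h x = \<zero>\<^bsub>?P\<^esub> \<longleftrightarrow> (\<forall>i<r. char_at (e i) x = 0)" for x
      by (auto simp: h_def power_algebra_def fun_eq_iff restrict_def)
    moreover have "(\<forall>i<r. char_at (e i) x = 0) \<longleftrightarrow> (\<forall>B\<in>Pow {1..n}. char_at B x = 0)" for x
      unfolding bij_betw_imp_surj_on[OF e, symmetric] by auto
    ultimately show ?thesis
      by (intro Set.set_eqI) (simp only: a_kernel_def' mem_Collect_eq mem_Rad_iff)
  qed
  have surj: "h ` carrier A = carrier ?P"
  proof
    show "carrier ?P \<subseteq> h ` carrier A"
    proof
      fix \<phi> assume \<phi>: "\<phi> \<in> carrier ?P"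
      \<comment> \<open>Prescribed character values are realised by a combination of identities, a
        character being the coefficient of an identity.\<close>
      let ?p = "\<Sum>i<r. Poly_Mapping.single (Some |` e i) (\<phi> i)"
      have k: "Poly_Mapping.keys ?p \<subseteq> Mor (EC n)"
        by (intro keys_sum_subset keys_single_subset id_in_Mor_EC eB) simp
      have "char_at (e j) (elt ?p) = \<phi> j" if j: "j < r" for j
      proof -
        have "char_at (e j) (elt ?p) = (\<Sum>i<r. if i = j then \<phi> i else 0)"
          unfolding char_at_def co_elt[OF k] lookup_sum
          by (rule sum.cong)
            (use j bij_betw_imp_inj_on[OF e] in \<open>auto simp: lookup_single when_def inj_on_def\<close>)
        then show ?thesis using j by simp
      qed
      then have "h (elt ?p) = \<phi>"
        using \<phi> by (auto simp: h_def power_algebra_def fun_eq_iff PiE_def extensional_def)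
      then show "\<phi> \<in> h ` carrier A" using elt_closed[OF k]
        by (intro image_eqI[where x = "elt ?p"]) simp_all
    qed
  qed (use h.hom_closed in blast)
  let ?h = "\<lambda>S. the_elem (h ` S)"
  have "?h \<in> ring_iso (A Quot Rad A) ?P"
    using h.FactRing_iso_set[OF surj] by (simp add: ker)
  \<comment> \<open>The quotient algebra copies the ring operations of the quotient ring, so only
    scalars remain to be checked.\<close>
  then have iso: "?h \<in> ring_iso (quotient_algebra A (Rad A)) ?P"
    by (simp add: ring_iso_def ring_hom_def quotient_algebra_def)
  have smult: "?h (c \<odot>\<^bsub>quotient_algebra A (Rad A)\<^esub> S) = c \<odot>\<^bsub>?P\<^esub> ?h S"
    if S: "S \<in> carrier (quotient_algebra A (Rad A))" for c S
  proof -
    have "S \<in> carrier (A Quot a_kernel A ?P h)" using S by (simp add: quotient_algebra_def ker)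
    then obtain x where x: "x \<in> carrier A" "S = Rad A +> x"
      using h.quot_mem ker by auto
    have eq: "?h (Rad A +> y) = h y" if "y \<in> carrier A" for y
      using h.the_elem_simp[OF that] by (simp add: ker)
    have "?h (c \<odot>\<^bsub>quotient_algebra A (Rad A)\<^esub> S) = h (c \<odot> x)"
      using x eq by (simp add: smult_quotient_algebra[OF ideal_Rad])
    also have "\<dots> = c \<odot>\<^bsub>?P\<^esub> h x"
      using x by (auto simp: h_def power_algebra_def char_at_simps fun_eq_iff)
    also have "h x = ?h S" using x eq by simp
    finally show ?thesis .
  qed
  have "algebras_isomorphic (quotient_algebra A (Rad A)) ?P"
    unfolding algebras_isomorphic_def by (intro bexI[OF _ iso] allI ballI smult)
  then show ?thesis
    unfolding split_basic_def by (intro conjI k_algebra_axioms exI)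
qed

section \<open>The identities as primitive orthogonal idempotents\<close>

lemma vertex_closed: "B \<subseteq> {1..n} \<Longrightarrow> vertex B \<in> carrier A"
  by (simp add: id_in_Mor_EC)

lemma vertex_mult:
  assumes "B \<subseteq> {1..n}" "C \<subseteq> {1..n}"
  shows "vertex C \<otimes> vertex B = (if B = C then vertex B else \<zero>)"
proof -
  have "co (vertex C \<otimes> vertex B) = co (if B = C then vertex B else \<zero>)"
    using assms by (auto simp: co_mult id_in_Mor_EC bilin_ext_single map_comp_id_right)
  then show ?thesis using assms by (subst (asm) co_inject) (auto simp: id_in_Mor_EC)
qed

lemma inj_on_vertex: "inj_on vertex (Pow {1..n})"
proof (rule inj_onI)
  fix B C assume "B \<in> Pow {1..n}" "C \<in> Pow {1..n}" "vertex B = vertex C"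
  then have "co (vertex B) = co (vertex C)" "B \<subseteq> {1..n}" "C \<subseteq> {1..n}" by simp_all
  then show "B = C" by (simp add: id_in_Mor_EC)
qed

text \<open>An idempotent summand of the vertex lies in its corner, a copy of the field, whose only
  idempotents are 0 and 1.\<close>

lemma primitive_idempotent_vertex:
  assumes B: "B \<subseteq> {1..n}"
  shows "primitive_idempotent A (vertex B)"
  unfolding primitive_idempotent_def
proof (intro conjI allI impI)
  note v = vertex_closed[OF B] and BM = id_in_Mor_EC[OF B]
  show "idempotent A (vertex B)" using v vertex_mult[OF B B] by (simp add: idempotent_def)
  show "vertex B \<noteq> \<zero>"
  proof
    assume "vertex B = \<zero>"
    then have "co (vertex B) = 0" by simp
    then show False using BM by simp
  qed
  fix f g
  assume fg: "idempotent A f \<and> idempotent A g \<and> orthogonal A f g \<and> vertex B = f \<oplus> g"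
  then have f: "f \<in> carrier A" "f \<otimes> f = f" and g: "g \<in> carrier A" "g \<otimes> g = g"
    and o: "f \<otimes> g = \<zero>" "g \<otimes> f = \<zero>" and e: "vertex B = f \<oplus> g"
    by (simp_all add: idempotent_def orthogonal_def)
  \<comment> \<open>By orthogonality (f + g) f (f + g) = f.\<close>
  have "vertex B \<otimes> f \<otimes> vertex B = f"
    unfolding e using f g o by (simp add: A.l_distr A.r_distr)
  then have "f \<in> {vertex B \<otimes> x \<otimes> vertex B |x. x \<in> span (Mor (EC n))}"
    using f(1) unfolding carrier_eq_span by force
  then have kf: "Poly_Mapping.keys (co f) \<subseteq> {Some |` B}"
    unfolding corner_span[OF B B order_refl] by (auto simp: span_def EC_hom_self[OF B])
  have cf: "co f = Poly_Mapping.single (Some |` B) (char_at B f)"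
  proof (rule poly_mapping_eqI)
    fix m show "Poly_Mapping.lookup (co f) m =
        Poly_Mapping.lookup (Poly_Mapping.single (Some |` B) (char_at B f)) m"
      using kf by (auto simp: char_at_def lookup_single when_def in_keys_iff)
  qed
  have "char_at B f * char_at B f = char_at B f"
    using char_at_simps(3)[OF f(1) f(1), of B] f(2) by simp
  then consider "char_at B f = 0" | "char_at B f = 1" by auto
  then show "f = \<zero> \<or> g = \<zero>"
  proof cases
    case 1
    then show ?thesis using cf f(1) co_inject[of f \<zero>] by simp
  next
    case 2
    then have "f = vertex B" using cf f(1) v BM co_inject[of f "vertex B"] by simp
    then have "co (f \<oplus> g) = co f" using e by simp
    then have "co g = 0" using f g by (simp add: co_add)
    then show ?thesis using g co_inject[of g \<zero>] by simp
  qed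
qed

lemma complete_vertices: "complete_primitive_orthogonal_idempotents A (vertex ` Pow {1..n})"
  unfolding complete_primitive_orthogonal_idempotents_def
proof (intro conjI ballI impI)
  show "finite (vertex ` Pow {1..n})" by simp
  show "primitive_idempotent A e" if "e \<in> vertex ` Pow {1..n}" for e
    using that primitive_idempotent_vertex by auto
  show "orthogonal A e f" if "e \<in> vertex ` Pow {1..n}" "f \<in> vertex ` Pow {1..n}" "e \<noteq> f" for e f
    using that vertex_mult by (auto simp: orthogonal_def)
  have E: "(\<lambda>e. e) \<in> vertex ` Pow {1..n} \<rightarrow> carrier A"
    using vertex_closed by auto
  have "co (\<Oplus>e\<in>vertex ` Pow {1..n}. e) = (\<Sum>e\<in>vertex ` Pow {1..n}. co e)"
    by (rule co_finsum) (use E in simp_all)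
  also have "\<dots> = co \<one>"
    unfolding sum.reindex[OF inj_on_vertex] co_one
    by (rule sum.cong) (simp_all add: id_in_Mor_EC)
  finally show "(\<Oplus>e\<in>vertex ` Pow {1..n}. e) = \<one>"
    using E by (subst (asm) co_inject) simp_all
qed

subsection \<open>The quiver\<close>

lemma basis_in_Rad: "f \<in> Mor (EC n) \<Longrightarrow> disp f \<noteq> 0 \<Longrightarrow> basis f \<in> Rad A"
  by (simp add: Rad_eq span_def non_ids_def)

lemma ideal_Rad2: "ideal (Rad2 A) A"
  by (rule A.ideal_prod_is_ideal[OF ideal_Rad ideal_Rad])

text \<open>Two factors of positive displacement give at least 2 by superadditivity. Conversely,
  displacement at least 2 allows splitting off an arrow with a non-identity left over, hence a
  product of two radical elements.\<close>

lemma Rad2_eq: "Rad2 A = span reducibles"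
proof
  show "Rad2 A \<subseteq> span reducibles"
  proof
    fix x assume "x \<in> Rad2 A"
    then show "x \<in> span reducibles"
    proof induction
      case (prod i j)
      then have ij: "i \<in> carrier A" "Poly_Mapping.keys (co i) \<subseteq> non_ids"
        "j \<in> carrier A" "Poly_Mapping.keys (co j) \<subseteq> non_ids"
        by (simp_all add: Rad_eq span_def)
      have "g \<circ>\<^sub>m f \<in> reducibles" if "g \<in> non_ids" "f \<in> non_ids" "dom g = ran f" for g f
      proof -
        have *: "g \<in> Mor (EC n)" "f \<in> Mor (EC n)" "disp g \<noteq> 0" "disp f \<noteq> 0"
          using that by (simp_all add: non_ids_def)
        have "2 \<le> disp (g \<circ>\<^sub>m f)" using disp_comp[OF *(2,1) that(3)] *(3,4) by linarith
        then show ?thesis using map_comp_in_Mor_EC[OF *(2,1)] by (simp add: reducibles_def)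
      qed
      then have "Poly_Mapping.keys (cmul (co i) (co j)) \<subseteq> reducibles"
        by (rule keys_cmul_subset[OF ij(2,4)])
      then show ?case using ij by (simp add: span_def co_mult)
    next
      case (sum x y)
      then show ?case by (simp add: span_def co_add keys_add_subset)
    qed
  qed
  note sub = ideal.axioms(1)[OF ideal_Rad2]
  show "span reducibles \<subseteq> Rad2 A"
  proof (rule span_subset)
    show "reducibles \<subseteq> Mor (EC n)" unfolding reducibles_def by (rule Collect_restrict)
    show "\<And>c x. x \<in> Rad2 A \<Longrightarrow> c \<odot> x \<in> Rad2 A" by (rule ideal_smult_closed[OF ideal_Rad2])
    show "\<zero> \<in> Rad2 A" by (rule additive_subgroup.zero_closed[OF sub])
    show "\<And>x y. x \<in> Rad2 A \<Longrightarrow> y \<in> Rad2 A \<Longrightarrow> x \<oplus> y \<in> Rad2 A"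
      by (rule additive_subgroup.a_closed[OF sub])
    fix f assume "f \<in> reducibles"
    then have "f \<in> Mor (EC n)" "2 \<le> disp f" by (simp_all add: reducibles_def)
    then obtain d g where d: "d \<in> Mor (EC n)" "disp d = 1"
      and g: "g \<in> Mor (EC n)" "disp g \<noteq> 0" and gd: "dom g = ran d" "g \<circ>\<^sub>m d = f"
      by (rule EC_factor_non_irreducible)
    have mem: "basis g \<in> Rad A" "basis d \<in> Rad A"
      using basis_in_Rad[OF g] basis_in_Rad[OF d(1)] d(2) by (simp_all only: zero_neq_one)
    have "co (basis g \<otimes> basis d) = co (basis f)"
      using d g gd map_comp_in_Mor_EC[OF d(1) g(1)] by (simp add: co_mult bilin_ext_single)
    then have "basis g \<otimes> basis d = basis f"
      using d g map_comp_in_Mor_EC[OF d(1) g(1)] gd by (subst (asm) co_inject) simp_all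
    then show "basis f \<in> Rad2 A" using ideal_prod.prod[OF mem, of A] by simp
  qed
qed

lemma arrow_space_eq:
  assumes "B \<subseteq> {1..n}" "C \<subseteq> {1..n}"
  shows "arrow_space A (vertex C) (vertex B) = (\<lambda>y. Rad2 A +> y) ` span (non_ids \<inter> EC_hom n B C)"
proof -
  have "arrow_space A (vertex C) (vertex B) =
      (\<lambda>y. Rad2 A +> y) ` {vertex C \<otimes> x \<otimes> vertex B |x. x \<in> span non_ids}"
    unfolding arrow_space_def Rad_eq by blast
  also have "{vertex C \<otimes> x \<otimes> vertex B |x. x \<in> span non_ids} = span (non_ids \<inter> EC_hom n B C)"
    by (rule corner_span[OF assms]) (simp add: non_ids_def Collect_restrict)
  finally show ?thesis .
qed

text \<open>The other non-identities from B to C have displacement at least 2, because d is the only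
  arrow there. They vanish modulo the square of the radical.\<close>

lemma coset_Rad2_eq:
  assumes y: "y \<in> span (non_ids \<inter> EC_hom n B C)"
    and d: "d \<in> EC_hom n B C" "disp d = 1"
  shows "Rad2 A +> y = Rad2 A +> (Poly_Mapping.lookup (co y) d \<odot> basis d)"
proof -
  have yc: "y \<in> carrier A" "Poly_Mapping.keys (co y) \<subseteq> non_ids \<inter> EC_hom n B C"
    using y by (simp_all add: span_def)
  have dM: "d \<in> Mor (EC n)" using d by (simp add: EC_hom_iff)
  let ?z = "Poly_Mapping.lookup (co y) d \<odot> basis d"
  have z: "?z \<in> carrier A" using dM by simp
  have lk: "Poly_Mapping.lookup (co (y \<ominus> ?z)) f =
      (if f = d then 0 else Poly_Mapping.lookup (co y) f)" for f
    using yc dM by (simp add: co_minus co_smult lookup_minus lookup_single when_def)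
  have "f \<in> reducibles" if f: "f \<in> Poly_Mapping.keys (co (y \<ominus> ?z))" for f
  proof -
    have "f \<noteq> d" "f \<in> Poly_Mapping.keys (co y)"
      using f by (auto simp: in_keys_iff lk split: if_splits)
    then have f: "f \<in> Mor (EC n)" "disp f \<noteq> 0" "f \<in> EC_hom n B C"
      using yc(2) by (auto simp: non_ids_def)
    have "disp f \<noteq> 1"
    proof
      assume "disp f = 1"
      then have "f \<in> arcs (EC_quiver n)" "d \<in> arcs (EC_quiver n)"
        using f dM d by (simp_all add: arcs_EC_quiver_eq)
      then have "f = d" using f d by (intro arcs_EC_quiver_unique) (simp_all add: EC_hom_iff)
      then show False using \<open>f \<noteq> d\<close> by simp
    qed
    then show ?thesis using f by (simp add: reducibles_def)
  qed
  then have "y \<ominus> ?z \<in> Rad2 A" using yc z by (auto simp: Rad2_eq span_def)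
  then show ?thesis using coset_eq_iff[OF ideal_Rad2 yc(1) z] by simp
qed

text \<open>At most one arrow leads from B to C, so the arrow space is zero or a line.\<close>

lemma is_basis_arrow_space:
  assumes B: "B \<subseteq> {1..n}" and C: "C \<subseteq> {1..n}"
  defines "D \<equiv> {d \<in> arcs (EC_quiver n). tail (EC_quiver n) d = B \<and> head (EC_quiver n) d = C}"
  shows "is_basis (quotient_algebra A (Rad2 A)) (arrow_space A (vertex C) (vertex B))
    ((\<lambda>d. Rad2 A +> basis d) ` D)"
    and "inj_on (\<lambda>d. Rad2 A +> basis d) D"
proof -
  let ?Q = "quotient_algebra A (Rad2 A)"
  note ring_Q = ideal.quotient_is_ring[OF ideal_Rad2]
  note const = abelian_subgroup.a_rcos_const[OF abelian_subgroupI3[OF ideal.axioms(1)[OF ideal_Rad2] M.abelian_group_axioms]]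
  have zero: "\<zero>\<^bsub>?Q\<^esub> = Rad2 A" "\<zero>\<^bsub>A Quot Rad2 A\<^esub> = Rad2 A"
    by (simp_all add: quotient_algebra_def FactRing_def)
  have Dmem: "d \<in> D \<longleftrightarrow> d \<in> EC_hom n B C \<and> disp d = 1" for d
    unfolding D_def arcs_EC_quiver_eq EC_hom_iff by (simp add: conj_ac)
  have Duniq: "d = e" if "d \<in> D" "e \<in> D" for d e
    using that by (intro arcs_EC_quiver_unique[of d n e]) (simp_all add: D_def)
  then show "inj_on (\<lambda>d. Rad2 A +> basis d) D" by (auto intro: inj_onI)
  show "is_basis ?Q (arrow_space A (vertex C) (vertex B)) ((\<lambda>d. Rad2 A +> basis d) ` D)"
  proof (cases "D = {}")
    case True
    have "non_ids \<inter> EC_hom n B C \<subseteq> reducibles"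
    proof
      fix f assume f: "f \<in> non_ids \<inter> EC_hom n B C"
      then have "disp f \<noteq> 1" using True Dmem by blast
      then show "f \<in> reducibles" using f by (auto simp: non_ids_def reducibles_def)
    qed
    then have "y \<in> Rad2 A" if "y \<in> span (non_ids \<inter> EC_hom n B C)" for y
      using that by (auto simp: Rad2_eq span_def)
    moreover have "Rad2 A +> y = Rad2 A" if "y \<in> Rad2 A" for y
      by (rule const[OF that])
    moreover have "\<zero> \<in> span (non_ids \<inter> EC_hom n B C)" by (simp add: span_def)
    moreover have empty: "finsum (A Quot Rad2 A) f {} = \<zero>\<^bsub>A Quot Rad2 A\<^esub>"
      for f :: "'a set \<Rightarrow> 'a set"
    proof -
      interpret Q: ring "A Quot Rad2 A" by (rule ring_Q)
      show ?thesis by simp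
    qed
    ultimately have "arrow_space A (vertex C) (vertex B) = {Rad2 A}"
      unfolding arrow_space_eq[OF B C] by force
    then show ?thesis
      using True empty
      by (simp add: is_basis_def finsum_quotient_algebra zero)
  next
    case False
    then obtain d where d: "D = {d}" using Duniq by blast
    then have dh: "d \<in> EC_hom n B C" "disp d = 1" using Dmem by blast+
    then have dM: "d \<in> Mor (EC n)" by (simp add: EC_hom_iff)
    let ?b = "Rad2 A +> basis d"
    have sm: "c \<odot>\<^bsub>?Q\<^esub> ?b = Rad2 A +> (c \<odot> basis d)" for c
      by (rule smult_quotient_algebra[OF ideal_Rad2 basis_closed[OF dM]])
    have cl: "Rad2 A +> x \<in> carrier (A Quot Rad2 A)" if "x \<in> carrier A" for x
      using that ideal.rcos_ring_hom[OF ideal_Rad2] by (rule ring_hom_closed[rotated])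
    have fs: "(\<Oplus>\<^bsub>?Q\<^esub>b\<in>{?b}. c b \<odot>\<^bsub>?Q\<^esub> b) = Rad2 A +> (c ?b \<odot> basis d)" for c
    proof -
      interpret Q: ring "A Quot Rad2 A" by (rule ring_Q)
      show ?thesis
        unfolding finsum_quotient_algebra using cl[of "c ?b \<odot> basis d"] dM by (simp add: sm)
    qed
    have mem: "c \<odot> basis d \<in> span (non_ids \<inter> EC_hom n B C)" for c
      using dM dh keys_single_subset[of d "non_ids \<inter> EC_hom n B C" c]
      by (simp add: span_def co_smult non_ids_def)
    \<comment> \<open>The arrow has displacement 1, so no nonzero multiple of it lies in the square
      of the radical.\<close>
    have indep: "c = 0" if "Rad2 A +> (c \<odot> basis d) = Rad2 A" for c
    proof -
      have "Rad2 A +> (c \<odot> basis d) = Rad2 A +> \<zero>" using that const[OF additive_subgroup.zero_closed[OF ideal.axioms(1)[OF ideal_Rad2]]] by simp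
      then have "c \<odot> basis d \<ominus> \<zero> \<in> Rad2 A"
        using coset_eq_iff[OF ideal_Rad2] dM by simp
      then have "Poly_Mapping.keys (Poly_Mapping.single d c) \<subseteq> reducibles"
        using dM by (simp add: Rad2_eq span_def co_minus co_smult)
      then show ?thesis using dh by (cases "c = 0") (simp_all add: reducibles_def)
    qed
    have space: "arrow_space A (vertex C) (vertex B) = range (\<lambda>c. Rad2 A +> (c \<odot> basis d))"
      unfolding arrow_space_eq[OF B C]
    proof
      show "(+>) (Rad2 A) ` span (non_ids \<inter> EC_hom n B C) \<subseteq> range (\<lambda>c. Rad2 A +> (c \<odot> basis d))"
      proof (rule image_subsetI)
        fix y assume "y \<in> span (non_ids \<inter> EC_hom n B C)"
        from coset_Rad2_eq[OF this dh]
        show "Rad2 A +> y \<in> range (\<lambda>c. Rad2 A +> (c \<odot> basis d))" by (rule range_eqI)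
      qed
      show "range (\<lambda>c. Rad2 A +> (c \<odot> basis d)) \<subseteq> (+>) (Rad2 A) ` span (non_ids \<inter> EC_hom n B C)"
        using mem by (intro image_subsetI imageI)
    qed
    have "1 \<odot> basis d = basis d"
      using smult_one[of "basis d"] dM by (simp add: ring_of_type_algebra_def)
    then have b: "?b \<in> range (\<lambda>c. Rad2 A +> (c \<odot> basis d))"
      by (intro range_eqI[of _ _ 1]) simp
    \<comment> \<open>A basis is tested with coefficient functions on cosets. On a singleton one
      value counts, and constant functions realise every scalar.\<close>
    have ext: "range (\<lambda>c. Rad2 A +> (c \<odot> basis d)) = {Rad2 A +> (c ?b \<odot> basis d) |c. True}"
    proof (intro Set.set_eqI iffI)
      fix S assume "S \<in> range (\<lambda>c. Rad2 A +> (c \<odot> basis d))"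
      then obtain c where "S = Rad2 A +> ((\<lambda>b. c) ?b \<odot> basis d)" by (elim rangeE)
      then show "S \<in> {Rad2 A +> (c ?b \<odot> basis d) |c. True}"
        by (intro CollectI exI[of _ "\<lambda>b. c"] conjI TrueI)
    next
      fix S assume "S \<in> {Rad2 A +> (c ?b \<odot> basis d) |c. True}"
      then show "S \<in> range (\<lambda>c. Rad2 A +> (c \<odot> basis d))" by (elim CollectE exE conjE) simp
    qed
    have img: "(\<lambda>d. Rad2 A +> basis d) ` D = {?b}" by (simp add: d)
    show ?thesis
      unfolding is_basis_def img fs zero(1) ext[symmetric]
    proof (intro conjI allI impI ballI)
      show "{?b} \<subseteq> arrow_space A (vertex C) (vertex B)" using b space by simp
      show "c x = 0" if "Rad2 A +> (c ?b \<odot> basis d) = Rad2 A" "x \<in> {?b}" for c x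
        using indep[OF that(1)] that(2) by simp
    qed (use space in simp_all)
  qed
qed

lemma is_quiver: "is_quiver_of A (vertex ` Pow {1..n}) (EC_quiver n)"
  unfolding is_quiver_of_def
proof (intro conjI exI[of _ vertex] exI[of _ "\<lambda>d. Rad2 A +> basis d"] ballI)
  show "wf_digraph (EC_quiver n)"
  proof
    fix d assume d: "d \<in> arcs (EC_quiver n)"
    then show "tail (EC_quiver n) d \<in> verts (EC_quiver n)"
        "head (EC_quiver n) d \<in> verts (EC_quiver n)"
      using arc_in_Mor_EC[OF d] by (simp_all add: EC_quiver_def Mor_EC_iff)
  qed
  show "bij_betw vertex (verts (EC_quiver n)) (vertex ` Pow {1..n})"
    using inj_on_vertex by (simp add: bij_betw_def EC_quiver_def)
  fix B C assume BC: "B \<in> verts (EC_quiver n)" "C \<in> verts (EC_quiver n)"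
  then have "B \<subseteq> {1..n}" "C \<subseteq> {1..n}" by (simp_all add: EC_quiver_def)
  note * = is_basis_arrow_space[OF this]
  show "inj_on (\<lambda>d. Rad2 A +> basis d)
      {a \<in> arcs (EC_quiver n). tail (EC_quiver n) a = B \<and> head (EC_quiver n) a = C}"
    by (rule *(2))
  show "is_basis (quotient_algebra A (Rad2 A)) (arrow_space A (vertex C) (vertex B))
      ((\<lambda>d. Rad2 A +> basis d) `
        {a \<in> arcs (EC_quiver n). tail (EC_quiver n) a = B \<and> head (EC_quiver n) a = C})"
    by (rule *(1))
qed

end

section \<open>The linearised free category\<close>

abbreviation path_cat :: "nat \<Rightarrow> (nat set, (nat set, nat \<rightharpoonup> nat) path) cat" where
  "path_cat n \<equiv> free_category (EC_quiver n)"

definition eval_path :: "(nat set, nat \<rightharpoonup> nat) path \<Rightarrow> (nat \<rightharpoonup> nat)" where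
  "eval_path = (\<lambda>(B, p, C). eval_walk B p)"

definition eval_lin :: "((nat set, nat \<rightharpoonup> nat) path \<Rightarrow>\<^sub>0 'k::field) \<Rightarrow> ((nat \<rightharpoonup> nat) \<Rightarrow>\<^sub>0 'k)" where
  "eval_lin = lin_ext (\<lambda>\<pi>. Poly_Mapping.single (eval_path \<pi>) 1)"

lemma path_hom_iff: "\<pi> \<in> cat_hom (path_cat n) B C \<longleftrightarrow> (\<exists>p. \<pi> = (B, p, C) \<and> EC_walk n B p C)"
  by (cases \<pi>) (auto simp: cat_hom_def free_category_def)

lemma path_in_hom: "(B, p, C) \<in> cat_hom (path_cat n) B C \<longleftrightarrow> EC_walk n B p C"
  by (simp add: path_hom_iff)

lemma eval_path_in_EC_hom: "\<pi> \<in> cat_hom (path_cat n) B C \<Longrightarrow> eval_path \<pi> \<in> EC_hom n B C"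
  unfolding path_hom_iff EC_hom_iff eval_path_def using eval_walk by fastforce

lemma path_comp: "Comp (path_cat n) (C', q, D) (B, p, C) = (B, p @ q, D)"
  by (simp add: free_category_def)

lemma path_comp_in_hom:
  assumes "\<pi> \<in> cat_hom (path_cat n) C D" "\<rho> \<in> cat_hom (path_cat n) B C"
  shows "Comp (path_cat n) \<pi> \<rho> \<in> cat_hom (path_cat n) B D"
    "eval_path (Comp (path_cat n) \<pi> \<rho>) = eval_path \<pi> \<circ>\<^sub>m eval_path \<rho>"
proof -
  obtain q p where "\<pi> = (C, q, D)" "EC_walk n C q D" "\<rho> = (B, p, C)" "EC_walk n B p C"
    using assms unfolding path_hom_iff by blast
  then show "Comp (path_cat n) \<pi> \<rho> \<in> cat_hom (path_cat n) B D"
    "eval_path (Comp (path_cat n) \<pi> \<rho>) = eval_path \<pi> \<circ>\<^sub>m eval_path \<rho>"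
    by (simp_all add: path_comp path_hom_iff EC_walk_append eval_path_def eval_walk_append)
qed

lemma LHom_linearization: "p \<in> LHom (linearization D) a b \<longleftrightarrow> Poly_Mapping.keys p \<subseteq> cat_hom D a b"
  by (simp add: linearization_def)

lemma linearization_sel [simp]:
  "LObj (linearization D) = Obj D"
  "LIdent (linearization D) a = Poly_Mapping.single (Ident D a) 1"
  "LComp (linearization D) a b c = bilin_ext (\<lambda>x y. True) (Comp D)"
  "LAdd (linearization D) a b = (+)"
  "LScale (linearization D) a b = scale_pm"
  by (simp_all add: linearization_def)

lemma Obj_path_cat [simp]: "Obj (path_cat n) = Pow {1..n}"
  by (simp add: free_category_def EC_quiver_def)

lemma keys_eval_lin:
  assumes "Poly_Mapping.keys p \<subseteq> cat_hom (path_cat n) B C"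
  shows "Poly_Mapping.keys (eval_lin p) \<subseteq> EC_hom n B C"
  unfolding eval_lin_def
  by (intro keys_lin_ext_subset keys_single_subset eval_path_in_EC_hom subsetD[OF assms])

text \<open>The left product ranges over all pairs of keys, the right one over composable pairs. The
  hom-space hypotheses make all pairs composable.\<close>

lemma eval_lin_comp:
  assumes p: "Poly_Mapping.keys p \<subseteq> cat_hom (path_cat n) C D"
    and q: "Poly_Mapping.keys q \<subseteq> cat_hom (path_cat n) B C"
  shows "eval_lin (bilin_ext (\<lambda>x y. True) (Comp (path_cat n)) p q) = cmul (eval_lin p) (eval_lin q)"
  using p
proof (induction p rule: poly_mapping_span_induct)
  case (single \<pi> a)
  show ?case
    using q
  proof (induction q rule: poly_mapping_span_induct)
    case (single \<rho> b)
    show ?case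
      using path_comp_in_hom(2)[OF \<open>\<pi> \<in> _\<close> single] eval_path_in_EC_hom[OF \<open>\<pi> \<in> _\<close>]
        eval_path_in_EC_hom[OF single]
      by (simp add: eval_lin_def bilin_ext_single EC_hom_iff)
  qed (simp_all add: eval_lin_def bilin_ext_add_right lin_ext_add)
qed (simp_all add: eval_lin_def bilin_ext_add_left lin_ext_add)

text \<open>An arbitrary choice is enough: any two walks with the same value will be identified by
  the relations.\<close>

definition choice_walk :: "nat \<Rightarrow> (nat \<rightharpoonup> nat) \<Rightarrow> (nat \<rightharpoonup> nat) list" where
  "choice_walk n f = (SOME p. EC_walk n (dom f) p (ran f) \<and> eval_walk (dom f) p = f)"

definition choice_path :: "nat \<Rightarrow> (nat \<rightharpoonup> nat) \<Rightarrow> (nat set, nat \<rightharpoonup> nat) path" where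
  "choice_path n f = (dom f, choice_walk n f, ran f)"

lemma choice_path:
  assumes "f \<in> EC_hom n B C"
  shows "choice_path n f \<in> cat_hom (path_cat n) B C" "eval_path (choice_path n f) = f"
proof -
  have f: "f \<in> Mor (EC n)" "dom f = B" "ran f = C" using assms by (simp_all add: EC_hom_iff)
  have "EC_walk n (dom f) (choice_walk n f) (ran f) \<and> eval_walk (dom f) (choice_walk n f) = f"
    unfolding choice_walk_def by (rule someI_ex[OF ex_EC_walk[OF f(1)]])
  then show "choice_path n f \<in> cat_hom (path_cat n) B C" "eval_path (choice_path n f) = f"
    using f by (simp_all add: choice_path_def path_hom_iff eval_path_def)
qed

text \<open>The chosen walks give a linear section of evaluation, which makes the evaluation functor
  full.\<close>

lemma choice_lin:
  fixes x :: "(nat \<rightharpoonup> nat) \<Rightarrow>\<^sub>0 'k::field"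
  assumes "Poly_Mapping.keys x \<subseteq> EC_hom n B C"
  defines "p \<equiv> lin_ext (\<lambda>f. Poly_Mapping.single (choice_path n f) (1 :: 'k)) x"
  shows "Poly_Mapping.keys p \<subseteq> cat_hom (path_cat n) B C" "eval_lin p = x"
proof -
  show "Poly_Mapping.keys p \<subseteq> cat_hom (path_cat n) B C"
    unfolding p_def
    by (intro keys_lin_ext_subset keys_single_subset choice_path(1) subsetD[OF assms(1)])
  have "eval_lin p = lin_ext (\<lambda>f. Poly_Mapping.single f 1) x"
    unfolding p_def eval_lin_def lin_ext_lin_ext
  proof (rule lin_ext_cong)
    fix f assume "f \<in> Poly_Mapping.keys x"
    then have "f \<in> EC_hom n B C" using assms(1) by blast
    from choice_path(2)[OF this] show "lin_ext (\<lambda>\<pi>. Poly_Mapping.single (eval_path \<pi>) 1)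
        (Poly_Mapping.single (choice_path n f) 1) = Poly_Mapping.single f 1"
      by simp
  qed
  then show "eval_lin p = x" by (simp add: lin_ext_id)
qed

subsection \<open>The relations\<close>

text \<open>Arrow lists reverse the right-to-left order of composition, and the identities for
  \<open>lower\<close> give both sides the same endpoint. In this shape a tail can be
  appended.\<close>

lemma EC_path_relations_cases:
  assumes "(\<pi>, \<rho>) \<in> EC_path_relations n"
  obtains (commute) A i j where "A \<subseteq> {1..n}" "i \<in> A" "j \<in> A" "2 \<le> i" "i + 1 < j"
      "\<pi> = (A, [d_mor A j, d_mor (lower A j) i], lower (lower A j) i)"
      "\<rho> = (A, [d_mor A i, d_mor (lower A i) j], lower (lower A j) i)"
  | (braid) A i where "A \<subseteq> {1..n}" "i \<in> A" "i + 1 \<in> A" "2 \<le> i"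
      "\<pi> = (A, [d_mor A (i + 1), d_mor (lower A (i + 1)) i], lower (lower A (i + 1)) i)"
      "\<rho> = (A, [d_mor A i, d_mor (lower A i) (i + 1), d_mor (lower (lower A i) (i + 1)) i],
        lower (lower A (i + 1)) i)"
proof -
  have arr: "arrow_path (EC_quiver n) d = (dom d, [d], ran d)" for d
    by (simp add: arrow_path_def EC_quiver_def)
  from assms consider
    (1) A i j where "A \<subseteq> {1..n}" "i \<in> A" "j \<in> A" "2 \<le> i" "i + 1 < j"
      "\<pi> = (dom (d_mor A j), [d_mor A j, d_mor (lower A j) i], ran (d_mor (lower A j) i))"
      "\<rho> = (dom (d_mor A i), [d_mor A i, d_mor (lower A i) j], ran (d_mor (lower A i) j))"
  | (2) A i where "A \<subseteq> {1..n}" "i \<in> A" "i + 1 \<in> A" "2 \<le> i"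
      "\<pi> = (dom (d_mor A (i + 1)), [d_mor A (i + 1), d_mor (lower A (i + 1)) i],
        ran (d_mor (lower A (i + 1)) i))"
      "\<rho> = (dom (d_mor A i), [d_mor A i, d_mor (lower A i) (i + 1),
        d_mor (lower (lower A i) (i + 1)) i], ran (d_mor (lower (lower A i) (i + 1)) i))"
    unfolding EC_path_relations_def Let_def arr path_comp append_Cons append_Nil Un_iff
      mem_Collect_eq prod.inject by metis
  then show thesis
  proof cases
    case 1
    have m: "i \<in> lower A j" "j \<in> lower A i" using 1(2-5) by (auto simp: lower_def)
    show ?thesis
      using 1(2-5) m lower_commute[of i j A]
      by (intro commute[OF 1(1-5)]) (simp_all add: 1(6,7) dom_d_mor ran_d_mor)
  next
    case 2
    have m: "i \<in> lower A (i + 1)" "i \<in> lower (lower A i) (i + 1)"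
      using 2(2-4) by (auto simp: lower_def)
    show ?thesis
      using 2(2-4) m lower_braid[of i A]
      by (intro braid[OF 2(1-4)]) (simp_all add: 2(5,6) dom_d_mor ran_d_mor)
  qed
qed

lemma commute_in_EC_path_relations:
  assumes "A \<subseteq> {1..n}" "i \<in> A" "j \<in> A" "2 \<le> i" "i + 1 < j"
  shows "((A, [d_mor A j, d_mor (lower A j) i], lower (lower A j) i),
      (A, [d_mor A i, d_mor (lower A i) j], lower (lower A j) i)) \<in> EC_path_relations n"
proof -
  have arr: "arrow_path (EC_quiver n) d = (dom d, [d], ran d)" for d
    by (simp add: arrow_path_def EC_quiver_def)
  have m: "i \<in> lower A j" "j \<in> lower A i" using assms(2-5) by (auto simp: lower_def)
  have "(A, [d_mor A j, d_mor (lower A j) i], lower (lower A j) i) =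
      Comp (path_cat n) (arrow_path (EC_quiver n) (d_mor (lower A j) i)) (arrow_path (EC_quiver n) (d_mor A j))"
    "(A, [d_mor A i, d_mor (lower A i) j], lower (lower A j) i) =
      Comp (path_cat n) (arrow_path (EC_quiver n) (d_mor (lower A i) j)) (arrow_path (EC_quiver n) (d_mor A i))"
    using assms m lower_commute[of i j A] by (simp_all add: arr path_comp dom_d_mor ran_d_mor)
  then show ?thesis
    unfolding EC_path_relations_def Let_def using assms by blast
qed

lemma braid_in_EC_path_relations:
  assumes "A \<subseteq> {1..n}" "i \<in> A" "i + 1 \<in> A" "2 \<le> i"
  shows "((A, [d_mor A (i + 1), d_mor (lower A (i + 1)) i], lower (lower A (i + 1)) i),
      (A, [d_mor A i, d_mor (lower A i) (i + 1), d_mor (lower (lower A i) (i + 1)) i],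
        lower (lower A (i + 1)) i)) \<in> EC_path_relations n"
proof -
  have arr: "arrow_path (EC_quiver n) d = (dom d, [d], ran d)" for d
    by (simp add: arrow_path_def EC_quiver_def)
  have m: "i \<in> lower A (i + 1)" "i \<in> lower (lower A i) (i + 1)"
    using assms(2-4) by (auto simp: lower_def)
  have "(A, [d_mor A (i + 1), d_mor (lower A (i + 1)) i], lower (lower A (i + 1)) i) =
      Comp (path_cat n) (arrow_path (EC_quiver n) (d_mor (lower A (i + 1)) i))
        (arrow_path (EC_quiver n) (d_mor A (i + 1)))"
    "(A, [d_mor A i, d_mor (lower A i) (i + 1), d_mor (lower (lower A i) (i + 1)) i],
        lower (lower A (i + 1)) i) =
      Comp (path_cat n) (arrow_path (EC_quiver n) (d_mor (lower (lower A i) (i + 1)) i))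
        (Comp (path_cat n) (arrow_path (EC_quiver n) (d_mor (lower A i) (i + 1)))
          (arrow_path (EC_quiver n) (d_mor A i)))"
    using assms m lower_braid[of i A] by (simp_all add: arr path_comp dom_d_mor ran_d_mor)
  then show ?thesis
    unfolding EC_path_relations_def Let_def using assms by blast
qed

text \<open>Soundness of the relations: by \<open>d_mor_commute\<close> and
  \<open>d_mor_braid\<close>, parallel paths with equal value.\<close>

lemma EC_path_relations_hom:
  assumes "(\<pi>, \<rho>) \<in> EC_path_relations n"
  shows "\<exists>B C. B \<subseteq> {1..n} \<and> C \<subseteq> {1..n} \<and> \<pi> \<in> cat_hom (path_cat n) B C \<and> \<rho> \<in> cat_hom (path_cat n) B C
    \<and> eval_path \<pi> = eval_path \<rho>"
  using assms
proof (cases rule: EC_path_relations_cases)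
  case (commute A i j)
  have j2: "2 \<le> j" using commute(5) by simp
  have m: "i \<in> lower A j" "j \<in> lower A i" using commute(2-5) by (auto simp: lower_def)
  note Ai = lower_subset[OF commute(1,2,4)] and Aj = lower_subset[OF commute(1,3) j2]
  have C: "lower (lower A j) i \<subseteq> {1..n}" by (rule lower_subset[OF Aj m(1) commute(4)])
  have arcs: "d_mor A j \<in> arcs (EC_quiver n)" "d_mor A i \<in> arcs (EC_quiver n)"
    "d_mor (lower A j) i \<in> arcs (EC_quiver n)" "d_mor (lower A i) j \<in> arcs (EC_quiver n)"
    using commute(1-4) j2 m Ai Aj unfolding arcs_EC_quiver_iff by metis+
  have l: "lower (lower A i) j = lower (lower A j) i"
    using lower_commute[of i j A] commute(4,5) j2 by simp
  have "\<pi> \<in> cat_hom (path_cat n) A (lower (lower A j) i)" "\<rho> \<in> cat_hom (path_cat n) A (lower (lower A j) i)"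
    unfolding path_hom_iff commute(6,7)
    using commute(2-4) j2 arcs m l C by (simp_all add: dom_d_mor ran_d_mor del: One_nat_def)
  moreover have "eval_path \<pi> = eval_path \<rho>"
    using d_mor_commute[OF commute(2-5)] commute(2-4) j2 m l
    by (simp add: commute(6,7) eval_path_def ran_d_mor map_comp_assoc)
  ultimately show ?thesis using commute(1) C by blast
next
  case (braid A i)
  have i2: "2 \<le> i + 1" using braid(4) by simp
  have m: "i \<in> lower A (i + 1)" "i + 1 \<in> lower A i" "i \<in> lower (lower A i) (i + 1)"
    using braid(2-4) by (auto simp: lower_def)
  note Ai = lower_subset[OF braid(1,2,4)] and Aj = lower_subset[OF braid(1,3) i2]
  note Aij = lower_subset[OF Ai m(2) i2]
  have C: "lower (lower A (i + 1)) i \<subseteq> {1..n}" by (rule lower_subset[OF Aj m(1) braid(4)])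
  have arcs: "d_mor A (i + 1) \<in> arcs (EC_quiver n)" "d_mor A i \<in> arcs (EC_quiver n)"
    "d_mor (lower A (i + 1)) i \<in> arcs (EC_quiver n)" "d_mor (lower A i) (i + 1) \<in> arcs (EC_quiver n)"
    "d_mor (lower (lower A i) (i + 1)) i \<in> arcs (EC_quiver n)"
    using braid(1-4) i2 m Ai Aj Aij unfolding arcs_EC_quiver_iff by metis+
  note l = lower_braid[OF braid(2,4)]
  note dr = dom_d_mor[OF braid(2)] dom_d_mor[OF braid(3)] dom_d_mor[OF m(1)] dom_d_mor[OF m(2)]
    dom_d_mor[OF m(3)] ran_d_mor[OF braid(2,4)] ran_d_mor[OF braid(3) i2] ran_d_mor[OF m(1) braid(4)]
    ran_d_mor[OF m(2) i2] ran_d_mor[OF m(3) braid(4)]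
  have "\<pi> \<in> cat_hom (path_cat n) A (lower (lower A (i + 1)) i)"
    "\<rho> \<in> cat_hom (path_cat n) A (lower (lower A (i + 1)) i)"
    unfolding braid(5,6) path_in_hom using arcs C
    by (simp_all only: dr l EC_walk_Cons EC_walk_Nil simp_thms)
  moreover have "eval_path \<pi> = eval_path \<rho>"
    unfolding braid(5,6) eval_path_def prod.case eval_walk.simps dr l map_comp_assoc
    using d_mor_braid[OF braid(2-4)] by simp
  ultimately show ?thesis using braid(1) C by blast
qed

section \<open>Completeness: an arbitrary linear congruence containing the relations\<close>

context
  fixes \<theta> :: "nat set \<Rightarrow> nat set \<Rightarrow>
      (((nat set, nat \<rightharpoonup> nat) path \<Rightarrow>\<^sub>0 'k::field) \<times> ((nat set, nat \<rightharpoonup> nat) path \<Rightarrow>\<^sub>0 'k)) set"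
    and n :: nat
  assumes cong: "linear_congruence (linearization (path_cat n)) \<theta>"
    and contains: "contains_relation (linearization (path_cat n)) (EC_relations n) \<theta>"
begin

private lemma theta_equiv:
  "B \<subseteq> {1..n} \<Longrightarrow> C \<subseteq> {1..n} \<Longrightarrow> equiv (LHom (linearization (path_cat n)) B C) (\<theta> B C)"
  by (rule linear_congruenceD(1)[OF cong]) simp_all

private lemma theta_comp:
  "B \<subseteq> {1..n} \<Longrightarrow> C \<subseteq> {1..n} \<Longrightarrow> D \<subseteq> {1..n} \<Longrightarrow> (g, g') \<in> \<theta> C D \<Longrightarrow> (f, f') \<in> \<theta> B C \<Longrightarrow>
   (bilin_ext (\<lambda>x y. True) (Comp (path_cat n)) g f, bilin_ext (\<lambda>x y. True) (Comp (path_cat n)) g' f')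
     \<in> \<theta> B D"
  using linear_congruenceD(2)[OF cong, of B C D g g' f f'] by simp

private lemma theta_add:
  "B \<subseteq> {1..n} \<Longrightarrow> C \<subseteq> {1..n} \<Longrightarrow> (f, f') \<in> \<theta> B C \<Longrightarrow> (g, g') \<in> \<theta> B C \<Longrightarrow> (f + g, f' + g') \<in> \<theta> B C"
  using linear_congruenceD(3)[OF cong, of B C f f' g g'] by simp

private lemma theta_scale:
  "B \<subseteq> {1..n} \<Longrightarrow> C \<subseteq> {1..n} \<Longrightarrow> (f, f') \<in> \<theta> B C \<Longrightarrow> (scale_pm t f, scale_pm t f') \<in> \<theta> B C"
  using linear_congruenceD(4)[OF cong, of B C f f' t] by simp

private lemma theta_refl:
  assumes "B \<subseteq> {1..n}" "C \<subseteq> {1..n}" "Poly_Mapping.keys f \<subseteq> cat_hom (path_cat n) B C"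
  shows "(f, f) \<in> \<theta> B C"
  using equiv_class_self[OF theta_equiv[OF assms(1,2)], of f] assms(3)
  by (simp add: LHom_linearization)

private lemma theta_sym:
  assumes "B \<subseteq> {1..n}" "C \<subseteq> {1..n}" "(f, g) \<in> \<theta> B C"
  shows "(g, f) \<in> \<theta> B C"
proof -
  have "sym (\<theta> B C)" using theta_equiv[OF assms(1,2)] by (simp add: equiv_def)
  then show ?thesis using assms(3) by (rule symD)
qed

private lemma theta_trans:
  assumes "B \<subseteq> {1..n}" "C \<subseteq> {1..n}" "(f, g) \<in> \<theta> B C" "(g, h) \<in> \<theta> B C"
  shows "(f, h) \<in> \<theta> B C"
proof -
  have "trans (\<theta> B C)" using theta_equiv[OF assms(1,2)] by (simp add: equiv_def)
  then show ?thesis using assms(3,4) by (rule transD)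
qed

private lemma EC_walk_ends: "EC_walk n B p C \<Longrightarrow> B \<subseteq> {1..n} \<and> C \<subseteq> {1..n}"
  using eval_walk[of n B p C] by (simp add: Mor_EC_iff)

private abbreviation path_vec :: "(nat set, nat \<rightharpoonup> nat) path \<Rightarrow> ((nat set, nat \<rightharpoonup> nat) path \<Rightarrow>\<^sub>0 'k)" where
  "path_vec \<pi> \<equiv> Poly_Mapping.single \<pi> 1"

private lemma theta_comp_path:
  assumes "(path_vec (C, q, D), path_vec (C, q', D)) \<in> \<theta> C D"
    and "(path_vec (B, p, C), path_vec (B, p', C)) \<in> \<theta> B C"
    and "B \<subseteq> {1..n}" "C \<subseteq> {1..n}" "D \<subseteq> {1..n}"
  shows "(path_vec (B, p @ q, D), path_vec (B, p' @ q', D)) \<in> \<theta> B D"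
  using theta_comp[OF assms(3-5,1,2)] by (simp add: bilin_ext_single path_comp)

private lemma theta_refl_path:
  assumes "EC_walk n B p C"
  shows "(path_vec (B, p, C), path_vec (B, p, C)) \<in> \<theta> B C"
proof (rule theta_refl)
  show "Poly_Mapping.keys (path_vec (B, p, C)) \<subseteq> cat_hom (path_cat n) B C"
    by (rule keys_single_subset) (simp add: path_in_hom assms)
qed (use EC_walk_ends[OF assms] in simp_all)

private lemma theta_relation:
  assumes "((B, p, C), (B, q, C)) \<in> EC_path_relations n"
  shows "(path_vec (B, p, C), path_vec (B, q, C)) \<in> \<theta> B C" "B \<subseteq> {1..n}" "C \<subseteq> {1..n}"
    "EC_walk n B p C" "EC_walk n B q C"
proof -
  from EC_path_relations_hom[OF assms] show BC: "B \<subseteq> {1..n}" "C \<subseteq> {1..n}"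
    and w: "EC_walk n B p C" "EC_walk n B q C" by (auto simp: path_hom_iff)
  have "(path_vec (B, p, C), path_vec (B, q, C)) \<in> EC_relations n"
    unfolding EC_relations_def using assms by blast
  moreover have "path_vec (B, p, C) \<in> LHom (linearization (path_cat n)) B C"
    "path_vec (B, q, C) \<in> LHom (linearization (path_cat n)) B C"
    using w by (simp_all add: LHom_linearization path_in_hom)
  ultimately show "(path_vec (B, p, C), path_vec (B, q, C)) \<in> \<theta> B C"
    using contains BC unfolding contains_relation_def by auto
qed

text \<open>The conditions on B and C belong to the relation because the congruence is controlled
  only on objects.\<close>

private lemma walk_congruence_theta:
  "walk_congruence n (\<lambda>B C p q. B \<subseteq> {1..n} \<and> C \<subseteq> {1..n} \<and>
     (path_vec (B, p, C), path_vec (B, q, C)) \<in> \<theta> B C)"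
proof
  fix B C p assume "EC_walk n B p C"
  then show "B \<subseteq> {1..n} \<and> C \<subseteq> {1..n} \<and> (path_vec (B, p, C), path_vec (B, p, C)) \<in> \<theta> B C"
    using EC_walk_ends theta_refl_path by blast
next
  fix B C p q
  assume "B \<subseteq> {1..n} \<and> C \<subseteq> {1..n} \<and> (path_vec (B, p, C), path_vec (B, q, C)) \<in> \<theta> B C"
  then show "B \<subseteq> {1..n} \<and> C \<subseteq> {1..n} \<and> (path_vec (B, q, C), path_vec (B, p, C)) \<in> \<theta> B C"
    using theta_sym by blast
next
  fix B C p q r
  assume "B \<subseteq> {1..n} \<and> C \<subseteq> {1..n} \<and> (path_vec (B, p, C), path_vec (B, q, C)) \<in> \<theta> B C"
    "B \<subseteq> {1..n} \<and> C \<subseteq> {1..n} \<and> (path_vec (B, q, C), path_vec (B, r, C)) \<in> \<theta> B C"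
  then show "B \<subseteq> {1..n} \<and> C \<subseteq> {1..n} \<and> (path_vec (B, p, C), path_vec (B, r, C)) \<in> \<theta> B C"
    using theta_trans by blast
next
  fix d p q C
  assume d: "d \<in> arcs (EC_quiver n)" and p: "EC_walk n (ran d) p C"
    and pq: "ran d \<subseteq> {1..n} \<and> C \<subseteq> {1..n} \<and>
      (path_vec (ran d, p, C), path_vec (ran d, q, C)) \<in> \<theta> (ran d) C"
  have w: "EC_walk n (dom d) [d] (ran d)" using d pq by simp
  then have "dom d \<subseteq> {1..n}" using EC_walk_ends by blast
  then show "dom d \<subseteq> {1..n} \<and> C \<subseteq> {1..n} \<and>
      (path_vec (dom d, d # p, C), path_vec (dom d, d # q, C)) \<in> \<theta> (dom d) C"
    \<comment> \<open>Prefixing d is composition on the right with a path congruent to itself;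
      appending r below is the same on the left.\<close>
    using theta_comp_path[OF _ theta_refl_path[OF w], of p C q] pq by simp
next
  fix A i j r C
  assume "A \<subseteq> {1..n}" "i \<in> A" "j \<in> A" "2 \<le> i" "i + 1 < j"
    and r: "EC_walk n (lower (lower A j) i) r C"
  note rel = theta_relation[OF commute_in_EC_path_relations[OF this(1-5)]]
  show "A \<subseteq> {1..n} \<and> C \<subseteq> {1..n} \<and> (path_vec (A, d_mor A j # d_mor (lower A j) i # r, C),
      path_vec (A, d_mor A i # d_mor (lower A i) j # r, C)) \<in> \<theta> A C"
    using theta_comp_path[OF theta_refl_path[OF r] rel(1-3)] EC_walk_ends[OF r] rel(2) by simp
next
  fix A i r C
  assume "A \<subseteq> {1..n}" "i \<in> A" "i + 1 \<in> A" "2 \<le> i"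
    and r: "EC_walk n (lower (lower A (i + 1)) i) r C"
  note rel = theta_relation[OF braid_in_EC_path_relations[OF this(1-4)]]
  show "A \<subseteq> {1..n} \<and> C \<subseteq> {1..n} \<and> (path_vec (A, d_mor A (i + 1) # d_mor (lower A (i + 1)) i # r, C),
      path_vec (A, d_mor A i # d_mor (lower A i) (i + 1) # d_mor (lower (lower A i) (i + 1)) i # r, C))
      \<in> \<theta> A C"
    using theta_comp_path[OF theta_refl_path[OF r] rel(1-3)] EC_walk_ends[OF r] rel(2) by simp
qed

text \<open>A path is congruent to the chosen walk with its value, and linearity extends this to
  combinations. The right-hand side is a normal form that depends only on
  \<open>eval_lin p\<close>.\<close>

private lemma theta_choice:
  assumes BC: "B \<subseteq> {1..n}" "C \<subseteq> {1..n}" and p: "Poly_Mapping.keys p \<subseteq> cat_hom (path_cat n) B C"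
  shows "(p, lin_ext (\<lambda>f. path_vec (choice_path n f)) (eval_lin p)) \<in> \<theta> B C"
  using p
proof (induction p rule: poly_mapping_span_induct)
  case zero
  then show ?case using theta_refl[OF BC, of 0] by (simp add: eval_lin_def)
next
  case (add p q)
  then show ?case using theta_add[OF BC add(3,4)] by (simp add: eval_lin_def lin_ext_add)
next
  case (single \<pi> c)
  have f: "eval_path \<pi> \<in> EC_hom n B C" by (rule eval_path_in_EC_hom[OF single])
  obtain q where q: "choice_path n (eval_path \<pi>) = (B, q, C)" "EC_walk n B q C"
    using choice_path(1)[OF f] unfolding path_hom_iff by blast
  obtain r where r: "\<pi> = (B, r, C)" "EC_walk n B r C" using single unfolding path_hom_iff by blast
  have "eval_walk B r = eval_walk B q"
    using choice_path(2)[OF f] unfolding q(1) by (simp add: r eval_path_def)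
  then have "(path_vec (B, r, C), path_vec (B, q, C)) \<in> \<theta> B C"
    using walk_congruence.eval_walk_eq_imp_related[OF walk_congruence_theta r(2) q(2)] by blast
  from theta_scale[OF BC this, of c] show ?case
    unfolding q(1)[symmetric] r(1)[symmetric] by (simp add: eval_lin_def)
qed

lemma eval_lin_eq_imp_congruent:
  assumes BC: "B \<subseteq> {1..n}" "C \<subseteq> {1..n}"
    and "Poly_Mapping.keys p \<subseteq> cat_hom (path_cat n) B C" "Poly_Mapping.keys q \<subseteq> cat_hom (path_cat n) B C"
    and "eval_lin p = eval_lin q"
  shows "(p, q) \<in> \<theta> B C"
  using theta_trans[OF BC theta_choice[OF BC assms(3)],
      OF theta_sym[OF BC theta_choice[OF BC assms(4)], folded assms(5)]] .

end

section \<open>Evaluation as a full linear functor into the algebra\<close>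

context EC_algebra
begin

definition realize :: "nat set \<Rightarrow> nat set \<Rightarrow> ((nat set, nat \<rightharpoonup> nat) path \<Rightarrow>\<^sub>0 'k) \<Rightarrow> 'a" where
  "realize B C p = elt (eval_lin p)"

lemma EC_hom_subset: "EC_hom n B C \<subseteq> Mor (EC n)"
  by (rule subsetI) (simp add: EC_hom_iff)

lemma keys_eval_lin_Mor:
  "Poly_Mapping.keys p \<subseteq> cat_hom (path_cat n) B C \<Longrightarrow> Poly_Mapping.keys (eval_lin p) \<subseteq> Mor (EC n)"
  using keys_eval_lin EC_hom_subset by (rule order_trans)

lemma LHom_lin_cat_of_algebra:
  assumes "B \<subseteq> {1..n}" "C \<subseteq> {1..n}"
  shows "LHom (lin_cat_of_algebra A E) (vertex B) (vertex C) = span (EC_hom n B C)"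
proof -
  have "LHom (lin_cat_of_algebra A E) (vertex B) (vertex C) =
      {vertex C \<otimes> x \<otimes> vertex B |x. x \<in> span (Mor (EC n))}"
    by (simp add: lin_cat_of_algebra_def carrier_eq_span)
  also have "\<dots> = span (Mor (EC n) \<inter> EC_hom n B C)"
    by (rule corner_span[OF assms order_refl])
  also have "Mor (EC n) \<inter> EC_hom n B C = EC_hom n B C"
    using EC_hom_subset by (rule inf_absorb2)
  finally show ?thesis .
qed

text \<open>Compatibility with products and scalars is tested on coordinates, where
  \<open>co\<close> is injective; fullness comes from \<open>choice_lin\<close>.\<close>

lemma full_linear_functor_realize:
  "full_linear_functor (linearization (path_cat n)) (lin_cat_of_algebra A (vertex ` Pow {1..n})) vertex realize"
    (is "full_linear_functor ?L ?D _ _")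
proof
  show "bij_betw vertex (LObj ?L) (LObj ?D)"
    using inj_on_vertex by (simp add: lin_cat_of_algebra_def bij_betw_def)
next
  fix B assume B: "B \<in> LObj ?L"
  then have BM: "Some |` B \<in> Mor (EC n)" by (simp add: id_in_Mor_EC)
  have I: "Ident (path_cat n) B = (B, [], B)" by (simp add: free_category_def)
  show "LIdent ?L B \<in> LHom ?L B B"
    unfolding LHom_linearization linearization_sel I
    by (rule keys_single_subset) (use B in \<open>simp add: path_in_hom\<close>)
  show "realize B B (LIdent ?L B) = LIdent ?D (vertex B)"
    by (simp add: realize_def eval_lin_def I eval_path_def lin_cat_of_algebra_def basis_def)
next
  fix B C D p q
  assume obj: "B \<in> LObj ?L" "C \<in> LObj ?L" "D \<in> LObj ?L" and "p \<in> LHom ?L C D" "q \<in> LHom ?L B C"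
  then have p: "Poly_Mapping.keys p \<subseteq> cat_hom (path_cat n) C D"
    and q: "Poly_Mapping.keys q \<subseteq> cat_hom (path_cat n) B C" by (simp_all add: LHom_linearization)
  let ?pq = "bilin_ext (\<lambda>x y. True) (Comp (path_cat n)) p q"
  have pq: "Poly_Mapping.keys ?pq \<subseteq> cat_hom (path_cat n) B D"
    by (rule keys_bilin_ext_subset) (rule path_comp_in_hom(1)[OF subsetD[OF p] subsetD[OF q]])
  then show "LComp ?L B C D p q \<in> LHom ?L B D" by (simp add: LHom_linearization)
  have "co (elt (eval_lin ?pq)) = co (elt (eval_lin p) \<otimes> elt (eval_lin q))"
    using keys_eval_lin_Mor[OF pq] keys_eval_lin_Mor[OF p] keys_eval_lin_Mor[OF q]
    by (simp add: co_mult eval_lin_comp[OF p q])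
  then have "elt (eval_lin ?pq) = elt (eval_lin p) \<otimes> elt (eval_lin q)"
    using keys_eval_lin_Mor[OF pq] keys_eval_lin_Mor[OF p] keys_eval_lin_Mor[OF q]
    by (subst (asm) co_inject) simp_all
  then show "realize B D (LComp ?L B C D p q) =
      LComp ?D (vertex B) (vertex C) (vertex D) (realize C D p) (realize B C q)"
    by (simp add: realize_def lin_cat_of_algebra_def)
next
  fix B C p q assume obj: "B \<in> LObj ?L" "C \<in> LObj ?L" and "p \<in> LHom ?L B C" "q \<in> LHom ?L B C"
  then have p: "Poly_Mapping.keys p \<subseteq> cat_hom (path_cat n) B C"
    and q: "Poly_Mapping.keys q \<subseteq> cat_hom (path_cat n) B C" by (simp_all add: LHom_linearization)
  show "LAdd ?L B C p q \<in> LHom ?L B C"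
    using keys_add_subset[OF p q] by (simp add: LHom_linearization)
  have "eval_lin (p + q) = eval_lin p + eval_lin q" by (simp add: eval_lin_def lin_ext_add)
  then show "realize B C (LAdd ?L B C p q) =
      LAdd ?D (vertex B) (vertex C) (realize B C p) (realize B C q)"
    using elt_add[OF keys_eval_lin_Mor[OF p] keys_eval_lin_Mor[OF q]]
    by (simp add: realize_def lin_cat_of_algebra_def)
next
  fix B C t p assume obj: "B \<in> LObj ?L" "C \<in> LObj ?L" and "p \<in> LHom ?L B C"
  then have p: "Poly_Mapping.keys p \<subseteq> cat_hom (path_cat n) B C" by (simp add: LHom_linearization)
  have tp: "Poly_Mapping.keys (scale_pm t p) \<subseteq> cat_hom (path_cat n) B C"
    using keys_scale_pm_subset p by (rule order_trans)
  then show "LScale ?L B C t p \<in> LHom ?L B C" by (simp add: LHom_linearization)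
  have "co (elt (eval_lin (scale_pm t p))) = co (t \<odot> elt (eval_lin p))"
    unfolding co_elt[OF keys_eval_lin_Mor[OF tp]] co_smult[OF elt_closed[OF keys_eval_lin_Mor[OF p]]]
      co_elt[OF keys_eval_lin_Mor[OF p]]
    by (simp add: eval_lin_def lin_ext_scale)
  then have "elt (eval_lin (scale_pm t p)) = t \<odot> elt (eval_lin p)"
    using keys_eval_lin_Mor[OF tp] keys_eval_lin_Mor[OF p] by (subst (asm) co_inject) simp_all
  then show "realize B C (LScale ?L B C t p) = LScale ?D (vertex B) (vertex C) t (realize B C p)"
    by (simp add: realize_def lin_cat_of_algebra_def)
next
  fix B C assume obj: "B \<in> LObj ?L" "C \<in> LObj ?L"
  then have D: "LHom ?D (vertex B) (vertex C) = span (EC_hom n B C)"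
    by (intro LHom_lin_cat_of_algebra) simp_all
  show "realize B C ` LHom ?L B C = LHom ?D (vertex B) (vertex C)"
    unfolding D
  proof
    show "realize B C ` LHom ?L B C \<subseteq> span (EC_hom n B C)"
    proof (rule image_subsetI)
      fix p assume "p \<in> LHom ?L B C"
      then have p: "Poly_Mapping.keys p \<subseteq> cat_hom (path_cat n) B C" by (simp add: LHom_linearization)
      show "realize B C p \<in> span (EC_hom n B C)"
        using keys_eval_lin[OF p] keys_eval_lin_Mor[OF p] by (simp add: realize_def span_def)
    qed
    show "span (EC_hom n B C) \<subseteq> realize B C ` LHom ?L B C"
    proof
      fix y assume "y \<in> span (EC_hom n B C)"
      then have y: "y \<in> carrier A" "Poly_Mapping.keys (co y) \<subseteq> EC_hom n B C" by (simp_all add: span_def)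
      note c = choice_lin[OF y(2)]
      show "y \<in> realize B C ` LHom ?L B C"
        by (rule image_eqI[OF _ iffD2[OF LHom_linearization c(1)]]) (simp add: realize_def c(2) y(1))
    qed
  qed
qed

lemma realize_eq_iff:
  assumes "Poly_Mapping.keys p \<subseteq> cat_hom (path_cat n) B C" "Poly_Mapping.keys q \<subseteq> cat_hom (path_cat n) B C"
  shows "realize B C p = realize B C q \<longleftrightarrow> eval_lin p = eval_lin q"
  unfolding realize_def
  using co_elt[OF keys_eval_lin_Mor[OF assms(1)]] co_elt[OF keys_eval_lin_Mor[OF assms(2)]] by metis

lemma relation_on_path_cat:
  "relation_on_lin_cat (linearization (path_cat n)) (EC_relations n ::
     (((nat set, nat \<rightharpoonup> nat) path \<Rightarrow>\<^sub>0 'k) \<times> ((nat set, nat \<rightharpoonup> nat) path \<Rightarrow>\<^sub>0 'k)) set)"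
  unfolding relation_on_lin_cat_def
proof (intro ballI, unfold case_prod_unfold)
  fix r :: "((nat set, nat \<rightharpoonup> nat) path \<Rightarrow>\<^sub>0 'k) \<times> ((nat set, nat \<rightharpoonup> nat) path \<Rightarrow>\<^sub>0 'k)"
  assume "r \<in> EC_relations n"
  then obtain \<pi> \<rho> where r: "r = (Poly_Mapping.single \<pi> 1, Poly_Mapping.single \<rho> 1)"
    and rel: "(\<pi>, \<rho>) \<in> EC_path_relations n" unfolding EC_relations_def by blast
  from EC_path_relations_hom[OF rel] obtain B C where "B \<subseteq> {1..n}" "C \<subseteq> {1..n}" "\<pi> \<in> cat_hom (path_cat n) B C" "\<rho> \<in> cat_hom (path_cat n) B C"
    by blast
  then show "\<exists>a\<in>LObj (linearization (path_cat n)). \<exists>b\<in>LObj (linearization (path_cat n)).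
      fst r \<in> LHom (linearization (path_cat n)) a b \<and> snd r \<in> LHom (linearization (path_cat n)) a b"
    by (intro bexI[of _ B] bexI[of _ C]) (simp_all add: r LHom_linearization)
qed

text \<open>The kernel of evaluation contains the relations by soundness, and lies in every
  congruence containing them by completeness.\<close>

lemma generated_congruence_eq:
  assumes BC: "B \<subseteq> {1..n}" "C \<subseteq> {1..n}"
  shows "generated_congruence (linearization (path_cat n)) (EC_relations n) B C =
    kernel_pair (linearization (path_cat n)) realize B C"
proof (rule generated_congruence_eqI)
  interpret full_linear_functor "linearization (path_cat n)"
    "lin_cat_of_algebra A (vertex ` Pow {1..n})" vertex realize
    by (rule full_linear_functor_realize)
  show "linear_congruence (linearization (path_cat n)) (kernel_pair (linearization (path_cat n)) realize)"
    by (rule linear_congruence_kernel_pair)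
next
  show "contains_relation (linearization (path_cat n)) (EC_relations n)
      (kernel_pair (linearization (path_cat n)) realize)"
    unfolding contains_relation_def
  proof (intro ballI subsetI)
    fix B C and r :: "((nat set, nat \<rightharpoonup> nat) path \<Rightarrow>\<^sub>0 'k) \<times> ((nat set, nat \<rightharpoonup> nat) path \<Rightarrow>\<^sub>0 'k)"
    assume r: "r \<in> EC_relations n \<inter>
      (LHom (linearization (path_cat n)) B C \<times> LHom (linearization (path_cat n)) B C)"
    then obtain \<pi> \<rho> where \<pi>\<rho>: "r = (Poly_Mapping.single \<pi> 1, Poly_Mapping.single \<rho> 1)"
      and rel: "(\<pi>, \<rho>) \<in> EC_path_relations n" unfolding EC_relations_def by blast
    have "eval_path \<pi> = eval_path \<rho>" using EC_path_relations_hom[OF rel] by blast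
    then show "r \<in> kernel_pair (linearization (path_cat n)) realize B C"
      using r unfolding \<pi>\<rho> by (simp add: kernel_pair_def realize_def eval_lin_def)
  qed
next
  fix B C and \<theta> :: "nat set \<Rightarrow> nat set \<Rightarrow>
    (((nat set, nat \<rightharpoonup> nat) path \<Rightarrow>\<^sub>0 'k) \<times> ((nat set, nat \<rightharpoonup> nat) path \<Rightarrow>\<^sub>0 'k)) set"
  assume \<theta>: "linear_congruence (linearization (path_cat n)) \<theta>"
    "contains_relation (linearization (path_cat n)) (EC_relations n) \<theta>"
    and BC: "B \<in> LObj (linearization (path_cat n))" "C \<in> LObj (linearization (path_cat n))"
  show "kernel_pair (linearization (path_cat n)) realize B C \<subseteq> \<theta> B C"
  proof
    fix r assume "r \<in> kernel_pair (linearization (path_cat n)) realize B C"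
    then obtain p q where r: "r = (p, q)" and pq: "Poly_Mapping.keys p \<subseteq> cat_hom (path_cat n) B C"
      "Poly_Mapping.keys q \<subseteq> cat_hom (path_cat n) B C" "realize B C p = realize B C q"
      unfolding kernel_pair_def LHom_linearization by blast
    have "eval_lin p = eval_lin q" using realize_eq_iff[OF pq(1,2)] pq(3) by simp
    then show "r \<in> \<theta> B C"
      using eval_lin_eq_imp_congruent[OF \<theta>, of B C p q] pq(1,2) BC by (simp add: r)
  qed
qed (use BC in simp_all)

theorem quiver_presentation: "is_quiver_presentation A (EC_quiver n) (EC_relations n)"
  unfolding is_quiver_presentation_def
proof (intro conjI exI[of _ "vertex ` Pow {1..n}"] split_basic relation_on_path_cat
    complete_vertices is_quiver)
  interpret full_linear_functor "linearization (path_cat n)"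
    "lin_cat_of_algebra A (vertex ` Pow {1..n})" vertex realize
    by (rule full_linear_functor_realize)
  show "lin_cats_isomorphic
      (quotient_lin_cat (linearization (path_cat n))
        (generated_congruence (linearization (path_cat n)) (EC_relations n)))
      (lin_cat_of_algebra A (vertex ` Pow {1..n}))"
    by (rule quotient_isomorphic) (simp add: generated_congruence_eq)
qed

end

section \<open>The two algebras\<close>

lemma EC_algebra_category_algebra:
  "EC_algebra (category_algebra (EC n) :: ('k::field, (nat \<rightharpoonup> nat) \<Rightarrow>\<^sub>0 'k) module) n (\<lambda>x. x)"
proof -
  let ?u = "\<Sum>B\<in>Pow {1..n}. Poly_Mapping.single (Some |` B) (1 :: 'k)"
  have A: "category_algebra (EC n) = \<lparr>carrier = {p. Poly_Mapping.keys p \<subseteq> Mor (EC n)}, monoid.mult = cmul,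
      one = ?u, zero = 0, add = (+), module.smult = scale_pm\<rparr>"
    by (simp add: category_algebra_def) (simp add: EC_def)
  have "k_algebra (category_algebra (EC n) :: ('k, (nat \<rightharpoonup> nat) \<Rightarrow>\<^sub>0 'k) module)"
    unfolding A
  proof (rule k_algebra_bilin_ext)
    show "g \<circ>\<^sub>m f \<in> Mor (EC n)" if "g \<in> Mor (EC n)" "f \<in> Mor (EC n)" for g f
      using map_comp_in_Mor_EC that by blast
    \<comment> \<open>Both sides express composability of all three maps: a composite keeps the
      domain of its first and the range of its last map.\<close>
    show "dom h = ran g \<and> dom (h \<circ>\<^sub>m g) = ran f \<longleftrightarrow> dom g = ran f \<and> dom h = ran (g \<circ>\<^sub>m f)"
      for h g f :: "nat \<rightharpoonup> nat"
      using dom_map_comp_eq[of g h] ran_map_comp_eq[of f g] by (metis order_refl)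
    show "(h \<circ>\<^sub>m g) \<circ>\<^sub>m f = h \<circ>\<^sub>m (g \<circ>\<^sub>m f)" for h g f :: "nat \<rightharpoonup> nat" by (rule map_comp_assoc)
    show "Poly_Mapping.keys ?u \<subseteq> Mor (EC n)"
      by (intro keys_sum_subset keys_single_subset id_in_Mor_EC) simp
    fix f :: "nat \<rightharpoonup> nat" and c :: 'k assume f: "f \<in> Mor (EC n)"
    have "cmul ?u (Poly_Mapping.single f c) =
        (\<Sum>B\<in>Pow {1..n}. if B = ran f then Poly_Mapping.single f c else 0)"
      unfolding bilin_ext_sum_left
      by (rule sum.cong) (simp_all add: bilin_ext_single map_comp_id_left)
    also have "\<dots> = Poly_Mapping.single f c" using f by (simp add: Mor_EC_iff)
    finally show "cmul ?u (Poly_Mapping.single f c) = Poly_Mapping.single f c" .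
    have "cmul (Poly_Mapping.single f c) ?u =
        (\<Sum>B\<in>Pow {1..n}. if dom f = B then Poly_Mapping.single f c else 0)"
      unfolding bilin_ext_sum_right
      by (rule sum.cong) (simp_all add: bilin_ext_single map_comp_id_right)
    also have "\<dots> = Poly_Mapping.single f c" using f by (simp add: Mor_EC_iff)
    finally show "cmul (Poly_Mapping.single f c) ?u = Poly_Mapping.single f c" .
  qed
  then show ?thesis
    by (intro EC_algebra.intro EC_algebra_axioms.intro) (simp_all add: A bij_betw_def)
qed

text \<open>The isomorphism from the monoid algebra sends a partial function to the sum of its
  restrictions; it is unitriangular with respect to restriction.\<close>

definition restrictions :: "(nat \<rightharpoonup> nat) \<Rightarrow> ((nat \<rightharpoonup> nat) \<Rightarrow>\<^sub>0 'k::field)" where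
  "restrictions f = (\<Sum>B\<in>Pow (dom f). Poly_Mapping.single (f |` B) 1)"

lemma restrict_in_Mor_EC: "f \<in> Mor (EC n) \<Longrightarrow> f |` B \<in> Mor (EC n)"
proof -
  assume f: "f \<in> Mor (EC n)"
  have "dom (f |` B) \<subseteq> dom f" "ran (f |` B) \<subseteq> ran f"
    by (auto simp: restrict_map_def ran_def split: if_splits)
  then have "dom (f |` B) \<subseteq> {1..n}" "ran (f |` B) \<subseteq> {1..n}"
    using f unfolding Mor_EC_iff by blast+
  moreover have val: "f x = Some u" if "(f |` B) x = Some u" for x u
    using that by (simp add: restrict_map_def split: if_splits)
  ultimately show ?thesis
    using f unfolding Mor_EC_iff by (meson val)
qed

lemma keys_restrictions: "f \<in> Mor (EC n) \<Longrightarrow> Poly_Mapping.keys (restrictions f) \<subseteq> Mor (EC n)"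
  unfolding restrictions_def by (intro keys_sum_subset keys_single_subset restrict_in_Mor_EC)

lemma ran_restrict_subset_iff:
  "B \<subseteq> dom f \<Longrightarrow> ran (f |` B) \<subseteq> dom g \<longleftrightarrow> B \<subseteq> dom (g \<circ>\<^sub>m f)"
  by (fastforce simp: ran_def restrict_map_def dom_def map_comp_def split: option.splits if_splits)

lemma restrict_map_comp:
  "(g |` ran (f |` B)) \<circ>\<^sub>m (f |` B) = (g \<circ>\<^sub>m f) |` B"
  by (rule ext) (auto simp: map_comp_def restrict_map_def ran_def split: option.splits)

text \<open>Restrict f to B and let C be the range of the result. Only the restriction of g to C is
  composable with it, and C lies in the domain of g exactly when B lies in that of
  \<open>g \<circ>\<^sub>m f\<close>. The product is then the restriction of the composite to
  B.\<close>

lemma restrictions_comp: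
  assumes f: "f \<in> Mor (EC n)" and g: "g \<in> Mor (EC n)"
  shows "cmul (restrictions g) (restrictions f) = (restrictions (g \<circ>\<^sub>m f) :: _ \<Rightarrow>\<^sub>0 'k::field)"
proof -
  note fin = finite_dom_EC[OF f] finite_dom_EC[OF g]
  have inner: "(\<Sum>C\<in>Pow (dom g). cmul (Poly_Mapping.single (g |` C) (1 :: 'k)) (Poly_Mapping.single (f |` B) 1)) =
      (if B \<subseteq> dom (g \<circ>\<^sub>m f) then Poly_Mapping.single ((g \<circ>\<^sub>m f) |` B) 1 else 0)"
    if B: "B \<in> Pow (dom f)" for B
  proof -
    have "(\<Sum>C\<in>Pow (dom g). cmul (Poly_Mapping.single (g |` C) (1 :: 'k)) (Poly_Mapping.single (f |` B) 1)) =
        (\<Sum>C\<in>Pow (dom g). if C = ran (f |` B) then Poly_Mapping.single ((g \<circ>\<^sub>m f) |` B) 1 else 0)"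
    proof (rule sum.cong[OF HOL.refl])
      fix C assume "C \<in> Pow (dom g)"
      then have "dom (g |` C) = C" by auto
      then show "cmul (Poly_Mapping.single (g |` C) (1 :: 'k)) (Poly_Mapping.single (f |` B) 1) =
          (if C = ran (f |` B) then Poly_Mapping.single ((g \<circ>\<^sub>m f) |` B) 1 else 0)"
        using restrict_map_comp[of g f B] by (simp add: bilin_ext_single)
    qed
    also have "\<dots> = (if ran (f |` B) \<subseteq> dom g then Poly_Mapping.single ((g \<circ>\<^sub>m f) |` B) 1 else 0)"
      using fin(2) by simp
    finally show ?thesis using ran_restrict_subset_iff[of B f g] B by simp
  qed
  have "cmul (restrictions g) (restrictions f) = (\<Sum>B\<in>Pow (dom f). \<Sum>C\<in>Pow (dom g).
      cmul (Poly_Mapping.single (g |` C) (1 :: 'k)) (Poly_Mapping.single (f |` B) 1))"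
    unfolding restrictions_def bilin_ext_sum_right unfolding bilin_ext_sum_left ..
  also have "\<dots> = (\<Sum>B\<in>Pow (dom f).
      if B \<subseteq> dom (g \<circ>\<^sub>m f) then Poly_Mapping.single ((g \<circ>\<^sub>m f) |` B) 1 else 0)"
    by (rule sum.cong[OF HOL.refl]) (rule inner)
  also have "\<dots> = (\<Sum>B\<in>{B \<in> Pow (dom f). B \<subseteq> dom (g \<circ>\<^sub>m f)}. Poly_Mapping.single ((g \<circ>\<^sub>m f) |` B) 1)"
    by (rule sum.inter_filter[symmetric]) (simp add: fin)
  also have "{B \<in> Pow (dom f). B \<subseteq> dom (g \<circ>\<^sub>m f)} = Pow (dom (g \<circ>\<^sub>m f))"
  proof -
    have "dom (g \<circ>\<^sub>m f) \<subseteq> dom f" by (auto simp: map_comp_def dom_def split: option.splits)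
    then show ?thesis by blast
  qed
  finally show ?thesis unfolding restrictions_def .
qed

lemma lookup_restrictions_self:
  assumes "finite (dom f)"
  shows "Poly_Mapping.lookup (restrictions f) f = 1"
proof -
  have "Poly_Mapping.lookup (restrictions f) f = (\<Sum>B\<in>Pow (dom f). if B = dom f then 1 else 0)"
    unfolding restrictions_def lookup_sum
  proof (rule sum.cong[OF HOL.refl])
    fix B assume "B \<in> Pow (dom f)"
    then have "dom (f |` B) = B" by auto
    then have "f |` B = f \<longleftrightarrow> B = dom f"
      using map_restrict_dom[of f] by metis
    then show "Poly_Mapping.lookup (Poly_Mapping.single (f |` B) 1) f = (if B = dom f then 1 else 0)"
      by (simp add: lookup_single when_def)
  qed
  then show ?thesis using assms by simp
qed

text \<open>A proper restriction has a strictly smaller domain. Ordered by domain size, the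
  transition matrix is thus triangular.\<close>

lemma lookup_restrictions_eq_0:
  assumes "finite (dom g)" "card (dom g) \<le> card (dom f)" "g \<noteq> f"
  shows "Poly_Mapping.lookup (restrictions g) f = 0"
  unfolding restrictions_def lookup_sum
proof (rule sum.neutral, rule ballI)
  fix B assume B: "B \<in> Pow (dom g)"
  have "g |` B \<noteq> f"
  proof
    assume eq: "g |` B = f"
    have "dom f = B" using B unfolding eq[symmetric] by auto
    then have "B = dom g" using B assms(1,2) card_seteq by blast
    then show False using eq assms(3) map_restrict_dom[of g] by simp
  qed
  then show "Poly_Mapping.lookup (Poly_Mapping.single (g |` B) 1) f = 0"
    by (simp add: lookup_single when_def)
qed

text \<open>Triangularity is used twice: a key with largest domain detects a nonzero kernel element,
  and preimages are built by recursion on the size of the domain.\<close>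

lemma bij_betw_restrictions:
  "bij_betw (lin_ext restrictions) {p. Poly_Mapping.keys p \<subseteq> Mor (EC n)}
     {p :: (nat \<rightharpoonup> nat) \<Rightarrow>\<^sub>0 'k::field. Poly_Mapping.keys p \<subseteq> Mor (EC n)}"
  unfolding bij_betw_def
proof
  have ker: "p = 0" if p: "Poly_Mapping.keys p \<subseteq> Mor (EC n)" "lin_ext restrictions p = 0"
    for p :: "(nat \<rightharpoonup> nat) \<Rightarrow>\<^sub>0 'k"
  proof (rule ccontr)
    assume nz: "p \<noteq> 0"
    let ?m = "Max ((\<lambda>f. card (dom f)) ` Poly_Mapping.keys p)"
    have "?m \<in> (\<lambda>f. card (dom f)) ` Poly_Mapping.keys p"
      by (rule Max_in) (simp_all add: nz)
    then obtain f where f: "f \<in> Poly_Mapping.keys p" "card (dom f) = ?m" by (metis imageE)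
    have le: "card (dom g) \<le> card (dom f)" if "g \<in> Poly_Mapping.keys p" for g
      unfolding f(2) using that by (intro Max_ge) simp_all
    have fin: "finite (dom g)" if "g \<in> Poly_Mapping.keys p" for g
      using that p(1) finite_dom_EC by blast
    \<comment> \<open>No other key restricts to f, whose domain has maximal size, so the coefficient
      at f survives.\<close>
    have "Poly_Mapping.lookup (lin_ext restrictions p) f =
        (\<Sum>g\<in>Poly_Mapping.keys p. if g = f then Poly_Mapping.lookup p f else 0)"
      unfolding lin_ext_def lookup_sum
      by (rule sum.cong[OF HOL.refl])
        (simp add: lookup_restrictions_self[OF fin[OF f(1)]] lookup_restrictions_eq_0 fin le)
    then have "Poly_Mapping.lookup p f = 0" using p(2) f(1) by simp
    then show False using f(1) by (simp add: in_keys_iff)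
  qed
  show "inj_on (lin_ext restrictions) {p :: (nat \<rightharpoonup> nat) \<Rightarrow>\<^sub>0 'k. Poly_Mapping.keys p \<subseteq> Mor (EC n)}"
  proof (rule inj_onI)
    fix p q :: "(nat \<rightharpoonup> nat) \<Rightarrow>\<^sub>0 'k"
    assume "p \<in> {p. Poly_Mapping.keys p \<subseteq> Mor (EC n)}" "q \<in> {p. Poly_Mapping.keys p \<subseteq> Mor (EC n)}"
      "lin_ext restrictions p = lin_ext restrictions q"
    then have "p - q = 0" using ker[of "p - q"]
      by (simp add: keys_minus_subset lin_ext_minus)
    then show "p = q" by simp
  qed
  have single: "\<exists>p. Poly_Mapping.keys p \<subseteq> Mor (EC n) \<and> lin_ext restrictions p = Poly_Mapping.single f (1 :: 'k)"
    if "f \<in> Mor (EC n)" for f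
    using that
  proof (induction "card (dom f)" arbitrary: f rule: less_induct)
    case less
    note fin = finite_dom_EC[OF less.prems]
    have "\<exists>p. Poly_Mapping.keys p \<subseteq> Mor (EC n) \<and> lin_ext restrictions p = Poly_Mapping.single (f |` B) (1 :: 'k)"
      if "B \<in> Pow (dom f) - {dom f}" for B
    proof (rule less.hyps[OF _ restrict_in_Mor_EC[OF less.prems]])
      have "B \<subset> dom f" using that by blast
      moreover from this have "dom (f |` B) = B" by auto
      ultimately show "card (dom (f |` B)) < card (dom f)" using psubset_card_mono[OF fin] by simp
    qed
    then obtain P where P: "\<And>B. B \<in> Pow (dom f) - {dom f} \<Longrightarrow> Poly_Mapping.keys (P B) \<subseteq> Mor (EC n) \<and>
        lin_ext restrictions (P B) = Poly_Mapping.single (f |` B) (1 :: 'k)"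
      by metis
    \<comment> \<open>Proper restrictions already have preimages by induction; subtracting these
      isolates f.\<close>
    let ?p = "Poly_Mapping.single f 1 - (\<Sum>B\<in>Pow (dom f) - {dom f}. P B)"
    have "Poly_Mapping.keys ?p \<subseteq> Mor (EC n)"
      by (intro keys_minus_subset keys_sum_subset keys_single_subset less.prems conjunct1[OF P])
    moreover have "lin_ext restrictions ?p = restrictions f -
        (\<Sum>B\<in>Pow (dom f) - {dom f}. Poly_Mapping.single (f |` B) 1)"
      using P by (simp add: lin_ext_minus lin_ext_sum)
    moreover have "restrictions f = Poly_Mapping.single f 1 +
        (\<Sum>B\<in>Pow (dom f) - {dom f}. Poly_Mapping.single (f |` B) (1 :: 'k))"
      unfolding restrictions_def using fin
        sum.remove[of "Pow (dom f)" "dom f" "\<lambda>B. Poly_Mapping.single (f |` B) (1 :: 'k)"]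
      by (simp add: map_restrict_dom)
    ultimately show ?case by (intro exI[of _ ?p]) simp
  qed
  show "lin_ext restrictions ` {p. Poly_Mapping.keys p \<subseteq> Mor (EC n)} =
      {p :: (nat \<rightharpoonup> nat) \<Rightarrow>\<^sub>0 'k. Poly_Mapping.keys p \<subseteq> Mor (EC n)}"
  proof
    show "lin_ext restrictions ` {p. Poly_Mapping.keys p \<subseteq> Mor (EC n)} \<subseteq>
        {p :: (nat \<rightharpoonup> nat) \<Rightarrow>\<^sub>0 'k. Poly_Mapping.keys p \<subseteq> Mor (EC n)}"
    proof (intro image_subsetI CollectI)
      fix p :: "(nat \<rightharpoonup> nat) \<Rightarrow>\<^sub>0 'k" assume "p \<in> {p. Poly_Mapping.keys p \<subseteq> Mor (EC n)}"
      then have p: "Poly_Mapping.keys p \<subseteq> Mor (EC n)" by simp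
      show "Poly_Mapping.keys (lin_ext restrictions p) \<subseteq> Mor (EC n)"
        by (intro keys_lin_ext_subset keys_restrictions subsetD[OF p])
    qed
    obtain P where P: "\<And>f. f \<in> Mor (EC n) \<Longrightarrow> Poly_Mapping.keys (P f) \<subseteq> Mor (EC n) \<and>
        lin_ext restrictions (P f) = Poly_Mapping.single f (1 :: 'k)"
      using single by metis
    show "{p :: (nat \<rightharpoonup> nat) \<Rightarrow>\<^sub>0 'k. Poly_Mapping.keys p \<subseteq> Mor (EC n)} \<subseteq>
        lin_ext restrictions ` {p. Poly_Mapping.keys p \<subseteq> Mor (EC n)}"
    proof
      fix q :: "(nat \<rightharpoonup> nat) \<Rightarrow>\<^sub>0 'k" assume "q \<in> {p. Poly_Mapping.keys p \<subseteq> Mor (EC n)}"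
      then have q: "Poly_Mapping.keys q \<subseteq> Mor (EC n)" by simp
      have "lin_ext restrictions (lin_ext P q) = lin_ext (\<lambda>f. Poly_Mapping.single f 1) q"
        unfolding lin_ext_lin_ext by (rule lin_ext_cong) (use P q in blast)
      then have "q = lin_ext restrictions (lin_ext P q)" by (simp add: lin_ext_id)
      moreover have "Poly_Mapping.keys (lin_ext P q) \<subseteq> Mor (EC n)"
        by (intro keys_lin_ext_subset conjunct1[OF P] subsetD[OF q])
      ultimately show "q \<in> lin_ext restrictions ` {p. Poly_Mapping.keys p \<subseteq> Mor (EC n)}"
        by (intro image_eqI CollectI)
    qed
  qed
qed

lemma EC_algebra_monoid_algebra:
  "EC_algebra (monoid_algebra (PC n) :: ('k::field, (nat \<rightharpoonup> nat) \<Rightarrow>\<^sub>0 'k) module) n (lin_ext restrictions)"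
proof -
  let ?u = "Poly_Mapping.single (Some |` {1..n}) (1 :: 'k)"
  have A: "monoid_algebra (PC n) = \<lparr>carrier = {p. Poly_Mapping.keys p \<subseteq> Mor (EC n)},
      monoid.mult = bilin_ext (\<lambda>x y. True) (\<circ>\<^sub>m), one = ?u, zero = 0, add = (+), module.smult = scale_pm\<rparr>"
    by (simp add: monoid_algebra_def carrier_PC) (simp add: PC_def)
  have alg: "k_algebra (monoid_algebra (PC n) :: ('k, (nat \<rightharpoonup> nat) \<Rightarrow>\<^sub>0 'k) module)"
    unfolding A
  proof (rule k_algebra_bilin_ext)
    show "g \<circ>\<^sub>m f \<in> Mor (EC n)" if "g \<in> Mor (EC n)" "f \<in> Mor (EC n)" for g f
      using map_comp_in_Mor_EC that by blast
    show "(h \<circ>\<^sub>m g) \<circ>\<^sub>m f = h \<circ>\<^sub>m (g \<circ>\<^sub>m f)" for h g f :: "nat \<rightharpoonup> nat" by (rule map_comp_assoc)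
    show "Poly_Mapping.keys ?u \<subseteq> Mor (EC n)"
      by (intro keys_single_subset id_in_Mor_EC) simp
    fix f :: "nat \<rightharpoonup> nat" and c :: 'k assume f: "f \<in> Mor (EC n)"
    then have "dom f \<subseteq> {1..n}" "ran f \<subseteq> {1..n}" by (simp_all add: Mor_EC_iff)
    then show "bilin_ext (\<lambda>x y. True) (\<circ>\<^sub>m) ?u (Poly_Mapping.single f c) = Poly_Mapping.single f c"
      "bilin_ext (\<lambda>x y. True) (\<circ>\<^sub>m) (Poly_Mapping.single f c) ?u = Poly_Mapping.single f c"
      by (simp_all add: bilin_ext_single map_comp_id_left map_comp_id_right del: One_nat_def)
  qed simp
  have mult: "lin_ext restrictions (bilin_ext (\<lambda>x y. True) (\<circ>\<^sub>m) p q) =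
      cmul (lin_ext restrictions p) (lin_ext restrictions q)"
    if p: "Poly_Mapping.keys p \<subseteq> Mor (EC n)" and q: "Poly_Mapping.keys q \<subseteq> Mor (EC n)"
    for p q :: "(nat \<rightharpoonup> nat) \<Rightarrow>\<^sub>0 'k"
    using p
  proof (induction p rule: poly_mapping_span_induct)
    case (single g a)
    show ?case
      using q
    proof (induction q rule: poly_mapping_span_induct)
      case (single f b)
      show ?case
        using restrictions_comp[OF single \<open>g \<in> _\<close>, where 'k = 'k]
        by (simp add: bilin_ext_single bilin_ext_scale_left bilin_ext_scale_right ac_simps)
    qed (simp_all add: bilin_ext_add_right lin_ext_add)
  qed (simp_all add: bilin_ext_add_left lin_ext_add)
  \<comment> \<open>The restrictions of the identity on [n] are the identities of all objects, so
    the units correspond.\<close>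
  have one: "restrictions (Some |` {1..n}) = (\<Sum>B\<in>Pow {1..n}. Poly_Mapping.single (Some |` B) (1 :: 'k))"
    unfolding restrictions_def dom_restrict_Some
    by (rule sum.cong[OF HOL.refl]) (simp add: Int_absorb1)
  show ?thesis
  proof (intro EC_algebra.intro EC_algebra_axioms.intro alg)
    show "bij_betw (lin_ext restrictions) (carrier (monoid_algebra (PC n)))
        {p :: (nat \<rightharpoonup> nat) \<Rightarrow>\<^sub>0 'k. Poly_Mapping.keys p \<subseteq> Mor (EC n)}"
      using bij_betw_restrictions by (simp add: A)
  qed (simp_all add: A mult lin_ext_add lin_ext_scale one del: One_nat_def)
qed

theorem theorem4p22:
  fixes n :: nat
  assumes "n \<ge> 1"
  shows "is_quiver_presentation
           (monoid_algebra (PC n) :: ('k::field, (nat \<rightharpoonup> nat) \<Rightarrow>\<^sub>0 'k) module)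
           (EC_quiver n) (EC_relations n)
       \<and> is_quiver_presentation
           (category_algebra (EC n) :: ('k::field, (nat \<rightharpoonup> nat) \<Rightarrow>\<^sub>0 'k) module)
           (EC_quiver n) (EC_relations n)"
  by (intro conjI EC_algebra.quiver_presentation[OF EC_algebra_monoid_algebra]
      EC_algebra.quiver_presentation[OF EC_algebra_category_algebra])

end
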